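(* Assume: $\alpha_i>0$ for $i=1,2,3,4$ and $\tau_j>0$ for $j=1,2$; $h\in C^0(\mathbb{R}^m;\mathbb{R}^m)$; $\sigma$ is Lipschitz continuous and acts componentwise; $\sigma(0)=0$; $\mathcal{L}\ge0$ and $\mathcal{L}$ is continuous in its first argument. Let the matrix operator norm be used on $\mathbb{R}^{d\times d}$ in $R_n^{(1)}$ and $R_\infty^{(1)}$, and let $L_\sigma>0$ be a Lipschitz constant for $\sigma$. Let $\{(x_s,y_s)\}_{s=1}^S\subset\mathbb{R}^d\times\mathbb{R}^m$ be a set of training data and, for all $n\in\mathbb{N}$, let $(K^{(n)},b^{(n)},W^{(n)},c^{(n)})\in\Theta^{(n)}$ be a minimiser of $\mathcal{E}_n$. Let $x\in\mathbb{R}^d$. Let $(K,b,W,c)\in\Theta$ be the minimiser of $\mathcal{E}_\infty$, which is assumed to be unique. For all $n\in\mathbb{N}$ let $X_i^{(n)}$, $i\in\{0,1,\dots,n\}$, be the solution to \[ X_{i+1}^{(n)}=X_i^{(n)}+\tfrac1n\sigma(K_i^{(n)}X_i^{(n)}+b_i^{(n)}),\quad i=0,\dots,n-1,\qquad X_0^{(n)}=x, \] and let $X:[0,1]\to\mathbb{R}^d$ be the solution to $\dot X(t)=\sigma(K(t)X(t)+b(t))$, $t\in[0,1]$, with $X(0)=x$. Then, for all $\delta>0$, there exists an $N\in\mathbb{N}$ such that, for all $n\ge N$, there exists an $\varepsilon_n\in\mathbb{R}$ such that, for all $i\in\{0,1,\dots,n\}$, \[ \|X(i/n)-X_i^{(n)}\|\le\frac{n}{L_\sigma(\|K\|_{L^\infty}+\delta)}A_n\left[\exp\left(\frac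 in L_\sigma(\|K\|_{L^\infty}+\delta)\right)-1\right], \] where \[ A_n=\frac1n\left(1+\|X\|_{L^\infty}\right)L_\sigma\delta+\varepsilon_n. \] Moreover, $\varepsilon_n=o\left(\frac1n\right)$ as $n\to\infty$.
   Context: $\mathbb{N}=\{1,2,\dots\}$. Fix $d,m,S\in\mathbb{N}$, functions $\sigma:\mathbb{R}^d\to\mathbb{R}^d$, $h:\mathbb{R}^m\to\mathbb{R}^m$, $\mathcal{L}:\mathbb{R}^m\times\mathbb{R}^m\to\mathbb{R}$, weights $\alpha_1,\dots,\alpha_4,\tau_1,\tau_2$, norms $\|\cdot\|$ on $\mathbb{R}^d,\mathbb{R}^{m\times d},\mathbb{R}^m$, and the operator norm on $\mathbb{R}^{d\times d}$ (also used in $\|K\|_{L^\infty}$). "$\sigma$ acts componentwise" means $\sigma(x)=(\tilde\sigma(x_1),\dots,\tilde\sigma(x_d))^\top$ for some $\tilde\sigma:\mathbb{R}\to\mathbb{R}$. Parameter spaces. For $n\in\mathbb{N}$ let $\mu_n=\frac1n\sum_{i=0}^{n-1}\delta_{i/n}$; a function $K^{(n)}$ on $\{i/n\}_{i=0}^{n-1}$ is identified with the tuple $K^{(n)}_i=K^{(n)}(i/n)$. Set $\Theta^{(n)}=L^2(\mu_n;\mathbb{R}^{d\times d})\times L^2(\mu_n;\mathbb{R}^d)\times\mathbb{R}^{m\times d}\times\mathbb{R}^m$ and $\Theta=H^1([0,1];\mathbb{R}^{d\times d})\times H^1([0,1];\mathbb{R}^d)\times\mathbb{R}^{m\times d}\times\mathbb{R}^m$;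 $H^1$ functions are identified with their continuous representatives. Discrete functional. $X_i^{(n)}[x;K^{(n)},b^{(n)}]$ denotes the solution of $X_{i+1}^{(n)}=X_i^{(n)}+\frac1n\sigma(K_i^{(n)}X_i^{(n)}+b_i^{(n)})$, $X_0^{(n)}=x$; $R_n^{(1)}(K^{(n)})=n\sum_{i=1}^{n-1}\|K_i^{(n)}-K_{i-1}^{(n)}\|^2+\tau_1\|K_0^{(n)}\|^2$, $R_n^{(2)}(b^{(n)})=n\sum_{i=1}^{n-1}\|b_i^{(n)}-b_{i-1}^{(n)}\|^2+\tau_2\|b_0^{(n)}\|^2$, and $\mathcal{E}_n(K^{(n)},b^{(n)},W,c)=\sum_{s=1}^S\mathcal{L}(h(WX_n^{(n)}[x_s;K^{(n)},b^{(n)}]+c),y_s)+\alpha_1R_n^{(1)}(K^{(n)})+\alpha_2R_n^{(2)}(b^{(n)})+\alpha_3\|W\|^2+\alpha_4\|c\|^2$ on $\Theta^{(n)}$. Continuum functional. $X(\cdot;x,K,b)$ denotes the solution of $\dot X(t)=\sigma(K(t)X(t)+b(t))$ on $[0,1]$, $X(0)=x$; $R_\infty^{(1)}(K)=\|\dot K\|_{L^2}^2+\tau_1\|K(0)\|^2$, $R_\infty^{(2)}(b)=\|\dot b\|_{L^2}^2+\tau_2\|b(0)\|^2$, and $\mathcal{E}_\infty(K,b,W,c)=\sum_{s=1}^S\mathcal{L}(h(WX(1;x_s,K,b)+c),y_s)+\alpha_1R_\infty^{(1)}(K)+\alpha_2R_\infty^{(2)}(b)+\alpha_3\|W\|^2+\alpha_4\|c\|^2$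 on $\Theta$. *)

theory Defs
  imports "HOL-Analysis.Analysis" "HOL-Library.Landau_Symbols" "HOL-Probability.Essential_Supremum"
begin

section \<open>Norms\<close>

text \<open>The norms on \<open>\<real>\<^sup>d\<close>, \<open>\<real>\<^sup>m\<^sup>\<times>\<^sup>d\<close> and \<open>\<real>\<^sup>m\<close> are arbitrary, hence they are
  carried as parameters; the type class norm only serves to fix the (unique) finite-dimensional
  topology.\<close>

definition is_norm :: "('a::real_vector \<Rightarrow> real) \<Rightarrow> bool" where
  "is_norm N \<longleftrightarrow>
     (\<forall>x. 0 \<le> N x) \<and> (\<forall>x. N x = 0 \<longleftrightarrow> x = 0) \<and>
     (\<forall>a x. N (a *\<^sub>R x) = \<bar>a\<bar> * N x) \<and> (\<forall>x y. N (x + y) \<le> N x + N y)"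

text \<open>As in the library's \<^const>\<open>onorm\<close>, the quotient is \<open>0\<close> at \<open>x = 0\<close>.\<close>

definition op_norm :: "(real^'d \<Rightarrow> real) \<Rightarrow> real^'d^'d \<Rightarrow> real" where
  "op_norm N A = (SUP x. N (A *v x) / N x)"

definition Linf_norm :: "('a \<Rightarrow> real) \<Rightarrow> (real \<Rightarrow> 'a) \<Rightarrow> real" where
  "Linf_norm N u = real_of_ereal (esssup (lebesgue_on {0..1}) (\<lambda>t. ereal (N (u t))))"

section \<open>The Sobolev space \<open>H\<^sup>1([0,1])\<close>\<close>

definition L2_fun :: "(real \<Rightarrow> 'a::euclidean_space) \<Rightarrow> bool" where
  "L2_fun u \<longleftrightarrow> u \<in> borel_measurable (lebesgue_on {0..1}) \<and>
     integrable (lebesgue_on {0..1}) (\<lambda>t. (norm (u t))\<^sup>2)"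

definition test_fun :: "(real \<Rightarrow> real) \<Rightarrow> (real \<Rightarrow> real) \<Rightarrow> bool" where
  "test_fun \<phi> \<phi>' \<longleftrightarrow>
     (\<forall>t. (\<phi> has_real_derivative \<phi>' t) (at t)) \<and> continuous_on UNIV \<phi>' \<and>
     (\<exists>a b. 0 < a \<and> a \<le> b \<and> b < 1 \<and> (\<forall>t. t \<notin> {a..b} \<longrightarrow> \<phi> t = 0))"

text \<open>\<open>H\<^sup>1\<close> on an interval, with test functions in \<open>C\<^sub>c\<^sup>1(0,1)\<close>, following Brezis,
  \<^emph>\<open>Functional Analysis, Sobolev Spaces and Partial Differential Equations\<close>, Section 8.2.\<close>

definition is_weak_deriv ::
  "(real \<Rightarrow> 'a::euclidean_space) \<Rightarrow> (real \<Rightarrow> 'a) \<Rightarrow> bool" where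
  "is_weak_deriv u g \<longleftrightarrow> L2_fun g \<and>
     (\<forall>\<phi> \<phi>'. test_fun \<phi> \<phi>' \<longrightarrow>
        (LINT t|lebesgue_on {0..1}. \<phi>' t *\<^sub>R u t) =
          - (LINT t|lebesgue_on {0..1}. \<phi> t *\<^sub>R g t))"

text \<open>An element is represented by its continuous representative. Extensionality makes HOL
  equality coincide with equality of functions on \<open>[0,1]\<close>.\<close>

definition H1 :: "(real \<Rightarrow> 'a::euclidean_space) set" where
  "H1 = {u \<in> extensional {0..1}. continuous_on {0..1} u \<and> L2_fun u \<and> (\<exists>g. is_weak_deriv u g)}"

text \<open>The weak derivative is unique up to null sets, so the choice does not affect integrals.\<close>

definition weak_deriv :: "(real \<Rightarrow> 'a::euclidean_space) \<Rightarrow> real \<Rightarrow> 'a" where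
  "weak_deriv u = (SOME g. is_weak_deriv u g)"

section \<open>Parameter spaces\<close>

text \<open>A function on \<open>{i/n | i < n}\<close> is the tuple of its values, indexed by \<open>i < n\<close>. As \<open>\<mu>\<^sub>n\<close> has
  finite support charging each point, \<open>L\<^sup>2(\<mu>\<^sub>n)\<close> consists of all such tuples.\<close>

type_synonym ('d, 'm) params_disc =
  "(nat \<Rightarrow> real^'d^'d) \<times> (nat \<Rightarrow> real^'d) \<times> (real^'d^'m) \<times> (real^'m)"

type_synonym ('d, 'm) params_cont =
  "(real \<Rightarrow> real^'d^'d) \<times> (real \<Rightarrow> real^'d) \<times> (real^'d^'m) \<times> (real^'m)"

definition Theta_disc :: "nat \<Rightarrow> ('d::finite, 'm::finite) params_disc set" where
  "Theta_disc n = ({..<n} \<rightarrow>\<^sub>E UNIV) \<times> ({..<n} \<rightarrow>\<^sub>E UNIV) \<times> UNIV \<times> UNIV"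

definition Theta :: "('d::finite, 'm::finite) params_cont set" where
  "Theta = H1 \<times> H1 \<times> UNIV \<times> UNIV"

section \<open>Discrete and continuum dynamics\<close>

primrec resnet ::
  "(real^'d \<Rightarrow> real^'d) \<Rightarrow> nat \<Rightarrow> (nat \<Rightarrow> real^'d^'d) \<Rightarrow> (nat \<Rightarrow> real^'d) \<Rightarrow>
    real^'d \<Rightarrow> nat \<Rightarrow> real^'d" where
  "resnet \<sigma> n K b x 0 = x"
| "resnet \<sigma> n K b x (Suc i) =
     resnet \<sigma> n K b x i + (1 / real n) *\<^sub>R \<sigma> (K i *v resnet \<sigma> n K b x i + b i)"

definition ode_solution ::
  "(real^'d \<Rightarrow> real^'d) \<Rightarrow> (real \<Rightarrow> real^'d^'d) \<Rightarrow> (real \<Rightarrow> real^'d) \<Rightarrow>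
    real^'d \<Rightarrow> (real \<Rightarrow> real^'d) \<Rightarrow> bool" where
  "ode_solution \<sigma> K b x X \<longleftrightarrow> X 0 = x \<and>
     (\<forall>t\<in>{0..1}. (X has_vector_derivative \<sigma> (K t *v X t + b t)) (at t within {0..1}))"

text \<open>For Lipschitz \<open>\<sigma>\<close> and continuous \<open>K\<close>, \<open>b\<close> the solution exists and is unique on \<open>[0,1]\<close>.\<close>

definition ode_flow ::
  "(real^'d \<Rightarrow> real^'d) \<Rightarrow> (real \<Rightarrow> real^'d^'d) \<Rightarrow> (real \<Rightarrow> real^'d) \<Rightarrow>
    real^'d \<Rightarrow> real \<Rightarrow> real^'d" where
  "ode_flow \<sigma> K b x = (SOME X. ode_solution \<sigma> K b x X)"

section \<open>Energies\<close>

definition reg_disc ::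
  "('a::euclidean_space \<Rightarrow> real) \<Rightarrow> real \<Rightarrow> nat \<Rightarrow> (nat \<Rightarrow> 'a) \<Rightarrow> real" where
  "reg_disc N \<tau> n u = real n * (\<Sum>i = 1..<n. (N (u i - u (i - 1)))\<^sup>2) + \<tau> * (N (u 0))\<^sup>2"

definition reg_cont ::
  "('a::euclidean_space \<Rightarrow> real) \<Rightarrow> real \<Rightarrow> (real \<Rightarrow> 'a) \<Rightarrow> real" where
  "reg_cont N \<tau> u = (LINT t|lebesgue_on {0..1}. (N (weak_deriv u t))\<^sup>2) + \<tau> * (N (u 0))\<^sup>2"

text \<open>\<open>Nd\<close>, \<open>NW\<close>, \<open>Nm\<close> are the norms on \<open>\<real>\<^sup>d\<close>, \<open>\<real>\<^sup>m\<^sup>\<times>\<^sup>d\<close>, \<open>\<real>\<^sup>m\<close>; on \<open>\<real>\<^sup>d\<^sup>\<times>\<^sup>d\<close> the operator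
  norm induced by \<open>Nd\<close> is used. The weights are \<open>\<alpha> 1, \<dots>, \<alpha> 4\<close> and \<open>\<tau> 1, \<tau> 2\<close>; the data are
  \<open>(xs s, ys s)\<close> for \<open>1 \<le> s \<le> S\<close>.\<close>

definition energy_disc ::
  "(real^'d \<Rightarrow> real) \<Rightarrow> (real^'d^'m \<Rightarrow> real) \<Rightarrow> (real^'m \<Rightarrow> real) \<Rightarrow>
   (real^'d \<Rightarrow> real^'d) \<Rightarrow> (real^'m \<Rightarrow> real^'m) \<Rightarrow> (real^'m \<Rightarrow> real^'m \<Rightarrow> real) \<Rightarrow>
   (nat \<Rightarrow> real) \<Rightarrow> (nat \<Rightarrow> real) \<Rightarrow> nat \<Rightarrow> (nat \<Rightarrow> real^'d) \<Rightarrow> (nat \<Rightarrow> real^'m) \<Rightarrow>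
   nat \<Rightarrow> ('d::finite, 'm::finite) params_disc \<Rightarrow> real" where
  "energy_disc Nd NW Nm \<sigma> h L \<alpha> \<tau> S xs ys n = (\<lambda>(K, b, W, c).
     (\<Sum>s = 1..S. L (h (W *v resnet \<sigma> n K b (xs s) n + c)) (ys s))
     + \<alpha> 1 * reg_disc (op_norm Nd) (\<tau> 1) n K + \<alpha> 2 * reg_disc Nd (\<tau> 2) n b
     + \<alpha> 3 * (NW W)\<^sup>2 + \<alpha> 4 * (Nm c)\<^sup>2)"

definition energy_cont ::
  "(real^'d \<Rightarrow> real) \<Rightarrow> (real^'d^'m \<Rightarrow> real) \<Rightarrow> (real^'m \<Rightarrow> real) \<Rightarrow>
   (real^'d \<Rightarrow> real^'d) \<Rightarrow> (real^'m \<Rightarrow> real^'m) \<Rightarrow> (real^'m \<Rightarrow> real^'m \<Rightarrow> real) \<Rightarrow>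
   (nat \<Rightarrow> real) \<Rightarrow> (nat \<Rightarrow> real) \<Rightarrow> nat \<Rightarrow> (nat \<Rightarrow> real^'d) \<Rightarrow> (nat \<Rightarrow> real^'m) \<Rightarrow>
   ('d::finite, 'm::finite) params_cont \<Rightarrow> real" where
  "energy_cont Nd NW Nm \<sigma> h L \<alpha> \<tau> S xs ys = (\<lambda>(K, b, W, c).
     (\<Sum>s = 1..S. L (h (W *v ode_flow \<sigma> K b (xs s) 1 + c)) (ys s))
     + \<alpha> 1 * reg_cont (op_norm Nd) (\<tau> 1) K + \<alpha> 2 * reg_cont Nd (\<tau> 2) b
     + \<alpha> 3 * (NW W)\<^sup>2 + \<alpha> 4 * (Nm c)\<^sup>2)"

end

theory Submission
  imports Defs "HOL-Complex_Analysis.Great_Picard"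
begin

text \<open>
  The minimisers converge by a \<open>\<Gamma>\<close>-convergence argument. Sampling an \<open>H\<^sup>1\<close> function on the grid
  does not increase the regulariser (Jensen), which gives the upper bound. Conversely, the piecewise linear
  interpolants of the discrete minimisers are equi-Hoelder, so Arzela--Ascoli yields a uniform limit \<open>u\<close>.
  Lower semicontinuity goes through F. Riesz's sums \<open>n \<Sum>\<^sub>i \<parallel>u((i+1)/n) - u(i/n)\<parallel>\<^sup>2\<close>: for fixed \<open>n\<close> they are
  continuous under pointwise convergence and bounded by \<open>\<integral> \<parallel>u'\<parallel>\<^sup>2\<close>; along dyadic \<open>n\<close> the difference quotients
  form an \<open>L\<^sup>2\<close>-bounded martingale, whose limit is the weak derivative, so boundedness of the sums characterises
  \<open>H\<^sup>1\<close> and their limit is \<open>\<integral> \<parallel>u'\<parallel>\<^sup>2\<close> for every norm. Uniqueness of the minimiser turns subsequential into full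
  uniform convergence \<open>K\<^sup>(\<^sup>n\<^sup>) \<rightarrow> K\<close>, \<open>b\<^sup>(\<^sup>n\<^sup>) \<rightarrow> b\<close>. The stated bound is then the discrete Gronwall estimate for the
  explicit Euler scheme, with \<open>\<epsilon>\<^sub>n\<close> the largest one-step truncation error.
\<close>

section \<open>Norms\<close>

text \<open>The norms are arbitrary, so the energy of a derivative need not come from an inner
  product. Riesz sums separate the two difficulties: for a fixed grid they see finitely many point
  values, so every norm passes to a pointwise limit; orthogonality is used for the Euclidean norm
  alone, to make the dyadic slopes Cauchy in L2. Strong L2 convergence then transfers to every norm
  by equivalence of norms. The definition of H1 by test functions is translated once, in both
  directions, into \<open>primitive_on_unit u g\<close>: the integral of \<open>g\<close> over every
  subinterval is the increment of \<open>u\<close>. All energy estimates work with that form. In the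
  final bound the tolerance \<delta> has two roles. It measures the distance of the discrete
  coefficients from the limit, which gives the first term of \<open>A_n\<close>, and it bounds the
  operator norms of the discrete matrices by the sup norm of \<open>K\<close> plus \<delta>, which
  gives the rate in the exponential. The truncation error depends only on \<open>X\<close>, so the
  same \<epsilon> serves every \<delta>.\<close>

lemma is_normD:
  assumes "is_norm N"
  shows is_norm_ge0: "0 \<le> N x"
    and is_norm_eq_0_iff: "N x = 0 \<longleftrightarrow> x = 0"
    and is_norm_scale: "N (a *\<^sub>R x) = \<bar>a\<bar> * N x"
    and is_norm_triangle: "N (x + y) \<le> N x + N y"
  using assms by (auto simp: is_norm_def)

lemma is_norm_norm: "is_norm (norm :: 'a::real_normed_vector \<Rightarrow> real)"
  by (simp add: is_norm_def norm_triangle_ineq)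

lemma is_norm_0: "is_norm N \<Longrightarrow> N 0 = 0"
  by (simp add: is_norm_eq_0_iff)

lemma is_norm_minus: "is_norm N \<Longrightarrow> N (- x) = N x"
  using is_norm_scale[of N "-1" x] by simp

lemma is_norm_minus_commute: "is_norm N \<Longrightarrow> N (x - y) = N (y - x)"
  using is_norm_minus[of N "x - y"] by simp

lemma is_norm_sum:
  assumes "is_norm N" shows "N (\<Sum>i\<in>I. f i) \<le> (\<Sum>i\<in>I. N (f i))"
proof (induction I rule: infinite_finite_induct)
  case (insert i I)
  then show ?case using is_norm_triangle[OF assms, of "f i" "\<Sum>i\<in>I. f i"] by simp
qed (simp_all add: is_norm_0[OF assms])

lemma is_norm_abs_diff:
  assumes "is_norm N" shows "\<bar>N x - N y\<bar> \<le> N (x - y)"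
  using is_norm_triangle[OF assms, of "x - y" y] is_norm_triangle[OF assms, of "y - x" x]
    is_norm_minus_commute[OF assms, of x y] by simp

lemma is_norm_le_norm:
  fixes N :: "'a::euclidean_space \<Rightarrow> real"
  assumes "is_norm N"
  obtains C where "0 < C" "\<And>x. N x \<le> C * norm x"
proof
  let ?C = "(\<Sum>i\<in>Basis. N i) + 1"
  have 0: "0 \<le> (\<Sum>i\<in>Basis. N i)"
    by (intro sum_nonneg is_norm_ge0[OF assms])
  then show "0 < ?C" by simp
  fix x
  have "N x = N (\<Sum>i\<in>Basis. (x \<bullet> i) *\<^sub>R i)" by (simp add: euclidean_representation)
  also have "\<dots> \<le> (\<Sum>i\<in>Basis. \<bar>x \<bullet> i\<bar> * N i)"
    using is_norm_sum[OF assms, of "\<lambda>i. (x \<bullet> i) *\<^sub>R i" Basis] by (simp add: is_norm_scale[OF assms])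
  also have "\<dots> \<le> (\<Sum>i\<in>Basis. norm x * N i)"
    by (intro sum_mono mult_right_mono is_norm_ge0[OF assms] Basis_le_norm)
  also have "\<dots> \<le> ?C * norm x"
    by (simp flip: sum_distrib_left add: distrib_left mult.commute[of _ "norm x"])
  finally show "N x \<le> ?C * norm x" .
qed

lemma is_norm_continuous:
  fixes N :: "'a::euclidean_space \<Rightarrow> real"
  assumes "is_norm N"
  shows "continuous_on S N"
proof -
  obtain C where C: "0 < C" "\<And>x. N x \<le> C * norm x" using is_norm_le_norm[OF assms] by blast
  have "C-lipschitz_on S N"
  proof (rule lipschitz_onI)
    fix x y
    have "\<bar>N x - N y\<bar> \<le> N (x - y)" by (rule is_norm_abs_diff[OF assms])
    also have "\<dots> \<le> C * norm (x - y)" by (rule C(2))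
    finally show "dist (N x) (N y) \<le> C * dist x y" by (simp add: dist_norm)
  qed (use C in simp)
  then show ?thesis by (rule lipschitz_on_continuous_on)
qed

text \<open>Compactness: on the Euclidean unit sphere the continuous function \<open>N\<close>
  attains a minimum, positive by definiteness. Its reciprocal is the constant.\<close>

lemma norm_le_is_norm:
  fixes N :: "'a::euclidean_space \<Rightarrow> real"
  assumes "is_norm N"
  obtains C where "0 < C" "\<And>x. norm x \<le> C * N x"
proof -
  obtain e :: 'a where "e \<in> Basis" using nonempty_Basis by blast
  then have "sphere (0::'a) 1 \<noteq> {}" by (auto intro!: exI[of _ e])
  then obtain z where z: "z \<in> sphere 0 1" "\<And>y. y \<in> sphere 0 1 \<Longrightarrow> N z \<le> N y"
    using continuous_attains_inf[OF compact_sphere _ is_norm_continuous[OF assms], of 0 1] by blast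
  have pos: "0 < N z"
    using z(1) is_norm_ge0[OF assms, of z] is_norm_eq_0_iff[OF assms, of z] by auto
  show thesis
  proof
    show "0 < 1 / N z" using pos by simp
    fix x
    show "norm x \<le> 1 / N z * N x"
    proof (cases "x = 0")
      case False
      then have "N z \<le> N ((1 / norm x) *\<^sub>R x)" by (intro z(2)) simp
      also have "\<dots> = N x / norm x" by (simp add: is_norm_scale[OF assms])
      finally show ?thesis using pos False by (simp add: field_simps)
    qed (simp add: is_norm_0[OF assms])
  qed
qed

lemma is_norm_tendsto:
  fixes N :: "'a::euclidean_space \<Rightarrow> real"
  assumes "is_norm N" "(f \<longlongrightarrow> l) F"
  shows "((\<lambda>x. N (f x)) \<longlongrightarrow> N l) F"
  using continuous_on_tendsto_compose[OF is_norm_continuous[OF assms(1), of UNIV] assms(2)] by simp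

section \<open>Induced operator norms\<close>

context
  fixes N :: "real^'d \<Rightarrow> real"
  assumes N: "is_norm N"
begin

text \<open>\<open>op_norm\<close> is a supremum in a conditionally complete order, so it dominates
  its quotients only once they are known to be bounded. Equivalence of norms reduces this to the
  Euclidean boundedness of a linear map.\<close>

lemma op_norm_bdd_above: "bdd_above (range (\<lambda>x. N (A *v x) / N x))"
proof -
  obtain C where C: "0 < C" "\<And>x. N x \<le> C * norm x" using is_norm_le_norm[OF N] by blast
  obtain C' where C': "0 < C'" "\<And>x. norm x \<le> C' * N x" using norm_le_is_norm[OF N] by blast
  obtain B where B: "0 < B" "\<And>x. norm (A *v x) \<le> B * norm x"
    using linear_bounded_pos[OF matrix_vector_mul_linear, of A] by auto
  have "N (A *v x) / N x \<le> C * B * C'" for x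
  proof (cases "N x = 0")
    case False
    have "N (A *v x) \<le> C * (B * norm x)"
      using C(2)[of "A *v x"] B(2)[of x] C(1) by (meson mult_left_mono order_trans less_imp_le)
    also have "\<dots> \<le> C * (B * (C' * N x))"
      using C B C' by (intro mult_left_mono) auto
    finally show ?thesis using False is_norm_ge0[OF N, of x] by (simp add: field_simps)
  qed (use C B C' in simp)
  then show ?thesis by (intro bdd_aboveI2)
qed

lemma op_norm_mult_vec: "N (A *v x) \<le> op_norm N A * N x"
proof (cases "x = 0")
  case False
  then have "0 < N x" using is_norm_ge0[OF N, of x] is_norm_eq_0_iff[OF N, of x] by simp
  moreover have "N (A *v x) / N x \<le> op_norm N A"
    unfolding op_norm_def by (intro cSUP_upper op_norm_bdd_above) simp
  ultimately show ?thesis by (simp add: field_simps)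
qed (simp add: is_norm_0[OF N])

lemma op_norm_le:
  assumes "0 \<le> B" "\<And>x. N (A *v x) \<le> B * N x"
  shows "op_norm N A \<le> B"
  unfolding op_norm_def
proof (rule cSUP_least)
  fix x show "N (A *v x) / N x \<le> B"
    using assms(1) assms(2)[of x] is_norm_ge0[OF N, of x] by (cases "N x = 0") (auto simp: field_simps)
qed simp

lemma op_norm_ge0: "0 \<le> op_norm N A"
  unfolding op_norm_def
  \<comment> \<open>The vector 0 contributes the quotient \<open>0 / 0\<close>, which is 0.\<close>
  by (rule cSUP_upper2[of _ _ 0]) (use op_norm_bdd_above in \<open>auto simp: is_norm_0[OF N]\<close>)

lemma is_norm_op_norm: "is_norm (op_norm N)"
  unfolding is_norm_def
proof (intro conjI allI)
  show "op_norm N A = 0 \<longleftrightarrow> A = 0" for A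
  proof
    assume "op_norm N A = 0"
    then have "A *v x = 0" for x
      using op_norm_mult_vec[of A x] is_norm_ge0[OF N, of "A *v x"] is_norm_eq_0_iff[OF N, of "A *v x"] by simp
    then show "A = 0" by (simp add: matrix_eq)
  next
    assume "A = 0"
    then show "op_norm N A = 0"
      using op_norm_le[of 0 A] op_norm_ge0[of A] by (simp add: is_norm_0[OF N])
  qed
  show "op_norm N (A + B) \<le> op_norm N A + op_norm N B" for A B
  proof (rule op_norm_le)
    fix x show "N ((A + B) *v x) \<le> (op_norm N A + op_norm N B) * N x"
      using is_norm_triangle[OF N, of "A *v x" "B *v x"] op_norm_mult_vec[of A x] op_norm_mult_vec[of B x]
      by (simp add: matrix_vector_mult_add_rdistrib algebra_simps)
  qed (simp add: op_norm_ge0)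
  \<comment> \<open>One inequality suffices: used with the scalar \<open>1 / a\<close> it yields the
    reverse one.\<close>
  have le: "op_norm N (a *\<^sub>R A) \<le> \<bar>a\<bar> * op_norm N A" for a A
  proof (rule op_norm_le)
    fix x show "N ((a *\<^sub>R A) *v x) \<le> \<bar>a\<bar> * op_norm N A * N x"
      using mult_left_mono[OF op_norm_mult_vec[of A x], of "\<bar>a\<bar>"]
      by (simp add: scaleR_matrix_vector_assoc[symmetric] is_norm_scale[OF N] algebra_simps)
  qed (simp add: op_norm_ge0)
  show "op_norm N (a *\<^sub>R A) = \<bar>a\<bar> * op_norm N A" for a A
  proof (cases "a = 0")
    case False
    then have "op_norm N A \<le> \<bar>1 / a\<bar> * op_norm N (a *\<^sub>R A)"
      using le[of "1 / a" "a *\<^sub>R A"] by simp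
    then have "\<bar>a\<bar> * op_norm N A \<le> op_norm N (a *\<^sub>R A)" using False by (simp add: field_simps)
    then show ?thesis using le[of a A] by simp
  next
    case True
    then show ?thesis using le[of a A] op_norm_ge0[of "a *\<^sub>R A"] by simp
  qed
qed (rule op_norm_ge0)

end

text \<open>The inequality holds for every Riemann sum, whose weights are nonnegative, and survives
  the limit along a gauge fine for both integrals.\<close>

lemma is_norm_has_integral_le:
  fixes g :: "real \<Rightarrow> 'a::euclidean_space"
  assumes N: "is_norm N" and g: "(g has_integral i) {a..b}"
    and Ng: "((\<lambda>t. N (g t)) has_integral j) {a..b}"
  shows "N i \<le> j"
proof -
  obtain C where C: "0 < C" "\<And>x. N x \<le> C * norm x" using is_norm_le_norm[OF N] by blast
  show ?thesis
  proof (rule field_le_epsilon)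
    fix e :: real assume e: "0 < e"
    \<comment> \<open>One \<open>e'\<close> pays for the scalar integral, and \<open>C * e'\<close>
      for the vector integral measured in \<open>N\<close>.\<close>
    define e' where "e' = e / (C + 1)"
    have e': "0 < e'" using e C by (simp add: e'_def)
    obtain \<gamma> where \<gamma>: "gauge \<gamma>" "\<And>p. p tagged_division_of {a..b} \<Longrightarrow> \<gamma> fine p \<Longrightarrow>
        norm ((\<Sum>(x,k)\<in>p. measure lborel k *\<^sub>R g x) - i) < e'"
      using g e' unfolding has_integral_real by meson
    obtain \<gamma>' where \<gamma>': "gauge \<gamma>'" "\<And>p. p tagged_division_of {a..b} \<Longrightarrow> \<gamma>' fine p \<Longrightarrow>
        norm ((\<Sum>(x,k)\<in>p. measure lborel k *\<^sub>R N (g x)) - j) < e'"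
      using Ng e' unfolding has_integral_real by meson
    obtain p where p: "p tagged_division_of {a..b}" "(\<lambda>x. \<gamma> x \<inter> \<gamma>' x) fine p"
      using fine_division_exists_real[OF gauge_Int[OF \<gamma>(1) \<gamma>'(1)]] .
    have fine: "\<gamma> fine p" "\<gamma>' fine p" using p(2) by (auto simp: fine_Int)
    let ?s = "\<Sum>(x,k)\<in>p. measure lborel k *\<^sub>R g x"
    let ?S = "\<Sum>(x,k)\<in>p. measure lborel k *\<^sub>R N (g x)"
    have "N ?s \<le> (\<Sum>z\<in>p. N (case z of (x,k) \<Rightarrow> measure lborel k *\<^sub>R g x))"
      by (rule is_norm_sum[OF N])
    also have "\<dots> = ?S"
      by (intro sum.cong refl) (auto simp: is_norm_scale[OF N])
    finally have 1: "N ?s \<le> ?S" .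
    have "N i \<le> N ?s + N (i - ?s)" using is_norm_triangle[OF N, of ?s "i - ?s"] by simp
    also have "N (i - ?s) \<le> C * norm (?s - i)" using C(2)[of "i - ?s"] by (simp add: norm_minus_commute)
    also have "C * norm (?s - i) \<le> C * e'" using \<gamma>(2)[OF p(1) fine(1)] C by simp
    also have "N ?s \<le> j + e'" using 1 \<gamma>'(2)[OF p(1) fine(2)] by simp
    finally have "N i \<le> j + (C + 1) * e'" by (simp add: algebra_simps)
    then show "N i \<le> j + e" using C by (simp add: e'_def)
  qed
qed

text \<open>Cauchy-Schwarz against the constant 1, obtained from the nonnegativity of the variance
  of \<open>f\<close> about its mean \<open>m\<close>.\<close>

lemma square_integral_le:
  fixes f :: "real \<Rightarrow> real"
  assumes "a \<le> b" and f: "(f has_integral i) {a..b}" and f2: "((\<lambda>t. (f t)\<^sup>2) has_integral j) {a..b}"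
  shows "i\<^sup>2 \<le> (b - a) * j"
proof (cases "a = b")
  case True
  then have "i = 0" using f has_integral_refl(2)[of f a] by (auto dest: has_integral_unique)
  then show ?thesis using True by simp
next
  case False
  then have ab: "0 < b - a" using assms(1) by simp
  define m where "m = i / (b - a)"
  have "((\<lambda>t. (f t)\<^sup>2 - 2 * m * f t + m\<^sup>2) has_integral (j - 2 * m * i + m\<^sup>2 * (b - a))) {a..b}"
    using has_integral_const_real[of "m\<^sup>2" a b] ab
    by (intro has_integral_add has_integral_diff f2 has_integral_mult_right[OF f]) (simp add: mult.commute)
  then have "((\<lambda>t. (f t - m)\<^sup>2) has_integral (j - 2 * m * i + m\<^sup>2 * (b - a))) {a..b}"
    by (simp add: power2_diff algebra_simps)
  then have "0 \<le> j - 2 * m * i + m\<^sup>2 * (b - a)"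
    by (rule has_integral_nonneg) simp
  also have "\<dots> = j - i\<^sup>2 / (b - a)"
    proof -
    have "m * (b - a) = i" using ab by (simp add: m_def)
    then have "m\<^sup>2 * (b - a) = m * i" by (simp add: power2_eq_square mult.assoc)
    then show ?thesis by (simp add: m_def power2_eq_square)
  qed
  finally show ?thesis using ab by (simp add: field_simps)
qed

section \<open>Square integrable functions, step functions and Riesz sums\<close>

lemma L2_fun_measurable: "L2_fun g \<Longrightarrow> g \<in> borel_measurable (lebesgue_on {0..1})"
  by (simp add: L2_fun_def)

lemma finite_measure_unit: "finite_measure (lebesgue_on {0..1::real})"
  by (intro finite_measure_lebesgue_on) simp

lemma borel_measurable_is_norm:
  fixes g :: "real \<Rightarrow> 'a::euclidean_space"
  assumes "is_norm N" "g \<in> borel_measurable M"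
  shows "(\<lambda>t. N (g t)) \<in> borel_measurable M"
  using borel_measurable_continuous_onI[OF is_norm_continuous[OF assms(1)]] assms(2)
  by (rule measurable_compose[rotated])

lemma L2_fun_is_norm_sq_integrable:
  fixes g :: "real \<Rightarrow> 'a::euclidean_space"
  assumes "is_norm N" "L2_fun g"
  shows "integrable (lebesgue_on {0..1}) (\<lambda>t. (N (g t))\<^sup>2)"
proof -
  obtain C where C: "0 < C" "\<And>x. N x \<le> C * norm x" using is_norm_le_norm[OF assms(1)] by blast
  have i: "integrable (lebesgue_on {0..1}) (\<lambda>t. C\<^sup>2 * (norm (g t))\<^sup>2)"
    using assms(2) by (simp add: L2_fun_def)
  have le: "norm ((N (g t))\<^sup>2) \<le> norm (C\<^sup>2 * (norm (g t))\<^sup>2)" for t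
    using power_mono[OF C(2)[of "g t"] is_norm_ge0[OF assms(1)], of 2] by (simp add: power_mult_distrib)
  have m: "(\<lambda>t. (N (g t))\<^sup>2) \<in> borel_measurable (lebesgue_on {0..1})"
    using borel_measurable_is_norm[OF assms(1) L2_fun_measurable[OF assms(2)]] by measurable
  show ?thesis
    by (rule Bochner_Integration.integrable_bound[OF i m AE_I2[OF le]])
qed

text \<open>On a space of finite measure square integrability is the stronger property; the majorant
  comes from \<open>y \<le> 1 + y\<^sup>2\<close>.\<close>

lemma L2_fun_is_norm_integrable:
  fixes g :: "real \<Rightarrow> 'a::euclidean_space"
  assumes "is_norm N" "L2_fun g"
  shows "integrable (lebesgue_on {0..1}) (\<lambda>t. N (g t))"
proof -
  interpret finite_measure "lebesgue_on {0..1::real}" by (rule finite_measure_unit)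
  have i: "integrable (lebesgue_on {0..1}) (\<lambda>t. 1 + (N (g t))\<^sup>2)"
    using L2_fun_is_norm_sq_integrable[OF assms] by simp
  have le: "norm (N (g t)) \<le> norm (1 + (N (g t))\<^sup>2)" for t
  proof -
    have "0 \<le> (N (g t) - 1)\<^sup>2" by simp
    moreover have "0 \<le> (N (g t))\<^sup>2" by simp
    ultimately show ?thesis
      using is_norm_ge0[OF assms(1), of "g t"] by (simp add: power2_diff)
  qed
  show ?thesis
    by (rule Bochner_Integration.integrable_bound[OF i
          borel_measurable_is_norm[OF assms(1) L2_fun_measurable[OF assms(2)]] AE_I2[OF le]])
qed

lemma L2_fun_integrable:
  fixes g :: "real \<Rightarrow> 'a::euclidean_space"
  assumes "L2_fun g"
  shows "integrable (lebesgue_on {0..1}) g"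
  using L2_fun_is_norm_integrable[OF is_norm_norm assms] L2_fun_measurable[OF assms] integrable_norm_cancel
  by blast

lemma lebesgue_on_integrable_on_subinterval:
  fixes f :: "real \<Rightarrow> 'a::euclidean_space"
  assumes "integrable (lebesgue_on {0..1}) f" "0 \<le> s" "t \<le> 1"
  shows "f integrable_on {s..t}"
  using integrable_on_lebesgue_on[OF assms(1)] integrable_on_subinterval[of f "{0..1}" s t] assms(2,3)
  by auto

lemma L2_fun_diff:
  fixes f g :: "real \<Rightarrow> 'a::euclidean_space"
  assumes "L2_fun f" "L2_fun g"
  shows "L2_fun (\<lambda>t. f t - g t)"
proof -
  have m: "(\<lambda>t. f t - g t) \<in> borel_measurable (lebesgue_on {0..1})"
    using assms by (auto simp: L2_fun_def)
  have i: "integrable (lebesgue_on {0..1}) (\<lambda>t. 2 * (norm (f t))\<^sup>2 + 2 * (norm (g t))\<^sup>2)"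
    using assms by (simp add: L2_fun_def)
  have le: "norm ((norm (f t - g t))\<^sup>2) \<le> norm (2 * (norm (f t))\<^sup>2 + 2 * (norm (g t))\<^sup>2)" for t
  proof -
    have "(norm (f t - g t))\<^sup>2 \<le> (norm (f t) + norm (g t))\<^sup>2"
      by (intro power_mono norm_triangle_ineq4) auto
    also have "\<dots> \<le> 2 * (norm (f t))\<^sup>2 + 2 * (norm (g t))\<^sup>2"
      using sum_squares_bound[of "norm (f t)" "norm (g t)"] by (simp add: power2_sum)
    finally show ?thesis by simp
  qed
  have "(\<lambda>t. (norm (f t - g t))\<^sup>2) \<in> borel_measurable (lebesgue_on {0..1})"
    using m by measurable
  then have "integrable (lebesgue_on {0..1}) (\<lambda>t. (norm (f t - g t))\<^sup>2)"
    by (rule Bochner_Integration.integrable_bound[OF i _ AE_I2[OF le]])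
  then show ?thesis using m by (simp add: L2_fun_def)
qed

lemma continuous_L2_fun:
  fixes u :: "real \<Rightarrow> 'a::euclidean_space"
  assumes "continuous_on {0..1} u"
  shows "L2_fun u"
  unfolding L2_fun_def
proof
  show m: "u \<in> borel_measurable (lebesgue_on {0..1})"
    using assms by (intro continuous_imp_measurable_on_sets_lebesgue) auto
  have "(\<lambda>t. (norm (u t))\<^sup>2) absolutely_integrable_on {0..1}"
    using assms by (intro absolutely_integrable_continuous_real continuous_intros)
  then show "integrable (lebesgue_on {0..1}) (\<lambda>t. (norm (u t))\<^sup>2)"
    by (intro absolutely_integrable_imp_integrable) auto
qed

section \<open>Uniform grids and step functions\<close>

lemma sum_integral_grid:
  fixes f :: "real \<Rightarrow> 'a::euclidean_space"
  assumes f: "f integrable_on {0..1}" and n: "0 < n"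
  shows "(\<Sum>i<n. integral {real i / real n..real (Suc i) / real n} f) = integral {0..1} f"
proof -
  have "(\<Sum>i<k. integral {real i / real n..real (Suc i) / real n} f) = integral {0..real k / real n} f"
    if "k \<le> n" for k
    using that
  proof (induction k)
    case (Suc k)
    have "f integrable_on {0..real (Suc k) / real n}"
      using Suc.prems n by (intro integrable_on_subinterval[OF f]) (auto simp: field_simps)
    then have "integral {0..real k / real n} f + integral {real k / real n..real (Suc k) / real n} f
        = integral {0..real (Suc k) / real n} f"
      by (intro Henstock_Kurzweil_Integration.integral_combine) (auto simp: divide_right_mono)
    then show ?case using Suc by simp
  qed simp
  from this[of n] show ?thesis using n by simp
qed

text \<open>Constant on the half-open cells from \<open>i / n\<close> to \<open>(i + 1) / n\<close>.
  At \<open>t = 1\<close> it reads \<open>v n\<close>, beyond the last cell, but no integral sees a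
  single point.\<close>

definition step :: "nat \<Rightarrow> (nat \<Rightarrow> 'a) \<Rightarrow> real \<Rightarrow> 'a" where
  "step n v t = v (nat \<lfloor>real n * t\<rfloor>)"

lemma step_eq:
  assumes "0 < n" "real i / real n \<le> t" "t < real (Suc i) / real n"
  shows "step n v t = v i"
proof -
  have "\<lfloor>real n * t\<rfloor> = int i"
    using assms by (intro floor_unique) (auto simp: field_simps)
  then show ?thesis by (simp add: step_def)
qed

lemma step_has_integral_cell:
  fixes v :: "nat \<Rightarrow> 'a::euclidean_space"
  assumes "0 < n"
  shows "(step n v has_integral (1 / real n) *\<^sub>R v i) {real i / real n..real (Suc i) / real n}"
\<comment> \<open>At the right end of the cell the step function already takes the value of the next
  one.\<close>
proof (rule has_integral_spike_finite[where S="{real (Suc i) / real n}"])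
  have "real (Suc i) / real n - real i / real n = 1 / real n"
    by (simp add: add_divide_distrib)
  then show "((\<lambda>t. v i) has_integral (1 / real n) *\<^sub>R v i) {real i / real n..real (Suc i) / real n}"
    using has_integral_const_real[of "v i" "real i / real n" "real (Suc i) / real n"]
    by (simp add: divide_right_mono)
qed (use assms in \<open>auto intro!: step_eq\<close>)

lemma step_has_integral:
  fixes v :: "nat \<Rightarrow> 'a::euclidean_space"
  assumes n: "0 < n" and "i \<le> j"
  shows "(step n v has_integral (1 / real n) *\<^sub>R (\<Sum>k=i..<j. v k)) {real i / real n..real j / real n}"
  using \<open>i \<le> j\<close>
proof (induction j rule: dec_induct)
  case base
  then show ?case using has_integral_refl(2)[of "step n v" "real i / real n"] by simp
next
  case (step j)
  have "(step n v has_integral (1 / real n) *\<^sub>R (\<Sum>k=i..<j. v k) + (1 / real n) *\<^sub>R v j)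
      {real i / real n..real (Suc j) / real n}"
    using step by (intro has_integral_combine[OF _ _ step.IH step_has_integral_cell[OF n]])
      (auto simp: divide_right_mono)
  then show ?case using step by (simp add: scaleR_add_right)
qed

lemma step_has_integral_unit:
  fixes v :: "nat \<Rightarrow> 'a::euclidean_space"
  assumes n: "0 < n"
  shows "(step n v has_integral (1 / real n) *\<^sub>R (\<Sum>k<n. v k)) {0..1}"
  using step_has_integral[OF n, of 0 n v] n by (simp add: atLeast0LessThan)

lemma comp_step: "(\<lambda>t. f (step n v t)) = step n (\<lambda>i. f (v i))"
  by (simp add: step_def fun_eq_iff)

lemma L2_fun_step:
  fixes v :: "nat \<Rightarrow> 'a::euclidean_space"
  assumes n: "0 < n"
  shows "L2_fun (step n v)"
  unfolding L2_fun_def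
proof
  show "step n v \<in> borel_measurable (lebesgue_on {0..1})"
    using step_has_integral_unit[OF n, of v] by (intro integrable_imp_measurable) auto
  have "(\<lambda>t. (norm (step n v t))\<^sup>2) integrable_on {0..1}"
    using step_has_integral_unit[OF n, of "\<lambda>i. (norm (v i))\<^sup>2"]
    by (auto simp: comp_step[of "\<lambda>x. (norm x)\<^sup>2"])
  then have "(\<lambda>t. (norm (step n v t))\<^sup>2) absolutely_integrable_on {0..1}"
    by (rule nonnegative_absolutely_integrable_1) simp
  then show "integrable (lebesgue_on {0..1}) (\<lambda>t. (norm (step n v t))\<^sup>2)"
    by (intro absolutely_integrable_imp_integrable) auto
qed

section \<open>Primitives of square integrable functions and their Riesz sums\<close>

definition primitive_on_unit :: "(real \<Rightarrow> 'a::euclidean_space) \<Rightarrow> (real \<Rightarrow> 'a) \<Rightarrow> bool" where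
  "primitive_on_unit u g \<longleftrightarrow> L2_fun g \<and>
     (\<forall>s t. 0 \<le> s \<and> s \<le> t \<and> t \<le> 1 \<longrightarrow> (g has_integral (u t - u s)) {s..t})"

text \<open>A cell increment \<open>D\<close> contributes \<open>n * (N D)\<^sup>2\<close>, which is
  the cell length \<open>1 / n\<close> times the squared norm of the slope \<open>n * D\<close>. The
  sum is therefore the energy of the piecewise linear interpolant of \<open>u\<close> on the
  grid.\<close>

definition riesz_sum :: "('a::real_vector \<Rightarrow> real) \<Rightarrow> nat \<Rightarrow> (real \<Rightarrow> 'a) \<Rightarrow> real" where
  "riesz_sum N n u = real n * (\<Sum>i<n. (N (u (real (Suc i) / real n) - u (real i / real n)))\<^sup>2)"

text \<open>Jensen's inequality on one interval: the triangle inequality for the integral of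
  \<open>g\<close>, followed by Cauchy-Schwarz.\<close>

lemma primitive_increment_le:
  fixes u :: "real \<Rightarrow> 'a::euclidean_space"
  assumes N: "is_norm N" and u: "primitive_on_unit u g" and st: "0 \<le> s" "s \<le> t" "t \<le> 1"
  shows "(N (u t - u s))\<^sup>2 \<le> (t - s) * integral {s..t} (\<lambda>r. (N (g r))\<^sup>2)"
proof -
  have g: "L2_fun g" "(g has_integral (u t - u s)) {s..t}"
    using u st by (auto simp: primitive_on_unit_def)
  have i1: "((\<lambda>r. N (g r)) has_integral integral {s..t} (\<lambda>r. N (g r))) {s..t}"
    using lebesgue_on_integrable_on_subinterval[OF L2_fun_is_norm_integrable[OF N g(1)]] st by blast
  have i2: "((\<lambda>r. (N (g r))\<^sup>2) has_integral integral {s..t} (\<lambda>r. (N (g r))\<^sup>2)) {s..t}"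
    using lebesgue_on_integrable_on_subinterval[OF L2_fun_is_norm_sq_integrable[OF N g(1)]] st by blast
  have "N (u t - u s) \<le> integral {s..t} (\<lambda>r. N (g r))"
    by (rule is_norm_has_integral_le[OF N g(2) i1])
  then have "(N (u t - u s))\<^sup>2 \<le> (integral {s..t} (\<lambda>r. N (g r)))\<^sup>2"
    by (intro power_mono is_norm_ge0[OF N])
  also have "\<dots> \<le> (t - s) * integral {s..t} (\<lambda>r. (N (g r))\<^sup>2)"
    by (rule square_integral_le[OF st(2) i1 i2])
  finally show ?thesis .
qed

text \<open>Enlarging the local energy to that of the whole interval leaves a Hoelder estimate with
  exponent 1/2, the source of equicontinuity.\<close>

lemma primitive_increment_le_total:
  fixes u :: "real \<Rightarrow> 'a::euclidean_space"
  assumes N: "is_norm N" and u: "primitive_on_unit u g" and st: "0 \<le> s" "s \<le> t" "t \<le> 1"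
  shows "(N (u t - u s))\<^sup>2 \<le> (t - s) * integral {0..1} (\<lambda>r. (N (g r))\<^sup>2)"
proof -
  have i: "integrable (lebesgue_on {0..1}) (\<lambda>r. (N (g r))\<^sup>2)"
    using u by (intro L2_fun_is_norm_sq_integrable[OF N]) (simp add: primitive_on_unit_def)
  have "integral {s..t} (\<lambda>r. (N (g r))\<^sup>2) \<le> integral {0..1} (\<lambda>r. (N (g r))\<^sup>2)"
    using st by (intro integral_subset_le lebesgue_on_integrable_on_subinterval[OF i]) auto
  then show ?thesis
    using primitive_increment_le[OF assms] st by (meson diff_ge_0_iff_ge mult_left_mono order_trans)
qed

text \<open>The cell length \<open>1 / n\<close> in Jensen's inequality cancels the factor
  \<open>n\<close>. The grid may be unrelated to \<open>u\<close>: this serves for sampling an H1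
  function, and also for testing an interpolant on dyadic grids that differ from its own.\<close>

lemma riesz_sum_le:
  fixes u :: "real \<Rightarrow> 'a::euclidean_space"
  assumes N: "is_norm N" and u: "primitive_on_unit u g" and n: "0 < n"
  shows "riesz_sum N n u \<le> integral {0..1} (\<lambda>r. (N (g r))\<^sup>2)"
proof -
  let ?I = "\<lambda>i. {real i / real n..real (Suc i) / real n}"
  have i: "integrable (lebesgue_on {0..1}) (\<lambda>r. (N (g r))\<^sup>2)"
    using u by (intro L2_fun_is_norm_sq_integrable[OF N]) (simp add: primitive_on_unit_def)
  have "riesz_sum N n u = (\<Sum>i<n. real n * (N (u (real (Suc i) / real n) - u (real i / real n)))\<^sup>2)"
    by (simp add: riesz_sum_def sum_distrib_left)
  also have "\<dots> \<le> (\<Sum>i<n. integral (?I i) (\<lambda>r. (N (g r))\<^sup>2))"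
  proof (rule sum_mono)
    fix i assume "i \<in> {..<n}"
    then have "(N (u (real (Suc i) / real n) - u (real i / real n)))\<^sup>2
        \<le> (real (Suc i) / real n - real i / real n) * integral (?I i) (\<lambda>r. (N (g r))\<^sup>2)"
      by (intro primitive_increment_le[OF N u]) (auto simp: divide_right_mono)
    also have "real (Suc i) / real n - real i / real n = 1 / real n"
      by (simp add: add_divide_distrib)
    finally show "real n * (N (u (real (Suc i) / real n) - u (real i / real n)))\<^sup>2
        \<le> integral (?I i) (\<lambda>r. (N (g r))\<^sup>2)"
      using n by (simp add: field_simps)
  qed
  also have "\<dots> = integral {0..1} (\<lambda>r. (N (g r))\<^sup>2)"
    by (intro sum_integral_grid n lebesgue_on_integrable_on_subinterval[OF i]) auto
  finally show ?thesis .
qed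

lemma primitive_continuous:
  assumes "primitive_on_unit u g"
  shows "continuous_on {0..1} u"
proof -
  have i: "(g has_integral (u t - u 0)) {0..t}" if "t \<in> {0..1}" for t
    using assms that by (simp add: primitive_on_unit_def)
  have g: "g integrable_on {0..1}" using i[of 1] by auto
  have eq: "u 0 + integral {0..t} g = u t" if "t \<in> {0..1}" for t
    using integral_unique[OF i[OF that]] by simp
  have "continuous_on {0..1} (\<lambda>t. u 0 + integral {0..t} g)"
    by (intro continuous_intros indefinite_integral_continuous_1 g)
  then show ?thesis using eq by (rule continuous_on_eq)
qed

lemma primitive_integral:
  fixes g :: "real \<Rightarrow> 'a::euclidean_space"
  assumes "L2_fun g"
  shows "primitive_on_unit (\<lambda>t. a + integral {0..t} g) g"
  unfolding primitive_on_unit_def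
proof (intro conjI allI impI)
  fix s t :: real assume st: "0 \<le> s \<and> s \<le> t \<and> t \<le> 1"
  have i: "g integrable_on {r..r'}" if "0 \<le> r" "r' \<le> 1" for r r'
    using lebesgue_on_integrable_on_subinterval[OF L2_fun_integrable[OF assms] that] .
  have "integral {0..s} g + integral {s..t} g = integral {0..t} g"
    using st by (intro Henstock_Kurzweil_Integration.integral_combine i) auto
  then have "integral {s..t} g = (a + integral {0..t} g) - (a + integral {0..s} g)"
    by (simp add: algebra_simps)
  then show "(g has_integral (a + integral {0..t} g - (a + integral {0..s} g))) {s..t}"
    using integrable_integral[OF i, of s t] st by simp
qed (rule assms)

section \<open>Weak derivatives as densities of primitives\<close>

text \<open>Test functions are C1, so a piecewise quadratic ramp is enough. Here \<open>p\<close> is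
  the squared positive part; twice its second difference with step 1/2 vanishes to the left of 0 and
  is constantly 1 to the right of 1. The derivative is a tent of height 2 and mass 1.\<close>

lemma smooth_ramp:
  obtains \<psi> \<psi>' :: "real \<Rightarrow> real"
  where "\<And>x. (\<psi> has_real_derivative \<psi>' x) (at x)" "continuous_on UNIV \<psi>'"
    "\<And>x. 0 \<le> \<psi>' x" "\<And>x. x \<le> 0 \<Longrightarrow> \<psi> x = 0" "\<And>x. 1 \<le> x \<Longrightarrow> \<psi> x = 1"
    "\<And>x. 0 \<le> \<psi> x" "\<And>x. \<psi> x \<le> 1" "\<And>x. x \<notin> {0..1} \<Longrightarrow> \<psi>' x = 0"
proof -
  define p where "p = (\<lambda>x::real. (max 0 x)\<^sup>2)"
  have p: "(p has_real_derivative 2 * max 0 x) (at x)" for x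
  proof -
    consider "x < 0" | "x = 0" | "0 < x" by linarith
    then show ?thesis
    proof cases
      case 1
      have "((\<lambda>x. 0) has_real_derivative 2 * max 0 x) (at x)" using 1 by simp
      then show ?thesis
        by (rule has_field_derivative_transform_within_open[where S="{..<0}"]) (use 1 in \<open>auto simp: p_def\<close>)
    next
      case 2
      have "((\<lambda>h. (p (0 + h) - p 0) / h) \<longlongrightarrow> 0) (at 0)"
      proof (rule Lim_null_comparison)
        show "\<forall>\<^sub>F h in at 0. norm ((p (0 + h) - p 0) / h) \<le> \<bar>h\<bar>"
          by (intro always_eventually allI)
            (auto simp: p_def max_def power2_eq_square abs_mult divide_simps)
        show "((\<lambda>h. \<bar>h\<bar>) \<longlongrightarrow> 0) (at (0::real))" by (intro tendsto_eq_intros) auto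
      qed
      then show ?thesis using 2 by (simp add: DERIV_def)
    next
      case 3
      have "((\<lambda>x. x\<^sup>2) has_real_derivative 2 * max 0 x) (at x)"
        using 3 by (auto intro!: derivative_eq_intros)
      then show ?thesis
        by (rule has_field_derivative_transform_within_open[where S="{0<..}"]) (use 3 in \<open>auto simp: p_def\<close>)
    qed
  qed
  define \<psi> where "\<psi> = (\<lambda>x. 2 * (p x - 2 * p (x - 1/2) + p (x - 1)))"
  define \<psi>' where "\<psi>' = (\<lambda>x::real. 4 * (max 0 x - 2 * max 0 (x - 1/2) + max 0 (x - 1)))"
  have shift: "((\<lambda>x. p (x - c)) has_real_derivative 2 * max 0 (x - c)) (at x)" for x c
  proof -
    have "((\<lambda>x. x - c) has_real_derivative 1) (at x)" by (auto intro!: derivative_eq_intros)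
    then show ?thesis using DERIV_chain2[where f=p and g="\<lambda>x. x - c" and Db=1, OF p] by fastforce
  qed
  have d: "(\<psi> has_real_derivative \<psi>' x) (at x)" for x
    unfolding \<psi>_def \<psi>'_def by (rule derivative_eq_intros p shift refl | simp)+
  have nn: "0 \<le> \<psi>' x" for x by (simp add: \<psi>'_def max_def)
  have l: "\<psi> x = 0" if "x \<le> 0" for x using that by (simp add: \<psi>_def p_def)
  have r: "\<psi> x = 1" if "1 \<le> x" for x
    using that by (simp add: \<psi>_def p_def power2_eq_square algebra_simps)
  have mono: "\<psi> x \<le> \<psi> y" if "x \<le> y" for x y
    using DERIV_nonneg_imp_nondecreasing[OF that, of \<psi>] d nn by blast
  show thesis
  proof (rule that[OF d _ nn l r])
    show "continuous_on UNIV \<psi>'" unfolding \<psi>'_def by (intro continuous_intros)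
    show "0 \<le> \<psi> x" for x using mono[of x 0] mono[of 0 x] l[of x] l[of 0] by (cases "x \<le> 0") auto
    show "\<psi> x \<le> 1" for x using mono[of x 1] r[of x] r[of 1] by (cases "x \<le> 1") auto
    show "\<psi>' x = 0" if "x \<notin> {0..1}" for x using that by (auto simp: \<psi>'_def max_def)
  qed
qed

text \<open>The weights are nonnegative, have integral 1 by the fundamental theorem of calculus, and
  live between \<open>c\<close> and \<open>c + \<epsilon> k\<close>. The integral is thus a
  one-sided average of \<open>u\<close> near \<open>c\<close>.\<close>

lemma mollifier_tendsto:
  fixes u :: "real \<Rightarrow> 'a::euclidean_space"
  assumes u: "continuous_on {0..1} u" and c: "0 < c" "c < 1"
    and \<epsilon>: "\<And>k. 0 < \<epsilon> k" "\<And>k. c + \<epsilon> k < 1" "\<epsilon> \<longlonglongrightarrow> 0"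
    and \<psi>: "\<And>x. (\<psi> has_real_derivative \<psi>' x) (at x)" "continuous_on UNIV \<psi>'"
    "\<And>x. 0 \<le> \<psi>' x" "\<And>x. x \<le> 0 \<Longrightarrow> \<psi> x = 0" "\<And>x. 1 \<le> x \<Longrightarrow> \<psi> x = 1"
    "\<And>x. x \<notin> {0..1} \<Longrightarrow> \<psi>' x = 0"
  shows "(\<lambda>k. integral {0..1} (\<lambda>t. (\<psi>' ((t - c) / \<epsilon> k) / \<epsilon> k) *\<^sub>R u t)) \<longlonglongrightarrow> u c"
proof (rule LIMSEQ_I)
  fix e :: real assume e: "0 < e"
  obtain d where d: "0 < d" "\<And>t. t \<in> {0..1} \<Longrightarrow> dist t c < d \<Longrightarrow> dist (u t) (u c) < e / 2"
    using u c e unfolding continuous_on_iff by (metis atLeastAtMost_iff half_gt_zero less_imp_le)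
  obtain k0 where k0: "\<And>k. k0 \<le> k \<Longrightarrow> \<epsilon> k < d"
    using order_tendstoD(2)[OF \<epsilon>(3) d(1)] by (auto simp: eventually_sequentially)
  have "norm (integral {0..1} (\<lambda>t. (\<psi>' ((t - c) / \<epsilon> k) / \<epsilon> k) *\<^sub>R u t) - u c) < e" if k: "k0 \<le> k" for k
  proof -
    let ?\<rho> = "\<lambda>t. \<psi>' ((t - c) / \<epsilon> k) / \<epsilon> k"
    have ek: "0 < \<epsilon> k" "c + \<epsilon> k < 1" "\<epsilon> k < d" using \<epsilon> k0[OF k] by auto
    have cont: "continuous_on {0..1} ?\<rho>"
      using ek by (intro continuous_intros continuous_on_compose2[OF \<psi>(2)]) auto
    have "((\<lambda>t. \<psi> ((t - c) / \<epsilon> k)) has_vector_derivative ?\<rho> t) (at t within {0..1})" for t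
    proof -
      have "((\<lambda>t. (t - c) / \<epsilon> k) has_real_derivative 1 / \<epsilon> k) (at t)"
        using ek by (auto intro!: derivative_eq_intros)
      from DERIV_chain2[OF \<psi>(1) this] show ?thesis
        by (auto simp: has_real_derivative_iff_has_vector_derivative intro: has_vector_derivative_at_within)
    qed
    then have "(?\<rho> has_integral (\<psi> ((1 - c) / \<epsilon> k) - \<psi> ((0 - c) / \<epsilon> k))) {0..1}"
      by (intro fundamental_theorem_of_calculus) auto
    then have one: "(?\<rho> has_integral 1) {0..1}"
      using ek c \<psi>(5)[of "(1 - c) / \<epsilon> k"] \<psi>(4)[of "- c / \<epsilon> k"] by simp
    have i1: "((\<lambda>t. ?\<rho> t *\<^sub>R u t) has_integral integral {0..1} (\<lambda>t. ?\<rho> t *\<^sub>R u t)) {0..1}"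
      by (intro integrable_integral integrable_continuous_real continuous_intros cont u)
    have i2: "((\<lambda>t. ?\<rho> t *\<^sub>R u c) has_integral u c) {0..1}"
      using has_integral_scaleR_left[OF one, of "u c"] by simp
    have i: "((\<lambda>t. ?\<rho> t *\<^sub>R (u t - u c)) has_integral (integral {0..1} (\<lambda>t. ?\<rho> t *\<^sub>R u t) - u c)) {0..1}"
      using has_integral_diff[OF i1 i2] by (simp add: scaleR_diff_right)
    have j: "((\<lambda>t. ?\<rho> t * (e / 2)) has_integral (e / 2)) {0..1}"
      using has_integral_mult_left[OF one, of "e / 2"] by simp
    have "norm (?\<rho> t *\<^sub>R (u t - u c)) \<le> ?\<rho> t * (e / 2)" if t: "t \<in> {0..1}" for t
    proof (cases "(t - c) / \<epsilon> k \<in> {0..1}")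
      case True
      then have "dist t c < d" using ek by (auto simp: dist_real_def field_simps)
      then have "norm (u t - u c) \<le> e / 2" using d(2)[OF t] by (simp add: dist_norm)
      moreover have nn: "0 \<le> ?\<rho> t" using \<psi>(3) ek by simp
      ultimately have "?\<rho> t * norm (u t - u c) \<le> ?\<rho> t * (e / 2)" by (rule mult_left_mono)
      then show ?thesis using abs_of_nonneg[OF nn] by (simp only: norm_scaleR)
    next
      case False
      then show ?thesis by (simp add: \<psi>(6))
    qed
    then have "norm (integral {0..1} (\<lambda>t. ?\<rho> t *\<^sub>R (u t - u c))) \<le> integral {0..1} (\<lambda>t. ?\<rho> t * (e / 2))"
      using i j by (intro integral_norm_bound_integral) auto
    also have "\<dots> = e / 2" using j by (rule integral_unique)
    finally show ?thesis using integral_unique[OF i] e by simp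
  qed
  then show "\<exists>no. \<forall>n\<ge>no. norm (integral {0..1} (\<lambda>t. (\<psi>' ((t - c) / \<epsilon> n) / \<epsilon> n) *\<^sub>R u t) - u c) < e"
    by blast
qed

lemma integrable_bounded_scaleR:
  fixes g :: "real \<Rightarrow> 'a::euclidean_space"
  assumes "integrable M g" "f \<in> borel_measurable M" "\<And>t. t \<in> space M \<Longrightarrow> \<bar>f t\<bar> \<le> B"
  shows "integrable M (\<lambda>t. f t *\<^sub>R g t)"
proof (rule Bochner_Integration.integrable_bound)
  show "integrable M (\<lambda>t. B * norm (g t))" using assms(1) by simp
  show "(\<lambda>t. f t *\<^sub>R g t) \<in> borel_measurable M" using assms by measurable
  show "AE t in M. norm (f t *\<^sub>R g t) \<le> norm (B * norm (g t))"
  proof (rule AE_I2)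
    fix t assume t: "t \<in> space M"
    have "\<bar>f t\<bar> * norm (g t) \<le> \<bar>B\<bar> * norm (g t)"
      using assms(3)[OF t] by (intro mult_right_mono) auto
    then show "norm (f t *\<^sub>R g t) \<le> norm (B * norm (g t))" by (simp add: abs_mult)
  qed
qed

lemma test_funD:
  assumes "test_fun \<phi> \<phi>'"
  shows test_fun_deriv: "(\<phi> has_real_derivative \<phi>' t) (at t)"
    and test_fun_continuous: "continuous_on S \<phi>" "continuous_on S \<phi>'"
    and test_fun_0: "\<phi> 0 = 0" and test_fun_1: "\<phi> 1 = 0"
proof -
  show d: "(\<phi> has_real_derivative \<phi>' t) (at t)" for t
    using assms by (simp add: test_fun_def)
  show "continuous_on S \<phi>"
    using d by (meson DERIV_isCont continuous_at_imp_continuous_on)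
  show "continuous_on S \<phi>'"
    using assms continuous_on_subset by (auto simp: test_fun_def)
  obtain a b where "0 < a" "b < 1" "\<And>t. t \<notin> {a..b} \<Longrightarrow> \<phi> t = 0"
    using assms unfolding test_fun_def by blast
  then show "\<phi> 0 = 0" "\<phi> 1 = 0" by auto
qed

lemma continuous_imp_measurable_unit:
  fixes f :: "real \<Rightarrow> 'a::euclidean_space"
  assumes "continuous_on {0..1} f"
  shows "f \<in> borel_measurable (lebesgue_on {0..1})"
  using L2_fun_measurable[OF continuous_L2_fun[OF assms]] .

lemma continuous_imp_integrable_unit:
  fixes f :: "real \<Rightarrow> 'a::euclidean_space"
  assumes "continuous_on {0..1} f"
  shows "integrable (lebesgue_on {0..1}) f"
  using L2_fun_integrable[OF continuous_L2_fun[OF assms]] .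

text \<open>The test functions are differences of two steepening ramps, started at \<open>a\<close>
  and at \<open>b\<close>; they approximate the indicator of \<open>{a<..b}\<close>. The side with
  their derivatives converges by mollification, the side with \<open>g\<close> by dominated
  convergence.\<close>

lemma weak_deriv_integral:
  fixes u :: "real \<Rightarrow> 'a::euclidean_space"
  assumes u: "continuous_on {0..1} u" and g: "is_weak_deriv u g" and ab: "0 < a" "a < b" "b < 1"
  shows "integral {a..b} g = u b - u a"
proof -
  let ?M = "lebesgue_on {0..1::real}"
  obtain \<psi> \<psi>' :: "real \<Rightarrow> real" where
    \<psi>: "\<And>x. (\<psi> has_real_derivative \<psi>' x) (at x)" "continuous_on UNIV \<psi>'"
      "\<And>x. 0 \<le> \<psi>' x" "\<And>x. x \<le> 0 \<Longrightarrow> \<psi> x = 0" "\<And>x. 1 \<le> x \<Longrightarrow> \<psi> x = 1"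
      "\<And>x. 0 \<le> \<psi> x" "\<And>x. \<psi> x \<le> 1" "\<And>x. x \<notin> {0..1} \<Longrightarrow> \<psi>' x = 0"
    using smooth_ramp by blast
  \<comment> \<open>The summand 2 keeps \<open>\<epsilon> k\<close> strictly below
    \<open>1 - b\<close> already for \<open>k = 0\<close>, so the support, contained in
    \<open>{a..b + \<epsilon> k}\<close>, stays inside the open unit interval.\<close>
  define \<epsilon> where "\<epsilon> k = (1 - b) / (real k + 2)" for k
  have \<epsilon>: "0 < \<epsilon> k" "b + \<epsilon> k < 1" "a + \<epsilon> k < 1" for k
  proof -
    show p: "0 < \<epsilon> k" using ab by (simp add: \<epsilon>_def)
    have "(1 - b) * 1 < (1 - b) * (real k + 2)" using ab by (intro mult_strict_left_mono) auto
    then have "\<epsilon> k < 1 - b" using ab by (simp add: \<epsilon>_def divide_less_eq)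
    then show "b + \<epsilon> k < 1" "a + \<epsilon> k < 1" using ab by auto
  qed
  have \<epsilon>0: "\<epsilon> \<longlonglongrightarrow> 0"
  proof -
    have "(\<lambda>k. (1 - b) * inverse (real (k + 2))) \<longlonglongrightarrow> (1 - b) * 0"
      by (intro tendsto_intros LIMSEQ_ignore_initial_segment[OF lim_inverse_n])
    then show ?thesis by (simp add: \<epsilon>_def[abs_def] divide_inverse add.commute)
  qed
  define \<rho> where "\<rho> c k t = \<psi>' ((t - c) / \<epsilon> k) / \<epsilon> k" for c k t
  define \<phi> where "\<phi> k t = \<psi> ((t - a) / \<epsilon> k) - \<psi> ((t - b) / \<epsilon> k)" for k t
  have test: "test_fun (\<phi> k) (\<lambda>t. \<rho> a k t - \<rho> b k t)" for k
    unfolding test_fun_def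
  proof (intro conjI allI exI impI)
    show "(\<phi> k has_real_derivative \<rho> a k t - \<rho> b k t) (at t)" for t
    proof -
      have "((\<lambda>t. \<psi> ((t - c) / \<epsilon> k)) has_real_derivative \<rho> c k t) (at t)" for c
      proof -
        have "((\<lambda>t. (t - c) / \<epsilon> k) has_real_derivative 1 / \<epsilon> k) (at t)"
          using \<epsilon>(1)[of k] by (auto intro!: derivative_eq_intros)
        from DERIV_chain2[OF \<psi>(1) this] show ?thesis by (simp add: \<rho>_def)
      qed
      then show ?thesis unfolding \<phi>_def by (intro DERIV_diff)
    qed
    show "continuous_on UNIV (\<lambda>t. \<rho> a k t - \<rho> b k t)"
      unfolding \<rho>_def using \<epsilon>(1)[of k] by (intro continuous_intros continuous_on_compose2[OF \<psi>(2)]) auto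
    show "0 < a" "a \<le> b + \<epsilon> k" "b + \<epsilon> k < 1" using ab \<epsilon>[of k] by auto
    show "\<phi> k t = 0" if "t \<notin> {a..b + \<epsilon> k}" for t
    proof -
      have "t < a \<or> b + \<epsilon> k < t" using that by auto
      then show ?thesis
      proof
        assume "t < a"
        then have "(t - a) / \<epsilon> k \<le> 0" "(t - b) / \<epsilon> k \<le> 0"
          using \<epsilon>(1)[of k] ab by (auto simp: field_simps)
        then show ?thesis by (simp add: \<phi>_def \<psi>(4))
      next
        assume "b + \<epsilon> k < t"
        then have "1 \<le> (t - a) / \<epsilon> k" "1 \<le> (t - b) / \<epsilon> k"
          using \<epsilon>(1)[of k] ab by (auto simp: field_simps)
        then show ?thesis by (simp add: \<phi>_def \<psi>(5))
      qed
    qed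
  qed
  have g': "L2_fun g" and eq: "(LINT t|?M. (\<rho> a k t - \<rho> b k t) *\<^sub>R u t) = - (LINT t|?M. \<phi> k t *\<^sub>R g t)" for k
    using g test[of k] unfolding is_weak_deriv_def by blast+
  have ig: "integrable ?M g" using L2_fun_integrable[OF g'] .
  have cont\<rho>: "continuous_on {0..1} (\<lambda>t. \<rho> c k t *\<^sub>R u t)" for c k
    unfolding \<rho>_def using \<epsilon>(1)[of k] by (intro continuous_intros continuous_on_compose2[OF \<psi>(2)] u) auto
  have "(LINT t|?M. (\<rho> a k t - \<rho> b k t) *\<^sub>R u t)
      = integral {0..1} (\<lambda>t. \<rho> a k t *\<^sub>R u t) - integral {0..1} (\<lambda>t. \<rho> b k t *\<^sub>R u t)" for k
    using continuous_imp_integrable_unit[OF cont\<rho>]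
    by (simp add: scaleR_diff_left lebesgue_integral_eq_integral)
  moreover have "(\<lambda>k. integral {0..1} (\<lambda>t. \<rho> a k t *\<^sub>R u t) - integral {0..1} (\<lambda>t. \<rho> b k t *\<^sub>R u t))
      \<longlonglongrightarrow> u a - u b"
    unfolding \<rho>_def using ab \<epsilon>
    by (intro tendsto_diff mollifier_tendsto[OF u _ _ _ _ \<epsilon>0 \<psi>(1,2,3,4,5,8)]) auto
  ultimately have l1: "(\<lambda>k. - (LINT t|?M. \<phi> k t *\<^sub>R g t)) \<longlonglongrightarrow> u a - u b"
    by (simp add: eq)
  have "indicat_real {a<..b} \<in> borel_measurable ?M"
    by (intro measurable_restrict_space1 measurable_completion borel_measurable_indicator) simp
  then have ii: "integrable ?M (\<lambda>t. indicat_real {a<..b} t *\<^sub>R g t)"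
    by (rule integrable_bounded_scaleR[OF ig, where B=1]) (auto simp: indicator_def)
  have "(\<lambda>k. LINT t|?M. \<phi> k t *\<^sub>R g t) \<longlonglongrightarrow> (LINT t|?M. indicator {a<..b} t *\<^sub>R g t)"
  proof (rule integral_dominated_convergence)
    show "integrable ?M (\<lambda>t. norm (g t))" using ig by simp
    show "(\<lambda>t. indicator {a<..b} t *\<^sub>R g t) \<in> borel_measurable ?M"
      by (rule borel_measurable_integrable[OF ii])
    show "(\<lambda>t. \<phi> k t *\<^sub>R g t) \<in> borel_measurable ?M" for k
      using borel_measurable_integrable[OF ig] continuous_imp_measurable_unit[OF test_fun_continuous(1)[OF test]]
      by measurable
    show "AE t in ?M. norm (\<phi> k t *\<^sub>R g t) \<le> norm (g t)" for k
    proof (rule AE_I2)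
      fix t
      have "\<bar>\<phi> k t\<bar> \<le> 1"
        using \<psi>(6,7)[of "(t - a) / \<epsilon> k"] \<psi>(6,7)[of "(t - b) / \<epsilon> k"] by (simp add: \<phi>_def)
      then show "norm (\<phi> k t *\<^sub>R g t) \<le> norm (g t)" by (simp add: mult_left_le_one_le)
    qed
    \<comment> \<open>The ramp starts at \<open>c\<close> itself and is 0 there for every
      \<open>k\<close>; this is why the limiting indicator is open on the left and closed on the
      right.\<close>
    have ev: "\<forall>\<^sub>F k in sequentially. \<psi> ((t - c) / \<epsilon> k) = (if c < t then 1 else 0)" for t c
    proof (cases "c < t")
      case True
      then have "\<forall>\<^sub>F k in sequentially. \<epsilon> k < t - c" using order_tendstoD(2)[OF \<epsilon>0, of "t - c"] by simp
      then show ?thesis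
        by (rule eventually_mono) (use True \<epsilon>(1) \<psi>(5) in \<open>auto simp: le_divide_eq less_imp_le\<close>)
    next
      case False
      then have "(t - c) / \<epsilon> k \<le> 0" for k using \<epsilon>(1)[of k] by (simp add: divide_le_0_iff)
      then show ?thesis using False by (simp add: \<psi>(4))
    qed
    show "AE t in ?M. (\<lambda>k. \<phi> k t *\<^sub>R g t) \<longlonglongrightarrow> indicator {a<..b} t *\<^sub>R g t"
    proof (rule AE_I2, rule tendsto_eventually)
      fix t
      show "\<forall>\<^sub>F k in sequentially. \<phi> k t *\<^sub>R g t = indicator {a<..b} t *\<^sub>R g t"
        using ev[of t a] ev[of t b]
        by eventually_elim (use ab in \<open>auto simp: \<phi>_def indicator_def\<close>)
    qed
  qed
  from tendsto_minus[OF this] l1 have "- (LINT t|?M. indicator {a<..b} t *\<^sub>R g t) = u a - u b"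
    using LIMSEQ_unique by blast
  moreover have "(LINT t|?M. indicator {a<..b} t *\<^sub>R g t) = integral {a..b} g"
  proof -
    have "(LINT t|?M. indicat_real {a<..b} t *\<^sub>R g t) = integral {0..1} (\<lambda>t. indicat_real {a<..b} t *\<^sub>R g t)"
      using ii by (simp add: lebesgue_integral_eq_integral)
    also have "\<dots> = integral {0..1} (\<lambda>t. if t \<in> {a..b} then g t else 0)"
      by (rule integral_spike[of "{a}"]) (auto simp: indicator_def)
    also have "\<dots> = integral {a..b} g"
      using ab by (subst integral_restrict_Int) (auto intro!: arg_cong[where f="\<lambda>S. integral S g"])
    finally show ?thesis .
  qed
  ultimately show ?thesis by (simp add: algebra_simps)
qed

text \<open>Test functions vanish near 0 and 1, so they only show that \<open>v\<close> is constant
  in the open interval. Continuity of \<open>u\<close> carries this to the two end points.\<close>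

lemma weak_deriv_imp_primitive:
  fixes u :: "real \<Rightarrow> 'a::euclidean_space"
  assumes u: "continuous_on {0..1} u" and g: "is_weak_deriv u g"
  shows "primitive_on_unit u g"
proof -
  have g': "L2_fun g" using g by (simp add: is_weak_deriv_def)
  have i: "g integrable_on {s..t}" if "0 \<le> s" "t \<le> 1" for s t
    using lebesgue_on_integrable_on_subinterval[OF L2_fun_integrable[OF g'] that] .
  define v where "v t = u t - integral {0..t} g" for t
  have cl: "closure {0<..<1::real} = {0..1}" by simp
  have split: "integral {0..s} g + integral {s..t} g = integral {0..t} g" if "0 \<le> s" "s \<le> t" "t \<le> 1" for s t
    using that by (intro Henstock_Kurzweil_Integration.integral_combine i) auto
  have "continuous_on (closure {0<..<1::real}) v"
    unfolding cl v_def by (intro continuous_intros u indefinite_integral_continuous_1 i) auto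
  moreover have le: "v t = v s" if "s \<in> {0<..<1}" "t \<in> {0<..<1}" "s < t" for s t
    using weak_deriv_integral[OF u g, of s t] that by (simp add: v_def split[of s t, symmetric])
  have "v t = v (1/2)" if "t \<in> {0<..<1}" for t
  proof (cases "t = 1/2")
    case False
    then show ?thesis using le[of t "1/2"] le[of "1/2" t] that by (cases "t < 1/2") auto
  next
    case True
    then show ?thesis by (simp only:)
  qed
  ultimately have v: "v t = v (1/2)" if "t \<in> {0..1}" for t
    using continuous_constant_on_closure[of "{0<..<1::real}" v "v (1/2)" t] that cl by metis
  have "(g has_integral (u t - u s)) {s..t}" if "0 \<le> s" "s \<le> t" "t \<le> 1" for s t
  proof -
    have "v t = v s" using v[of s] v[of t] that by simp
    then have "u t - u s = integral {0..t} g - integral {0..s} g"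
      by (simp add: v_def algebra_simps)
    then have "integral {s..t} g = u t - u s"
      by (simp add: split[OF that, symmetric])
    then show ?thesis using integrable_integral[OF i[of s t]] that by simp
  qed
  then show ?thesis using g' by (simp add: primitive_on_unit_def)
qed

text \<open>Integration by parts for a density that is merely square integrable. The increments of
  the product telescope to 0 over a grid. On a cell, freezing \<open>u\<close> at the left end and
  \<phi> at the right end makes the product rule exact, and uniform continuity bounds the cost of
  freezing by a small multiple of the integral of \<open>B + norm (g r)\<close>.\<close>

lemma primitive_imp_weak_deriv:
  fixes u :: "real \<Rightarrow> 'a::euclidean_space"
  assumes prim: "primitive_on_unit u g"
  shows "is_weak_deriv u g"
  unfolding is_weak_deriv_def
proof (intro conjI allI impI)
  show g: "L2_fun g" using prim by (simp add: primitive_on_unit_def)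
  have u: "continuous_on {0..1} u" by (rule primitive_continuous[OF prim])
  let ?M = "lebesgue_on {0..1::real}"
  fix \<phi> \<phi>' assume t: "test_fun \<phi> \<phi>'"
  note c = test_fun_continuous[OF t]
  obtain B where B: "0 < B" "\<And>t. t \<in> {0..1} \<Longrightarrow> norm (\<phi>' t) \<le> B"
    using compact_imp_bounded[OF compact_continuous_image[OF c(2), of "{0..1}"]]
    by (auto simp: bounded_pos)
  obtain B' where B': "0 < B'" "\<And>t. t \<in> {0..1} \<Longrightarrow> norm (\<phi> t) \<le> B'"
    using compact_imp_bounded[OF compact_continuous_image[OF c(1), of "{0..1}"]]
    by (auto simp: bounded_pos)
  have I1: "integrable ?M (\<lambda>t. \<phi>' t *\<^sub>R u t)"
    by (intro continuous_imp_integrable_unit continuous_intros c u)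
  have I2: "integrable ?M (\<lambda>t. \<phi> t *\<^sub>R g t)"
    by (rule integrable_bounded_scaleR[OF L2_fun_integrable[OF g] continuous_imp_measurable_unit[OF c(1)]])
      (use B' in auto)
  have I3: "integrable ?M (\<lambda>t. B + norm (g t))"
    using continuous_imp_integrable_unit[of "\<lambda>t. B"] L2_fun_integrable[OF g] by simp
  let ?f = "\<lambda>r. \<phi>' r *\<^sub>R u r + \<phi> r *\<^sub>R g r"
  note sub = lebesgue_on_integrable_on_subinterval
  let ?J = "integral {0..1} (\<lambda>r. B + norm (g r))"
  have J: "0 \<le> ?J" using B by (intro Henstock_Kurzweil_Integration.integral_nonneg sub[OF I3]) auto
  have "norm (integral {0..1} ?f) \<le> e * ?J" if e: "0 < e" for e
  proof -
    have uc: "uniformly_continuous_on {0..1} u" "uniformly_continuous_on {0..1} \<phi>"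
      using u c(1) by (auto intro: compact_uniformly_continuous)
    obtain d1 where d1: "0 < d1" "\<And>s t. s \<in> {0..1} \<Longrightarrow> t \<in> {0..1} \<Longrightarrow> dist t s < d1 \<Longrightarrow> dist (u t) (u s) < e"
      using uc(1) e unfolding uniformly_continuous_on_def by meson
    obtain d2 where d2: "0 < d2" "\<And>s t. s \<in> {0..1} \<Longrightarrow> t \<in> {0..1} \<Longrightarrow> dist t s < d2 \<Longrightarrow> dist (\<phi> t) (\<phi> s) < e"
      using uc(2) e unfolding uniformly_continuous_on_def by meson
    obtain n :: nat where n: "0 < n" "1 / real n < min d1 d2"
      using real_arch_inverse[of "min d1 d2"] d1(1) d2(1) by (auto simp: inverse_eq_divide)
    let ?s = "\<lambda>i. real i / real n"
    have cell: "norm (\<phi> (?s (Suc i)) *\<^sub>R u (?s (Suc i)) - \<phi> (?s i) *\<^sub>R u (?s i) - integral {?s i..?s (Suc i)} ?f)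
        \<le> integral {?s i..?s (Suc i)} (\<lambda>r. e * (B + norm (g r)))" if i: "i < n" for i
    proof -
      define s t where "s = ?s i" and "t = ?s (Suc i)"
      have "real (Suc i) \<le> real n" using i by simp
      then have st: "0 \<le> s" "s \<le> t" "t \<le> 1" "t - s = 1 / real n"
        using n by (auto simp: s_def t_def divide_right_mono divide_le_eq diff_divide_distrib[symmetric])
      have "(\<phi>' has_integral (\<phi> t - \<phi> s)) {s..t}"
        using st test_fun_deriv[OF t]
        by (intro fundamental_theorem_of_calculus)
          (auto simp: has_real_derivative_iff_has_vector_derivative[symmetric] intro: has_field_derivative_at_within)
      then have h1: "((\<lambda>r. \<phi>' r *\<^sub>R u s) has_integral (\<phi> t - \<phi> s) *\<^sub>R u s) {s..t}"
        by (rule has_integral_scaleR_left)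
      have "(g has_integral (u t - u s)) {s..t}" using prim st by (simp add: primitive_on_unit_def)
      then have h2: "((\<lambda>r. \<phi> t *\<^sub>R g r) has_integral \<phi> t *\<^sub>R (u t - u s)) {s..t}"
        by (rule has_integral_cmul)
      have h3: "(?f has_integral integral {s..t} ?f) {s..t}"
        using st by (intro integrable_integral integrable_add sub[OF I1] sub[OF I2]) auto
      have "((\<lambda>r. \<phi>' r *\<^sub>R u s + \<phi> t *\<^sub>R g r - ?f r) has_integral
          ((\<phi> t - \<phi> s) *\<^sub>R u s + \<phi> t *\<^sub>R (u t - u s) - integral {s..t} ?f)) {s..t}"
        by (intro has_integral_diff has_integral_add h1 h2 h3)
      then have h: "((\<lambda>r. \<phi>' r *\<^sub>R (u s - u r) + (\<phi> t - \<phi> r) *\<^sub>R g r) has_integral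
          (\<phi> t *\<^sub>R u t - \<phi> s *\<^sub>R u s - integral {s..t} ?f)) {s..t}"
        by (simp add: algebra_simps)
      have "norm (\<phi>' r *\<^sub>R (u s - u r) + (\<phi> t - \<phi> r) *\<^sub>R g r) \<le> e * (B + norm (g r))" if r: "r \<in> {s..t}" for r
      proof -
        have "dist s r < d1" "dist t r < d2" "r \<in> {0..1}" using r st n by (auto simp: dist_real_def)
        then have "norm (u s - u r) \<le> e" "\<bar>\<phi> t - \<phi> r\<bar> \<le> e" "\<bar>\<phi>' r\<bar> \<le> B"
          using d1(2)[of r s] d2(2)[of r t] st B(2)[of r] by (auto simp: dist_norm)
        then have "\<bar>\<phi>' r\<bar> * norm (u s - u r) \<le> B * e" "\<bar>\<phi> t - \<phi> r\<bar> * norm (g r) \<le> e * norm (g r)"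
          using B by (auto intro!: mult_mono)
        then have "norm (\<phi>' r *\<^sub>R (u s - u r)) + norm ((\<phi> t - \<phi> r) *\<^sub>R g r) \<le> e * (B + norm (g r))"
          by (simp add: distrib_left mult.commute)
        then show ?thesis
          using norm_triangle_ineq[of "\<phi>' r *\<^sub>R (u s - u r)" "(\<phi> t - \<phi> r) *\<^sub>R g r"] by linarith
      qed
      then have "norm (integral {s..t} (\<lambda>r. \<phi>' r *\<^sub>R (u s - u r) + (\<phi> t - \<phi> r) *\<^sub>R g r))
          \<le> integral {s..t} (\<lambda>r. e * (B + norm (g r)))"
        using h st by (intro integral_norm_bound_integral integrable_on_mult_right sub[OF I3]) auto
      then show ?thesis using integral_unique[OF h] by (simp add: s_def t_def)
    qed
    have tel: "(\<Sum>i<n. \<phi> (?s (Suc i)) *\<^sub>R u (?s (Suc i)) - \<phi> (?s i) *\<^sub>R u (?s i)) = 0"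
      using sum_lessThan_telescope[of "\<lambda>i. \<phi> (?s i) *\<^sub>R u (?s i)" n] n test_fun_0[OF t] test_fun_1[OF t] by simp
    have grid: "(\<Sum>i<n. integral {?s i..?s (Suc i)} ?f) = integral {0..1} ?f"
      by (intro sum_integral_grid n integrable_add sub[OF I1] sub[OF I2]) auto
    have "norm (integral {0..1} ?f)
        = norm (\<Sum>i<n. \<phi> (?s (Suc i)) *\<^sub>R u (?s (Suc i)) - \<phi> (?s i) *\<^sub>R u (?s i) - integral {?s i..?s (Suc i)} ?f)"
      by (subst sum_subtractf) (simp only: tel grid, simp)
    also have "\<dots> \<le> (\<Sum>i<n. integral {?s i..?s (Suc i)} (\<lambda>r. e * (B + norm (g r))))"
      using cell by (intro sum_norm_le) auto
    also have "\<dots> = integral {0..1} (\<lambda>r. e * (B + norm (g r)))"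
      by (intro sum_integral_grid n integrable_on_mult_right sub[OF I3]) auto
    also have "\<dots> = e * ?J" by simp
    finally show ?thesis .
  qed
  then have "norm (integral {0..1} ?f) \<le> 0 + e" if "0 < e" for e
  proof -
    \<comment> \<open>The denominator \<open>?J + 1\<close> also covers the case that
      \<open>?J\<close> is 0.\<close>
    have "norm (integral {0..1} ?f) \<le> e / (?J + 1) * ?J"
      using \<open>\<And>e. 0 < e \<Longrightarrow> norm (integral {0..1} ?f) \<le> e * ?J\<close>[of "e / (?J + 1)"] that J by simp
    also have "\<dots> \<le> e" using that J by (simp add: field_simps)
    finally show ?thesis by simp
  qed
  then have "norm (integral {0..1} ?f) \<le> 0" by (rule field_le_epsilon)
  then have "integral {0..1} ?f = 0" by simp
  moreover have "integral {0..1} ?f = integral {0..1} (\<lambda>r. \<phi>' r *\<^sub>R u r) + integral {0..1} (\<lambda>r. \<phi> r *\<^sub>R g r)"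
    by (intro integral_add sub[OF I1] sub[OF I2]) auto
  ultimately show "(LINT t|?M. \<phi>' t *\<^sub>R u t) = - (LINT t|?M. \<phi> t *\<^sub>R g t)"
    using I1 I2 by (simp add: lebesgue_integral_eq_integral eq_neg_iff_add_eq_0)
qed

text \<open>By Henstock's lemma the Riemann sums of the norm of a function with vanishing indefinite
  integral are arbitrarily small.\<close>

lemma primitive_unique:
  fixes u :: "real \<Rightarrow> 'a::euclidean_space"
  assumes "primitive_on_unit u g" "primitive_on_unit u g'"
  shows "AE t in lebesgue_on {0..1}. g t = g' t"
proof -
  let ?d = "\<lambda>t. g t - g' t"
  have d: "(?d has_integral 0) {s..t}" if "0 \<le> s" "s \<le> t" "t \<le> 1" for s t
    using has_integral_diff[of g "u t - u s" "{s..t}" g' "u t - u s"] assms that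
    by (simp add: primitive_on_unit_def)
  have L2: "L2_fun ?d" using assms by (auto simp: primitive_on_unit_def intro: L2_fun_diff)
  have "((\<lambda>t. norm (?d t)) has_integral 0) {0..1}"
    unfolding has_integral_real
  proof (intro allI impI)
    fix e :: real assume e: "0 < e"
    have "?d integrable_on cbox 0 1" using d[of 0 1] by auto
    then obtain \<gamma> where \<gamma>: "gauge \<gamma>" "\<And>p. \<lbrakk>p tagged_partial_division_of cbox 0 1; \<gamma> fine p\<rbrakk> \<Longrightarrow>
        (\<Sum>(x,k)\<in>p. norm (measure lborel k *\<^sub>R ?d x - integral k ?d)) < e"
      using Henstock_lemma[OF _ e] by blast
    have "norm ((\<Sum>(x,k)\<in>p. measure lborel k *\<^sub>R norm (?d x)) - 0) < e"
      if p: "p tagged_division_of {0..1}" "\<gamma> fine p" for p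
    proof -
      have "(\<Sum>(x,k)\<in>p. measure lborel k *\<^sub>R norm (?d x))
          = (\<Sum>(x,k)\<in>p. norm (measure lborel k *\<^sub>R ?d x - integral k ?d))"
      proof (rule sum.cong[OF refl], safe)
        fix x k assume xk: "(x, k) \<in> p"
        obtain s t where k: "k = {s..t}" using tagged_division_ofD(4)[OF p(1) xk] by auto
        have "x \<in> k" "k \<subseteq> {0..1}" using tagged_division_ofD(2,3)[OF p(1) xk] by auto
        then have "integral k ?d = 0" using d[of s t] by (auto simp: k)
        then show "measure lborel k *\<^sub>R norm (?d x) = norm (measure lborel k *\<^sub>R ?d x - integral k ?d)"
          by simp
      qed
      also have "\<dots> < e"
        using p \<gamma>(2)[of p] by (auto simp: tagged_division_of_def)
      finally have "(\<Sum>(x,k)\<in>p. measure lborel k *\<^sub>R norm (?d x)) < e" .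
      moreover have "0 \<le> (\<Sum>(x,k)\<in>p. measure lborel k *\<^sub>R norm (?d x))"
        by (intro sum_nonneg) auto
      ultimately show ?thesis by simp
    qed
    then show "\<exists>\<gamma>. gauge \<gamma> \<and> (\<forall>p. p tagged_division_of {0..1} \<and> \<gamma> fine p \<longrightarrow>
        norm ((\<Sum>(x,k)\<in>p. measure lborel k *\<^sub>R norm (?d x)) - 0) < e)"
      using \<gamma>(1) by blast
  qed
  moreover have i: "integrable (lebesgue_on {0..1}) (\<lambda>t. norm (?d t))"
    using L2_fun_integrable[OF L2] by simp
  ultimately have "(LINT t|lebesgue_on {0..1}. norm (?d t)) = 0"
    by (simp add: lebesgue_integral_eq_integral integral_unique)
  then have "AE t in lebesgue_on {0..1}. norm (?d t) = 0"
    using integral_nonneg_eq_0_iff_AE[OF i] by simp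
  then show ?thesis by simp
qed

lemma weak_deriv_primitive:
  fixes u :: "real \<Rightarrow> 'a::euclidean_space"
  assumes "u \<in> H1"
  shows "primitive_on_unit u (weak_deriv u)"
proof -
  have "continuous_on {0..1} u" "\<exists>g. is_weak_deriv u g" using assms by (auto simp: H1_def)
  then show ?thesis
    unfolding weak_deriv_def by (intro weak_deriv_imp_primitive someI_ex[where P="is_weak_deriv u"])
qed

lemma primitive_H1:
  fixes u :: "real \<Rightarrow> 'a::euclidean_space"
  assumes "primitive_on_unit u g" "u \<in> extensional {0..1}"
  shows "u \<in> H1"
  using assms primitive_imp_weak_deriv[OF assms(1)] primitive_continuous[OF assms(1)]
    continuous_L2_fun[OF primitive_continuous[OF assms(1)]]
  by (auto simp: H1_def)

text \<open>\<open>weak_deriv u\<close> is an unspecified choice. Densities of the same function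
  agree almost everywhere, so any known one computes the energy.\<close>

lemma LINT_weak_deriv:
  fixes u :: "real \<Rightarrow> 'a::euclidean_space"
  assumes N: "is_norm N" and "u \<in> H1" "primitive_on_unit u g"
  shows "(LINT t|lebesgue_on {0..1}. (N (weak_deriv u t))\<^sup>2) = integral {0..1} (\<lambda>t. (N (g t))\<^sup>2)"
proof -
  note w = weak_deriv_primitive[OF assms(2)]
  have L2: "L2_fun g" "L2_fun (weak_deriv u)" using w assms(3) by (auto simp: primitive_on_unit_def)
  have "(LINT t|lebesgue_on {0..1}. (N (weak_deriv u t))\<^sup>2) = (LINT t|lebesgue_on {0..1}. (N (g t))\<^sup>2)"
  proof (rule integral_cong_AE)
    show "AE t in lebesgue_on {0..1}. (N (weak_deriv u t))\<^sup>2 = (N (g t))\<^sup>2"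
      using primitive_unique[OF w assms(3)] by eventually_elim simp
  qed (intro borel_measurable_integrable L2_fun_is_norm_sq_integrable[OF N] L2)+
  also have "\<dots> = integral {0..1} (\<lambda>t. (N (g t))\<^sup>2)"
    using L2_fun_is_norm_sq_integrable[OF N L2(1)] by (simp add: lebesgue_integral_eq_integral)
  finally show ?thesis .
qed

section \<open>Bounded Riesz sums characterise \<open>H\<^sup>1\<close>\<close>

lemma LINT_square_le:
  fixes f :: "real \<Rightarrow> 'a::euclidean_space"
  assumes "L2_fun f"
  shows "(LINT t|lebesgue_on {0..1}. norm (f t))\<^sup>2 \<le> (LINT t|lebesgue_on {0..1}. (norm (f t))\<^sup>2)"
proof -
  have i: "integrable (lebesgue_on {0..1}) (\<lambda>t. norm (f t))" "integrable (lebesgue_on {0..1}) (\<lambda>t. (norm (f t))\<^sup>2)"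
    using assms L2_fun_is_norm_integrable[OF is_norm_norm assms] by (auto simp: L2_fun_def)
  show ?thesis
    using square_integral_le[OF _ has_integral_integral_lebesgue_on[OF i(1)] has_integral_integral_lebesgue_on[OF i(2)]]
    by simp
qed

text \<open>Riesz-Fischer. On the unit interval an L2 Cauchy sequence is Cauchy in L1, which
  provides a subsequence converging almost everywhere. Fatou's lemma along it, with
  \<open>f k\<close> held fixed, turns the Cauchy bound into a bound for the distance from
  \<open>f k\<close> to the limit.\<close>

lemma L2_complete:
  fixes f :: "nat \<Rightarrow> real \<Rightarrow> 'a::euclidean_space"
  assumes L2: "\<And>k. L2_fun (f k)"
    and cauchy: "\<And>e. 0 < e \<Longrightarrow> \<exists>K. \<forall>j\<ge>K. \<forall>k\<ge>K. (LINT t|lebesgue_on {0..1}. (norm (f j t - f k t))\<^sup>2) < e"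
  obtains g where "L2_fun g" "(\<lambda>k. LINT t|lebesgue_on {0..1}. (norm (f k t - g t))\<^sup>2) \<longlonglongrightarrow> 0"
proof -
  let ?M = "lebesgue_on {0..1::real}"
  have m: "f k \<in> borel_measurable ?M" for k using L2_fun_measurable[OF L2] .
  have i2: "integrable ?M (\<lambda>t. (norm (f j t - f k t))\<^sup>2)" for j k
    using L2_fun_diff[OF L2 L2] by (simp add: L2_fun_def)
  have L1: "\<exists>K. \<forall>j\<ge>K. \<forall>k\<ge>K. (LINT t|?M. norm (f j t - f k t)) < e" if e: "0 < e" for e
  proof -
    obtain K where K: "\<And>j k. j \<ge> K \<Longrightarrow> k \<ge> K \<Longrightarrow> (LINT t|?M. (norm (f j t - f k t))\<^sup>2) < e\<^sup>2"
      using cauchy[of "e\<^sup>2"] e by auto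
    have "(LINT t|?M. norm (f j t - f k t)) < e" if "j \<ge> K" "k \<ge> K" for j k
      using LINT_square_le[OF L2_fun_diff[OF L2[of j] L2[of k]]] K[OF that] e
      by (meson less_imp_le order_le_less_trans power2_less_imp_less)
    then show ?thesis by blast
  qed
  obtain r where r: "strict_mono r" "AE t in ?M. Cauchy (\<lambda>i. f (r i) t)"
    using cauchy_L1_AE_cauchy_subseq[OF L2_fun_integrable[OF L2] L1] by blast
  define g where "g t = lim (\<lambda>i. f (r i) t)" for t
  have mg: "g \<in> borel_measurable ?M"
    unfolding g_def by (rule borel_measurable_lim_metric[OF m])
  have lim: "AE t in ?M. (\<lambda>i. f (r i) t) \<longlonglongrightarrow> g t"
    using r(2) by eventually_elim (simp add: g_def Cauchy_convergent_iff convergent_LIMSEQ_iff)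
  have key: "(\<integral>\<^sup>+ t. ennreal ((norm (f k t - g t))\<^sup>2) \<partial>?M) \<le> ennreal e"
    if K: "\<And>j. j \<ge> K \<Longrightarrow> (LINT t|?M. (norm (f k t - f j t))\<^sup>2) < e" for k K e
  proof -
    have "(\<integral>\<^sup>+ t. ennreal ((norm (f k t - g t))\<^sup>2) \<partial>?M)
        = (\<integral>\<^sup>+ t. liminf (\<lambda>i. ennreal ((norm (f k t - f (r i) t))\<^sup>2)) \<partial>?M)"
    proof (rule nn_integral_cong_AE)
      show "AE t in ?M. ennreal ((norm (f k t - g t))\<^sup>2) = liminf (\<lambda>i. ennreal ((norm (f k t - f (r i) t))\<^sup>2))"
        using lim
      proof eventually_elim
        case (elim t)
        then have "(\<lambda>i. ennreal ((norm (f k t - f (r i) t))\<^sup>2)) \<longlonglongrightarrow> ennreal ((norm (f k t - g t))\<^sup>2)"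
          by (intro tendsto_ennrealI tendsto_intros)
        then show ?case by (rule lim_imp_Liminf[OF sequentially_bot, symmetric])
      qed
    qed
    also have "\<dots> \<le> liminf (\<lambda>i. \<integral>\<^sup>+ t. ennreal ((norm (f k t - f (r i) t))\<^sup>2) \<partial>?M)"
      using m by (intro nn_integral_liminf) measurable
    also have "\<dots> \<le> limsup (\<lambda>i. \<integral>\<^sup>+ t. ennreal ((norm (f k t - f (r i) t))\<^sup>2) \<partial>?M)"
      by (rule Liminf_le_Limsup) simp
    also have "\<dots> \<le> ennreal e"
    proof (rule Limsup_bounded)
      show "\<forall>\<^sub>F i in sequentially. (\<integral>\<^sup>+ t. ennreal ((norm (f k t - f (r i) t))\<^sup>2) \<partial>?M) \<le> ennreal e"
        unfolding eventually_sequentially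
      proof (intro exI[of _ K] allI impI)
        fix i assume "K \<le> i"
        then have "K \<le> r i" using seq_suble[OF r(1), of i] by simp
        then show "(\<integral>\<^sup>+ t. ennreal ((norm (f k t - f (r i) t))\<^sup>2) \<partial>?M) \<le> ennreal e"
          using K[of "r i"] i2[of k "r i"] by (subst nn_integral_eq_integral) (auto intro!: ennreal_leI)
      qed
    qed
    finally show ?thesis .
  qed
  have mk: "(\<lambda>t. f k t - g t) \<in> borel_measurable ?M" for k using m mg by measurable
  have mk2: "(\<lambda>t. (norm (f k t - g t))\<^sup>2) \<in> borel_measurable ?M" for k using mk by measurable
  have int: "integrable ?M (\<lambda>t. (norm (f k t - g t))\<^sup>2)" if "\<And>j. j \<ge> K \<Longrightarrow> (LINT t|?M. (norm (f k t - f j t))\<^sup>2) < e" for k K e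
    using key[of K k e, OF that] by (intro integrableI_bounded mk2) (auto intro: order_le_less_trans)
  obtain K1 where K1: "\<And>j k. j \<ge> K1 \<Longrightarrow> k \<ge> K1 \<Longrightarrow> (LINT t|?M. (norm (f j t - f k t))\<^sup>2) < 1"
    using cauchy[of 1] by auto
  have "L2_fun (\<lambda>t. f K1 t - g t)"
    using int[of K1 K1 1] K1 mk by (simp add: L2_fun_def)
  from L2_fun_diff[OF L2[of K1] this] have "L2_fun g" by simp
  moreover have "(\<lambda>k. LINT t|?M. (norm (f k t - g t))\<^sup>2) \<longlonglongrightarrow> 0"
  proof (rule LIMSEQ_I)
    fix e :: real assume e: "0 < e"
    obtain K where K: "\<And>j k. j \<ge> K \<Longrightarrow> k \<ge> K \<Longrightarrow> (LINT t|?M. (norm (f j t - f k t))\<^sup>2) < e / 2"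
      using cauchy[of "e / 2"] e by auto
    have "norm ((LINT t|?M. (norm (f k t - g t))\<^sup>2) - 0) < e" if k: "K \<le> k" for k
    proof -
      have "ennreal (LINT t|?M. (norm (f k t - g t))\<^sup>2) = (\<integral>\<^sup>+ t. ennreal ((norm (f k t - g t))\<^sup>2) \<partial>?M)"
        using int[OF K[OF k]] by (subst nn_integral_eq_integral) auto
      also have "\<dots> \<le> ennreal (e / 2)" by (rule key[OF K[OF k]])
      finally have "(LINT t|?M. (norm (f k t - g t))\<^sup>2) \<le> e / 2" using e by (subst (asm) ennreal_le_iff) auto
      moreover have "0 \<le> (LINT t|?M. (norm (f k t - g t))\<^sup>2)" by simp
      ultimately show ?thesis using e by (simp only: real_norm_def diff_zero)
    qed
    then show "\<exists>no. \<forall>k\<ge>no. norm ((LINT t|?M. (norm (f k t - g t))\<^sup>2) - 0) < e" by blast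
  qed
  ultimately show thesis by (rule that)
qed

section \<open>Difference quotients on nested grids\<close>

lemma has_integral_grid:
  fixes f :: "real \<Rightarrow> 'a::euclidean_space"
  assumes n: "0 < n" and f: "\<And>i. i < n \<Longrightarrow> (f has_integral I i) {real i / real n..real (Suc i) / real n}"
  shows "(f has_integral (\<Sum>i<n. I i)) {0..1}"
proof -
  have "(f has_integral (\<Sum>i<k. I i)) {0..real k / real n}" if "k \<le> n" for k
    using that
  proof (induction k)
    case 0
    then show ?case using has_integral_refl(2)[of f 0] by simp
  next
    case (Suc k)
    have "(f has_integral (\<Sum>i<k. I i) + I k) {0..real (Suc k) / real n}"
      using Suc by (intro has_integral_combine[OF _ _ Suc.IH f]) (auto simp: divide_right_mono)
    then show ?case by simp
  qed
  from this[of n] show ?thesis using n by simp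
qed

text \<open>If \<open>u\<close> has a density, this is its average over each cell, that is, its
  conditional expectation given the grid. The formula makes sense without a density, which is what
  allows one to be constructed.\<close>

definition grid_slope :: "nat \<Rightarrow> (real \<Rightarrow> 'a::real_vector) \<Rightarrow> real \<Rightarrow> 'a" where
  "grid_slope n u = step n (\<lambda>i. real n *\<^sub>R (u (real (Suc i) / real n) - u (real i / real n)))"

lemma grid_slope_norm_integral:
  fixes u :: "real \<Rightarrow> 'a::euclidean_space"
  assumes N: "is_norm N" and n: "0 < n"
  shows "((\<lambda>t. (N (grid_slope n u t))\<^sup>2) has_integral riesz_sum N n u) {0..1}"
proof -
  let ?D = "\<lambda>i. u (real (Suc i) / real n) - u (real i / real n)"
  have "((\<lambda>t. (N (grid_slope n u t))\<^sup>2) has_integral (1 / real n) *\<^sub>R (\<Sum>i<n. (N (real n *\<^sub>R ?D i))\<^sup>2)) {0..1}"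
    unfolding grid_slope_def comp_step[of "\<lambda>x. (N x)\<^sup>2"] by (rule step_has_integral_unit[OF n])
  also have "(1 / real n) *\<^sub>R (\<Sum>i<n. (N (real n *\<^sub>R ?D i))\<^sup>2) = riesz_sum N n u"
    using n by (simp add: riesz_sum_def is_norm_scale[OF N] power_mult_distrib sum_distrib_left[symmetric])
      (simp add: power2_eq_square)
  finally show ?thesis .
qed

text \<open>The points \<open>i / m\<close> belong to the refined grid, where they have index
  \<open>i * q\<close>, so the fine increments between them telescope.\<close>

lemma grid_slope_has_integral:
  fixes u :: "real \<Rightarrow> 'a::euclidean_space"
  assumes "0 < m" "0 < q" "i \<le> j"
  shows "(grid_slope (m * q) u has_integral (u (real j / real m) - u (real i / real m)))
    {real i / real m..real j / real m}"
proof -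
  let ?n = "m * q"
  let ?v = "\<lambda>k. real ?n *\<^sub>R (u (real (Suc k) / real ?n) - u (real k / real ?n))"
  have n: "0 < ?n" using assms by simp
  have "(step ?n ?v has_integral (1 / real ?n) *\<^sub>R (\<Sum>k=i*q..<j*q. ?v k)) {real (i * q) / real ?n..real (j * q) / real ?n}"
    using assms by (intro step_has_integral[OF n]) auto
  moreover have "(1 / real ?n) *\<^sub>R (\<Sum>k=i*q..<j*q. ?v k)
      = (\<Sum>k=i*q..<j*q. u (real (Suc k) / real ?n) - u (real k / real ?n))"
    using n by (simp only: scaleR_sum_right[symmetric]) simp
  moreover have "\<dots> = u (real (j * q) / real ?n) - u (real (i * q) / real ?n)"
    using assms by (intro sum_Suc_diff') auto
  moreover have "real (k * q) / real ?n = real k / real m" for k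
    using assms by simp
  ultimately show ?thesis by (simp add: grid_slope_def)
qed

text \<open>The slopes on successively refined grids form a martingale.\<close>

lemma grid_slope_orthogonal:
  fixes u :: "real \<Rightarrow> 'a::euclidean_space"
  assumes m: "0 < m" and q: "0 < q"
  shows "((\<lambda>t. (norm (grid_slope (m * q) u t - grid_slope m u t))\<^sup>2)
    has_integral (riesz_sum norm (m * q) u - riesz_sum norm m u)) {0..1}"
proof -
  let ?f = "grid_slope (m * q) u" and ?g = "grid_slope m u"
  let ?D = "\<lambda>i. u (real (Suc i) / real m) - u (real i / real m)"
  \<comment> \<open>On a coarse cell \<open>?g\<close> is constant and \<open>?f\<close> integrates
    to the coarse increment. The mixed term therefore equals the coarse energy, and expanding the
    square leaves the difference of the two energies, as in Pythagoras' theorem.\<close>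
  have "((\<lambda>t. ?f t \<bullet> ?g t) has_integral (\<Sum>i<m. ?D i \<bullet> (real m *\<^sub>R ?D i))) {0..1}"
  proof (rule has_integral_grid[OF m])
    fix i assume "i < m"
    have "((\<lambda>t. ?f t \<bullet> (real m *\<^sub>R ?D i)) has_integral (?D i \<bullet> (real m *\<^sub>R ?D i))) {real i / real m..real (Suc i) / real m}"
      using has_integral_linear[OF grid_slope_has_integral[OF m q, of i "Suc i" u] bounded_linear_inner_left,
          of "real m *\<^sub>R ?D i"]
      unfolding o_def by simp
    then show "((\<lambda>t. ?f t \<bullet> ?g t) has_integral (?D i \<bullet> (real m *\<^sub>R ?D i))) {real i / real m..real (Suc i) / real m}"
    proof (rule has_integral_spike_finite[where S="{real (Suc i) / real m}", rotated 2])
      fix t assume t: "t \<in> {real i / real m..real (Suc i) / real m} - {real (Suc i) / real m}"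
      then have "?g t = real m *\<^sub>R ?D i"
        unfolding grid_slope_def by (intro step_eq[OF m]) auto
      then show "?f t \<bullet> ?g t = ?f t \<bullet> (real m *\<^sub>R ?D i)" by simp
    qed simp
  qed
  also have "(\<Sum>i<m. ?D i \<bullet> (real m *\<^sub>R ?D i)) = riesz_sum norm m u"
    by (simp add: riesz_sum_def sum_distrib_left power2_norm_eq_inner)
  finally have fg: "((\<lambda>t. ?f t \<bullet> ?g t) has_integral riesz_sum norm m u) {0..1}" .
  have ff: "((\<lambda>t. (norm (?f t))\<^sup>2) has_integral riesz_sum norm (m * q) u) {0..1}"
    using m q by (intro grid_slope_norm_integral is_norm_norm) simp
  have gg: "((\<lambda>t. (norm (?g t))\<^sup>2) has_integral riesz_sum norm m u) {0..1}"
    using m by (intro grid_slope_norm_integral is_norm_norm)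
  have "((\<lambda>t. (norm (?f t))\<^sup>2 - 2 * (?f t \<bullet> ?g t) + (norm (?g t))\<^sup>2) has_integral
      (riesz_sum norm (m * q) u - 2 * riesz_sum norm m u + riesz_sum norm m u)) {0..1}"
    by (intro has_integral_add has_integral_diff ff gg has_integral_mult_right fg)
  moreover have "(norm (?f t))\<^sup>2 - 2 * (?f t \<bullet> ?g t) + (norm (?g t))\<^sup>2 = (norm (?f t - ?g t))\<^sup>2" for t
    by (simp add: power2_norm_eq_inner inner_diff_left inner_diff_right inner_commute)
  ultimately show ?thesis by simp
qed

lemma L2_fun_grid_slope:
  fixes u :: "real \<Rightarrow> 'a::euclidean_space"
  shows "0 < n \<Longrightarrow> L2_fun (grid_slope n u)"
  unfolding grid_slope_def by (rule L2_fun_step)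

text \<open>Young's inequality with a parameter: the leading factor can be brought arbitrarily near
  to 1, at the price of a large weight on an error that will tend to 0.\<close>

lemma is_norm_sq_split:
  assumes N: "is_norm N" and "0 < \<eta>"
  shows "(N x)\<^sup>2 \<le> (1 + \<eta>) * (N y)\<^sup>2 + (1 + 1 / \<eta>) * (N (y - x))\<^sup>2"
proof -
  have "N x \<le> N y + N (y - x)"
    using is_norm_triangle[OF N, of y "x - y"] is_norm_minus_commute[OF N, of x y] by simp
  then have "(N x)\<^sup>2 \<le> (N y + N (y - x))\<^sup>2" by (intro power_mono is_norm_ge0[OF N])
  moreover have "2 * (N y * N (y - x)) \<le> \<eta> * (N y)\<^sup>2 + (1 / \<eta>) * (N (y - x))\<^sup>2"
  proof -
    have "0 \<le> (1 / \<eta>) * (\<eta> * N y - N (y - x))\<^sup>2" using assms by simp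
    also have "\<dots> = \<eta> * (N y)\<^sup>2 - 2 * (N y * N (y - x)) + (1 / \<eta>) * (N (y - x))\<^sup>2"
      using assms(2) by (simp add: power2_eq_square field_simps)
    finally show ?thesis by simp
  qed
  ultimately show ?thesis by (simp add: power2_sum algebra_simps)
qed

lemma dyadic_floor_tendsto:
  fixes t :: real
  assumes "0 \<le> t"
  shows "(\<lambda>j. real (nat \<lfloor>2 ^ j * t\<rfloor>) / 2 ^ j) \<longlonglongrightarrow> t"
proof (rule LIM_zero_cancel, rule Lim_null_comparison)
  show "\<forall>\<^sub>F j in sequentially. norm (real (nat \<lfloor>2 ^ j * t\<rfloor>) / 2 ^ j - t) \<le> (1/2) ^ j"
  proof (intro always_eventually allI)
    fix j
    have "real (nat \<lfloor>2 ^ j * t\<rfloor>) = of_int \<lfloor>2 ^ j * t\<rfloor>" using assms by simp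
    then have "\<bar>real (nat \<lfloor>2 ^ j * t\<rfloor>) - 2 ^ j * t\<bar> \<le> 1" by linarith
    then have "\<bar>real (nat \<lfloor>2 ^ j * t\<rfloor>) - 2 ^ j * t\<bar> / 2 ^ j \<le> 1 / 2 ^ j" by (rule divide_right_mono) simp
    moreover have "real (nat \<lfloor>2 ^ j * t\<rfloor>) / 2 ^ j - t = (real (nat \<lfloor>2 ^ j * t\<rfloor>) - 2 ^ j * t) / 2 ^ j"
      by (simp add: diff_divide_distrib)
    ultimately show "norm (real (nat \<lfloor>2 ^ j * t\<rfloor>) / 2 ^ j - t) \<le> (1/2) ^ j"
      by (simp add: power_one_over abs_divide)
  qed
  show "(\<lambda>j. (1/2::real) ^ j) \<longlonglongrightarrow> 0" by (intro LIMSEQ_realpow_zero) auto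
qed

text \<open>By orthogonality the dyadic sums increase, and the squared L2 distance of two slopes is
  the difference of their sums; boundedness thus makes the slopes Cauchy. Their limit
  \<open>g\<close> recovers the increments of \<open>u\<close> at dyadic points, and by density and
  continuity everywhere. For a general \<open>N\<close> the sums lie below the energy of
  \<open>g\<close> by Jensen, and L2 convergence of the slopes supplies the matching lower
  bound.\<close>

lemma riesz_sum_bounded_imp_primitive:
  fixes u :: "real \<Rightarrow> 'a::euclidean_space"
  assumes u: "continuous_on {0..1} u" and B: "\<And>j. riesz_sum norm (2 ^ j) u \<le> B"
  obtains g where "primitive_on_unit u g"
    "\<And>N. is_norm N \<Longrightarrow> (\<lambda>j. riesz_sum N (2 ^ j) u) \<longlonglongrightarrow> integral {0..1} (\<lambda>t. (N (g t))\<^sup>2)"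
proof -
  let ?M = "lebesgue_on {0..1::real}"
  let ?f = "\<lambda>j. grid_slope (2 ^ j) u"
  let ?R = "\<lambda>j. riesz_sum norm (2 ^ j) u"
  have L2: "L2_fun (?f j)" for j by (rule L2_fun_grid_slope) simp
  have i2: "integrable ?M (\<lambda>t. (norm (?f j t - ?f k t))\<^sup>2)" for j k
    using L2_fun_diff[OF L2 L2] by (simp add: L2_fun_def)
  have diff: "((\<lambda>t. (norm (?f k t - ?f j t))\<^sup>2) has_integral (?R k - ?R j)) {0..1}" if "j \<le> k" for j k
  proof -
    have "(2::nat) ^ k = 2 ^ j * 2 ^ (k - j)" using that by (simp flip: power_add)
    then show ?thesis using grid_slope_orthogonal[of "2 ^ j" "2 ^ (k - j)" u] by simp
  qed
  have LI: "(LINT t|?M. (norm (?f k t - ?f j t))\<^sup>2) = ?R k - ?R j" if "j \<le> k" for j k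
    using integral_unique[OF diff[OF that]] i2[of k j] by (simp add: lebesgue_integral_eq_integral)
  have mono: "?R j \<le> ?R k" if "j \<le> k" for j k
    using has_integral_nonneg[OF diff[OF that]] by simp
  have "Bseq ?R"
  proof (rule BseqI'[of _ "B"])
    fix j
    have "0 \<le> ?R j" by (simp add: riesz_sum_def sum_nonneg)
    then show "norm (?R j) \<le> B" using B[of j] by simp
  qed
  then have "Cauchy ?R"
    using mono by (intro convergent_Cauchy Bseq_monoseq_convergent) (auto simp: monoseq_def)
  have cauchy: "\<exists>K. \<forall>j\<ge>K. \<forall>k\<ge>K. (LINT t|?M. (norm (?f j t - ?f k t))\<^sup>2) < e" if e: "0 < e" for e
  proof -
    obtain K where K: "\<And>j k. j \<ge> K \<Longrightarrow> k \<ge> K \<Longrightarrow> \<bar>?R j - ?R k\<bar> < e"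
      using \<open>Cauchy ?R\<close> e unfolding Cauchy_def dist_real_def by meson
    have "(LINT t|?M. (norm (?f j t - ?f k t))\<^sup>2) < e" if jk: "j \<ge> K" "k \<ge> K" for j k
    proof (cases "k \<le> j")
      case True
      then show ?thesis using LI[OF True] K[OF jk] by simp
    next
      case False
      then show ?thesis using LI[of j k] K[OF jk] by (simp add: norm_minus_commute)
    qed
    then show ?thesis by blast
  qed
  obtain g where g: "L2_fun g" and lim: "(\<lambda>k. LINT t|?M. (norm (?f k t - g t))\<^sup>2) \<longlonglongrightarrow> 0"
    using L2_complete[OF L2 cauchy] by blast
  have ig2: "integrable ?M (\<lambda>t. (norm (?f k t - g t))\<^sup>2)" for k
    using L2_fun_diff[OF L2 g] by (simp add: L2_fun_def)
  have ig: "g integrable_on {s..t}" if "0 \<le> s" "t \<le> 1" for s t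
    using lebesgue_on_integrable_on_subinterval[OF L2_fun_integrable[OF g] that] .
  define v where "v t = u t - (u 0 + integral {0..t} g)" for t
  have cv: "continuous_on {0..1} v"
    unfolding v_def by (intro continuous_intros u indefinite_integral_continuous_1 ig) auto
  have dyadic: "v (real i / 2 ^ j) = 0" if i: "i \<le> 2 ^ j" for i j
  proof -
    let ?t = "real i / 2 ^ j"
    have "real i \<le> real (2 ^ j)" using i by (simp only: of_nat_le_iff)
    then have t: "0 \<le> ?t" "?t \<le> 1" by (auto simp: divide_le_eq)
    have "(\<lambda>k. integral {0..?t} (\<lambda>r. ?f k r - g r)) \<longlonglongrightarrow> 0"
    proof (rule Lim_null_comparison)
      show "\<forall>\<^sub>F k in sequentially. norm (integral {0..?t} (\<lambda>r. ?f k r - g r)) \<le> sqrt (LINT t|?M. (norm (?f k t - g t))\<^sup>2)"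
      proof (intro always_eventually allI real_le_rsqrt)
        fix k
        have "(norm (integral {0..?t} (\<lambda>r. ?f k r - g r)))\<^sup>2 \<le> ?t * integral {0..1} (\<lambda>r. (norm (?f k r - g r))\<^sup>2)"
          using primitive_increment_le_total[OF is_norm_norm primitive_integral[OF L2_fun_diff[OF L2 g]], of 0 ?t 0 k] t
          by simp
        also have "\<dots> \<le> 1 * integral {0..1} (\<lambda>r. (norm (?f k r - g r))\<^sup>2)"
          using t lebesgue_on_integrable_on_subinterval[OF ig2]
          by (intro mult_right_mono Henstock_Kurzweil_Integration.integral_nonneg) auto
        also have "\<dots> = (LINT t|?M. (norm (?f k t - g t))\<^sup>2)"
          using ig2 by (simp add: lebesgue_integral_eq_integral)
        finally show "(norm (integral {0..?t} (\<lambda>r. ?f k r - g r)))\<^sup>2 \<le> (LINT t|?M. (norm (?f k t - g t))\<^sup>2)" .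
      qed
      show "(\<lambda>k. sqrt (LINT t|?M. (norm (?f k t - g t))\<^sup>2)) \<longlonglongrightarrow> 0"
        using tendsto_real_sqrt[OF lim] by simp
    qed
    \<comment> \<open>From level \<open>j\<close> on the point lies on the grid, and the sequence is
      constant.\<close>
    moreover have "\<forall>\<^sub>F k in sequentially. integral {0..?t} (\<lambda>r. ?f k r - g r) = v ?t"
      unfolding eventually_sequentially
    proof (intro exI[of _ j] allI impI)
      fix k assume "j \<le> k"
      then have "(2::nat) ^ k = 2 ^ j * 2 ^ (k - j)" by (simp flip: power_add)
      then have f: "(?f k has_integral (u ?t - u 0)) {0..?t}"
        using grid_slope_has_integral[of "2 ^ j" "2 ^ (k - j)" 0 i u] by simp
      have "((\<lambda>r. ?f k r - g r) has_integral (u ?t - u 0 - integral {0..?t} g)) {0..?t}"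
        using t by (intro has_integral_diff f integrable_integral ig) auto
      then show "integral {0..?t} (\<lambda>r. ?f k r - g r) = v ?t"
        by (simp add: v_def integral_unique algebra_simps)
    qed
    ultimately have "(\<lambda>k. v ?t) \<longlonglongrightarrow> 0" by (rule Lim_transform_eventually)
    then show ?thesis by (simp add: LIMSEQ_const_iff)
  qed
  have v0: "v t = 0" if t: "t \<in> {0..1}" for t
  proof -
    let ?d = "\<lambda>j. real (nat \<lfloor>2 ^ j * t\<rfloor>) / 2 ^ j"
    have le: "nat \<lfloor>2 ^ j * t\<rfloor> \<le> 2 ^ j" for j
    proof -
      have "2 ^ j * t \<le> 2 ^ j * 1" using t by (intro mult_left_mono) auto
      then have "\<lfloor>2 ^ j * t\<rfloor> \<le> \<lfloor>(2::real) ^ j\<rfloor>" by (intro floor_mono) simp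
      also have "\<lfloor>(2::real) ^ j\<rfloor> = 2 ^ j" by (metis floor_of_int of_int_numeral of_int_power)
      finally show ?thesis by (simp add: nat_le_iff)
    qed
    have "?d j \<in> {0..1}" for j
    proof -
      have "real (nat \<lfloor>2 ^ j * t\<rfloor>) \<le> real (2 ^ j)" using le[of j] by (simp only: of_nat_le_iff)
      then show ?thesis by (auto simp: divide_le_eq)
    qed
    then have "(\<lambda>j. v (?d j)) \<longlonglongrightarrow> v t"
      using t by (intro continuous_on_tendsto_compose[OF cv dyadic_floor_tendsto]) auto
    then have "(\<lambda>j. 0) \<longlonglongrightarrow> v t" using dyadic[OF le] by simp
    then show ?thesis by (simp add: LIMSEQ_const_iff)
  qed
  have prim: "primitive_on_unit u g"
    unfolding primitive_on_unit_def
  proof (intro conjI allI impI g)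
    fix s t :: real assume st: "0 \<le> s \<and> s \<le> t \<and> t \<le> 1"
    have "(g has_integral ((u 0 + integral {0..t} g) - (u 0 + integral {0..s} g))) {s..t}"
      using primitive_integral[OF g, of "u 0"] st unfolding primitive_on_unit_def by blast
    moreover have "u 0 + integral {0..t} g = u t" "u 0 + integral {0..s} g = u s"
      using v0[of t] v0[of s] st by (auto simp: v_def)
    ultimately show "(g has_integral (u t - u s)) {s..t}" by simp
  qed
  moreover have "(\<lambda>j. riesz_sum N (2 ^ j) u) \<longlonglongrightarrow> integral {0..1} (\<lambda>t. (N (g t))\<^sup>2)"
    if N: "is_norm N" for N
  proof (rule LIMSEQ_I)
    fix e :: real assume e: "0 < e"
    let ?I = "integral {0..1} (\<lambda>t. (N (g t))\<^sup>2)"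
    obtain C where C: "0 < C" "\<And>x. N x \<le> C * norm x" using is_norm_le_norm[OF N] by blast
    have iN: "integrable ?M (\<lambda>t. (N (g t))\<^sup>2)" by (rule L2_fun_is_norm_sq_integrable[OF N g])
    have I0: "0 \<le> ?I"
      by (intro Henstock_Kurzweil_Integration.integral_nonneg lebesgue_on_integrable_on_subinterval[OF iN]) auto
    have upper: "riesz_sum N (2 ^ j) u \<le> ?I" for j by (rule riesz_sum_le[OF N prim]) simp
    \<comment> \<open>Chosen so that the surplus \<open>\<eta> * ?I\<close> takes less than half of
      \<open>e\<close>; the other half absorbs the weighted L2 error. The summand 1 covers
      \<open>?I = 0\<close>.\<close>
    define \<eta> where "\<eta> = e / (2 * (?I + 1))"
    have \<eta>: "0 < \<eta>" "\<eta> * ?I < e / 2"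
      using e I0 by (auto simp: \<eta>_def field_simps)
    let ?c = "(1 + 1 / \<eta>) * C\<^sup>2"
    have "(\<lambda>k. ?c * (LINT t|?M. (norm (?f k t - g t))\<^sup>2)) \<longlonglongrightarrow> ?c * 0"
      by (intro tendsto_intros lim)
    then have "\<forall>\<^sub>F k in sequentially. ?c * (LINT t|?M. (norm (?f k t - g t))\<^sup>2) < e / 2"
      using e order_tendstoD(2)[of _ 0 sequentially "e / 2"] by simp
    then obtain K where K: "\<And>k. K \<le> k \<Longrightarrow> ?c * (LINT t|?M. (norm (?f k t - g t))\<^sup>2) < e / 2"
      by (auto simp: eventually_sequentially)
    have "norm (riesz_sum N (2 ^ k) u - ?I) < e" if k: "K \<le> k" for k
    proof -
      have h: "((\<lambda>t. (1 + \<eta>) * (N (?f k t))\<^sup>2 + ?c * (norm (?f k t - g t))\<^sup>2) has_integral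
          ((1 + \<eta>) * riesz_sum N (2 ^ k) u + ?c * (LINT t|?M. (norm (?f k t - g t))\<^sup>2))) {0..1}"
        using has_integral_integral_lebesgue_on[OF ig2]
        by (intro has_integral_add has_integral_mult_right grid_slope_norm_integral N) auto
      have "(N (g t))\<^sup>2 \<le> (1 + \<eta>) * (N (?f k t))\<^sup>2 + ?c * (norm (?f k t - g t))\<^sup>2" for t
      proof -
        have "(N (?f k t - g t))\<^sup>2 \<le> C\<^sup>2 * (norm (?f k t - g t))\<^sup>2"
          using power_mono[OF C(2)[of "?f k t - g t"] is_norm_ge0[OF N], of 2] by (simp add: power_mult_distrib)
        then have "(1 + 1 / \<eta>) * (N (?f k t - g t))\<^sup>2 \<le> (1 + 1 / \<eta>) * (C\<^sup>2 * (norm (?f k t - g t))\<^sup>2)"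
          using \<eta>(1) by (intro mult_left_mono) auto
        then show ?thesis using is_norm_sq_split[OF N \<eta>(1), of "g t" "?f k t"] by (simp add: mult.assoc)
      qed
      then have "?I \<le> (1 + \<eta>) * riesz_sum N (2 ^ k) u + ?c * (LINT t|?M. (norm (?f k t - g t))\<^sup>2)"
        using lebesgue_on_integrable_on_subinterval[OF iN, of 0 1]
        by (intro has_integral_le[OF integrable_integral h]) auto
      also have "\<dots> < (1 + \<eta>) * riesz_sum N (2 ^ k) u + e / 2" using K[OF k] by simp
      also have "\<dots> \<le> riesz_sum N (2 ^ k) u + \<eta> * ?I + e / 2"
        using mult_left_mono[OF upper[of k], of \<eta>] \<eta>(1) by (simp add: distrib_right)
      finally have "?I < riesz_sum N (2 ^ k) u + e" using \<eta>(2) by simp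
      then show ?thesis using upper[of k] by simp
    qed
    then show "\<exists>no. \<forall>n\<ge>no. norm (riesz_sum N (2 ^ n) u - ?I) < e" by blast
  qed
  ultimately show thesis by (rule that)
qed

section \<open>The differential equation and the Euler scheme\<close>

lemma picard_iterates_converge:
  fixes P :: "nat \<Rightarrow> real \<Rightarrow> 'a::euclidean_space"
  assumes "\<And>k t. t \<in> {0..1} \<Longrightarrow> norm (P (Suc k) t - P k t) \<le> D * (1/2) ^ k"
  obtains X where "uniform_limit {0..1} P X sequentially"
proof -
  have "summable (\<lambda>k. D * (1/2::real) ^ k)" by (intro summable_mult summable_geometric) simp
  then have "uniform_limit {0..1} (\<lambda>n t. \<Sum>i<n. P (Suc i) t - P i t) (\<lambda>t. \<Sum>i. P (Suc i) t - P i t) sequentially"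
    using assms by (intro Weierstrass_m_test)
  moreover have "uniform_limit {0..1} (\<lambda>n. P 0) (P 0) sequentially"
    by (rule uniform_limit_const)
  ultimately have "uniform_limit {0..1} (\<lambda>n t. (\<Sum>i<n. P (Suc i) t - P i t) + P 0 t)
      (\<lambda>t. (\<Sum>i. P (Suc i) t - P i t) + P 0 t) sequentially"
    by (rule uniform_limit_add)
  moreover have "(\<Sum>i<n. P (Suc i) t - P i t) + P 0 t = P n t" for n t
    using sum_lessThan_telescope[of "\<lambda>i. P i t" n] by simp
  ultimately have "uniform_limit {0..1} P (\<lambda>t. (\<Sum>i. P (Suc i) t - P i t) + P 0 t) sequentially"
    by simp
  then show thesis by (rule that)
qed

text \<open>The origin of the contraction factor 1/2: integrating the weight
  \<open>exp (2 * C * s)\<close> against the Lipschitz constant \<open>C\<close> returns at most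
  half of the weight.\<close>

lemma has_integral_exp_scaled:
  fixes C t :: real
  assumes "0 < C" "0 \<le> t"
  shows "((\<lambda>s. C * exp (2 * C * s)) has_integral (exp (2 * C * t) - 1) / 2) {0..t}"
proof -
  have "((\<lambda>s. C * exp (2 * C * s)) has_integral (exp (2 * C * t) / 2 - exp (2 * C * 0) / 2)) {0..t}"
  proof (rule fundamental_theorem_of_calculus[OF assms(2)])
    fix s
    have "((\<lambda>s. exp (2 * C * s) / 2) has_real_derivative C * exp (2 * C * s)) (at s within {0..t})"
      by (auto intro!: derivative_eq_intros)
    then show "((\<lambda>s. exp (2 * C * s) / 2) has_vector_derivative C * exp (2 * C * s)) (at s within {0..t})"
      by (simp add: has_real_derivative_iff_has_vector_derivative)
  qed
  then show ?thesis by (simp add: diff_divide_distrib)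
qed

text \<open>Picard iteration on the whole of \<open>[0,1]\<close>: in the sup norm weighted by \<open>exp (-2 C t)\<close> the
  iteration contracts by \<open>1/2\<close>.\<close>

lemma lipschitz_ivp_solution:
  fixes f :: "real \<Rightarrow> 'a::euclidean_space \<Rightarrow> 'a"
  assumes C: "0 < C" and lip: "\<And>t x y. t \<in> {0..1} \<Longrightarrow> norm (f t x - f t y) \<le> C * norm (x - y)"
    and cont: "\<And>X. continuous_on {0..1} X \<Longrightarrow> continuous_on {0..1} (\<lambda>t. f t (X t))"
  obtains X where "X 0 = x0" "\<And>t. t \<in> {0..1} \<Longrightarrow> (X has_vector_derivative f t (X t)) (at t within {0..1})"
proof -
  define P where "P = rec_nat (\<lambda>t. x0) (\<lambda>k Y t. x0 + integral {0..t} (\<lambda>s. f s (Y s)))"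
  have P0: "P 0 = (\<lambda>t. x0)" and PS: "\<And>k. P (Suc k) = (\<lambda>t. x0 + integral {0..t} (\<lambda>s. f s (P k s)))"
    by (simp_all add: P_def)
  have cP: "continuous_on {0..1} (P k)" for k
  proof (induction k)
    case (Suc k)
    show ?case unfolding PS
      by (intro continuous_intros indefinite_integral_continuous_1 integrable_continuous_real cont Suc)
  qed (simp add: P0)
  have int: "(\<lambda>s. f s (X s)) integrable_on {0..t}" if "continuous_on {0..1} X" "t \<in> {0..1}" for X t
    using that by (intro integrable_continuous_real continuous_on_subset[OF cont]) auto
  obtain M where M: "0 < M" "\<And>t. t \<in> {0..1} \<Longrightarrow> norm (f t x0) \<le> M"
    using compact_imp_bounded[OF compact_continuous_image[OF cont[of "\<lambda>t. x0"]]]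
    by (auto simp: bounded_pos)
  \<comment> \<open>The weight has to stay in the induction hypothesis: a bound uniform in
    \<open>t\<close> would contribute a factor \<open>C\<close> per iteration, which may exceed
    1.\<close>
  have step: "norm (P (Suc k) t - P k t) \<le> M * (1/2) ^ k * exp (2 * C * t)" if "t \<in> {0..1}" for k t
    using that
  proof (induction k arbitrary: t)
    case 0
    have "norm (integral {0..t} (\<lambda>s. f s x0)) \<le> M * (t - 0)"
      using 0 M by (intro integral_bound continuous_on_subset[OF cont]) auto
    also have "\<dots> \<le> M * 1" using 0 M by (intro mult_left_mono) auto
    also have "\<dots> \<le> M * exp (2 * C * t)" using 0 M C by (intro mult_left_mono) auto
    finally show ?case by (simp add: PS P0)
  next
    case (Suc k)
    have h: "((\<lambda>s. M * (1/2) ^ k * (C * exp (2 * C * s))) has_integral M * (1/2) ^ k * ((exp (2 * C * t) - 1) / 2)) {0..t}"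
      using Suc C by (intro has_integral_mult_right has_integral_exp_scaled) auto
    have "P (Suc (Suc k)) t - P (Suc k) t = integral {0..t} (\<lambda>s. f s (P (Suc k) s)) - integral {0..t} (\<lambda>s. f s (P k s))"
      by (simp only: PS[of "Suc k"] PS[of k] add_diff_cancel_left)
    also have "\<dots> = integral {0..t} (\<lambda>s. f s (P (Suc k) s) - f s (P k s))"
      by (rule integral_diff[symmetric]; rule int[OF cP Suc.prems])
    also have "norm \<dots> \<le> integral {0..t} (\<lambda>s. M * (1/2) ^ k * (C * exp (2 * C * s)))"
    proof (rule integral_norm_bound_integral)
      fix s assume s: "s \<in> {0..t}"
      have "norm (f s (P (Suc k) s) - f s (P k s)) \<le> C * norm (P (Suc k) s - P k s)"
        using lip Suc.prems s by auto
      also have "\<dots> \<le> C * (M * (1/2) ^ k * exp (2 * C * s))"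
        using Suc.IH[of s] Suc.prems s C by (intro mult_left_mono) auto
      finally show "norm (f s (P (Suc k) s) - f s (P k s)) \<le> M * (1/2) ^ k * (C * exp (2 * C * s))"
        by (simp add: mult_ac)
    qed (use h in \<open>auto intro!: integrable_diff int[OF cP Suc.prems]\<close>)
    also have "\<dots> = M * (1/2) ^ k * ((exp (2 * C * t) - 1) / 2)" using h by (rule integral_unique)
    also have "\<dots> \<le> M * (1/2) ^ k * (exp (2 * C * t) / 2)" using M by (intro mult_left_mono) auto
    finally show ?case by simp
  qed
  have "norm (P (Suc k) t - P k t) \<le> (M * exp (2 * C)) * (1/2) ^ k" if t: "t \<in> {0..1}" for k t
  proof -
    have "exp (2 * C * t) \<le> exp (2 * C)" using t C by simp
    then have "M * (1/2) ^ k * exp (2 * C * t) \<le> M * (1/2) ^ k * exp (2 * C)"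
      using M by (intro mult_left_mono) auto
    then show ?thesis using step[OF t, of k] by (simp add: mult_ac)
  qed
  then obtain X where X: "uniform_limit {0..1} P X sequentially"
    using picard_iterates_converge by blast
  have cX: "continuous_on {0..1} X"
    by (rule uniform_limit_theorem[OF always_eventually[OF allI[OF cP]] X]) simp
  have eq: "x0 + integral {0..t} (\<lambda>s. f s (X s)) = X t" if t: "t \<in> {0..1}" for t
  proof -
    have "(\<lambda>k. P (Suc k) t) \<longlonglongrightarrow> x0 + integral {0..t} (\<lambda>s. f s (X s))"
    proof (rule LIMSEQ_I)
      fix e :: real assume e: "0 < e"
      have "\<forall>\<^sub>F k in sequentially. \<forall>s\<in>{0..1}. dist (P k s) (X s) < e / (2 * C)"
        using uniform_limitD[OF X, of "e / (2 * C)"] e C by simp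
      then obtain K where K: "\<And>k s. K \<le> k \<Longrightarrow> s \<in> {0..1} \<Longrightarrow> norm (P k s - X s) < e / (2 * C)"
        unfolding eventually_sequentially dist_norm by blast
      have "norm (P (Suc k) t - (x0 + integral {0..t} (\<lambda>s. f s (X s)))) < e" if k: "K \<le> k" for k
      proof -
        have "P (Suc k) t - (x0 + integral {0..t} (\<lambda>s. f s (X s)))
            = integral {0..t} (\<lambda>s. f s (P k s)) - integral {0..t} (\<lambda>s. f s (X s))"
          by (simp add: PS)
        also have "\<dots> = integral {0..t} (\<lambda>s. f s (P k s) - f s (X s))"
          using int[OF cP t] int[OF cX t] by (simp add: integral_diff)
        also have "norm \<dots> \<le> e / 2 * (t - 0)"
        proof (rule integral_bound)
          show "continuous_on {0..t} (\<lambda>s. f s (P k s) - f s (X s))"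
            using t by (intro continuous_intros continuous_on_subset[OF cont[OF cP]] continuous_on_subset[OF cont[OF cX]]) auto
          fix s assume "s \<in> {0..t}"
          then have s: "s \<in> {0..1}" using t by auto
          have "norm (f s (P k s) - f s (X s)) \<le> C * norm (P k s - X s)" by (rule lip[OF s])
          also have "\<dots> \<le> C * (e / (2 * C))" using K[OF k s] C by (intro mult_left_mono) auto
          finally show "norm (f s (P k s) - f s (X s)) \<le> e / 2" using C by simp
        qed (use t in auto)
        also have "\<dots> \<le> e / 2 * 1" using t e by (intro mult_left_mono) auto
        finally show ?thesis using e by simp
      qed
      then show "\<exists>no. \<forall>k\<ge>no. norm (P (Suc k) t - (x0 + integral {0..t} (\<lambda>s. f s (X s)))) < e" by blast
    qed
    moreover have "(\<lambda>k. P (Suc k) t) \<longlonglongrightarrow> X t"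
      using tendsto_uniform_limitI[OF X t] by (rule LIMSEQ_Suc)
    ultimately show ?thesis by (rule LIMSEQ_unique)
  qed
  show thesis
  proof (rule that)
    show "X 0 = x0" using eq[of 0] by simp
    fix t :: real assume t: "t \<in> {0..1}"
    have "((\<lambda>t. x0 + integral {0..t} (\<lambda>s. f s (X s))) has_vector_derivative 0 + f t (X t)) (at t within {0..1})"
      by (intro has_vector_derivative_add has_vector_derivative_const integral_has_vector_derivative cont cX t)
    then have "((\<lambda>t. x0 + integral {0..t} (\<lambda>s. f s (X s))) has_vector_derivative f t (X t)) (at t within {0..1})"
      by simp
    then show "(X has_vector_derivative f t (X t)) (at t within {0..1})"
      by (rule has_vector_derivative_transform[OF t, rotated]) (simp add: eq)
  qed
qed

lemma continuous_on_matrix_vector_mult: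
  fixes A :: "real \<Rightarrow> real^'n^'m" and X :: "real \<Rightarrow> real^'n"
  assumes "continuous_on S A" "continuous_on S X"
  shows "continuous_on S (\<lambda>t. A t *v X t)"
  unfolding matrix_vector_mult_def by (intro continuous_intros assms)

lemma lipschitz_is_norm_continuous:
  fixes f :: "'a::euclidean_space \<Rightarrow> 'a"
  assumes N: "is_norm N" and lip: "\<And>u v. N (f u - f v) \<le> C * N (u - v)"
  shows "continuous_on S f"
proof -
  obtain A where A: "0 < A" "\<And>x. norm x \<le> A * N x" using norm_le_is_norm[OF N] by blast
  obtain B where B: "0 < B" "\<And>x. N x \<le> B * norm x" using is_norm_le_norm[OF N] by blast
  \<comment> \<open>The sign of \<open>C\<close> is unknown, while a Lipschitz constant must be
    nonnegative.\<close>
  have "(A * (\<bar>C\<bar> * B))-lipschitz_on S f"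
  proof (rule lipschitz_onI)
    fix u v
    have "norm (f u - f v) \<le> A * N (f u - f v)" by (rule A(2))
    also have "\<dots> \<le> A * (\<bar>C\<bar> * N (u - v))"
      using A(1) lip[of u v] abs_ge_self[of C] is_norm_ge0[OF N, of "u - v"]
      by (intro mult_left_mono) (auto intro: order_trans mult_right_mono)
    also have "\<dots> \<le> A * (\<bar>C\<bar> * (B * norm (u - v)))"
      using A(1) B(2)[of "u - v"] by (intro mult_left_mono) auto
    finally show "dist (f u) (f v) \<le> A * (\<bar>C\<bar> * B) * dist u v" by (simp add: dist_norm mult_ac)
  qed (use A B in simp)
  then show ?thesis by (rule lipschitz_on_continuous_on)
qed

lemma is_norm_bounded_on_unit:
  fixes u :: "real \<Rightarrow> 'a::euclidean_space"
  assumes N: "is_norm N" and u: "continuous_on {0..1} u"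
  obtains B where "0 < B" "\<And>t. t \<in> {0..1} \<Longrightarrow> N (u t) \<le> B"
proof -
  have "continuous_on {0..1} (\<lambda>t. N (u t))"
    by (rule continuous_on_compose2[OF is_norm_continuous[OF N, of UNIV] u]) auto
  then have "bounded ((\<lambda>t. N (u t)) ` {0..1})"
    by (intro compact_imp_bounded compact_continuous_image) auto
  then obtain B where B: "0 < B" "\<And>t. t \<in> {0..1} \<Longrightarrow> \<bar>N (u t)\<bar> \<le> B"
    unfolding bounded_pos by auto
  show thesis
    by (rule that[OF B(1)]) (use B(2) abs_le_D1 in blast)
qed

text \<open>The recursion with equality has the solution \<open>A / r * ((1 + r) ^ i - 1)\<close>,
  which dominates \<open>e\<close> by induction; then \<open>1 + r \<le> exp r\<close>.\<close>

lemma discrete_gronwall: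
  fixes e :: "nat \<Rightarrow> real"
  assumes r: "0 < r" and A: "0 \<le> A" and e0: "e 0 = 0"
    and step: "\<And>i. i < n \<Longrightarrow> e (Suc i) \<le> (1 + r) * e i + A" and i: "i \<le> n"
  shows "e i \<le> A / r * (exp (real i * r) - 1)"
proof -
  have "e i \<le> A / r * ((1 + r) ^ i - 1)"
    using i
  proof (induction i)
    case (Suc i)
    have "e (Suc i) \<le> (1 + r) * e i + A" using step Suc.prems by simp
    also have "\<dots> \<le> (1 + r) * (A / r * ((1 + r) ^ i - 1)) + A"
      using Suc r by (intro add_right_mono mult_left_mono) auto
    also have "\<dots> = A / r * ((1 + r) ^ Suc i - 1)" using r by (simp add: field_simps)
    finally show ?case .
  qed (simp add: e0)
  also have "\<dots> \<le> A / r * (exp (real i * r) - 1)"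
  proof -
    have "(1 + r) ^ i \<le> exp r ^ i" using r by (intro power_mono exp_ge_add_one_self) auto
    then show ?thesis using A r by (intro mult_left_mono) (auto simp: exp_of_nat_mult)
  qed
  finally show ?thesis .
qed

section \<open>The Euler scheme: stability and consistency\<close>

context
  fixes N :: "real^'d \<Rightarrow> real" and \<sigma> :: "real^'d \<Rightarrow> real^'d" and L :: real
  assumes N: "is_norm N" and L: "0 < L" and lip: "\<And>u v. N (\<sigma> u - \<sigma> v) \<le> L * N (u - v)"
begin

lemma vector_field_continuous:
  fixes K :: "real \<Rightarrow> real^'d^'d"
  assumes "continuous_on {0..1} K" "continuous_on {0..1} b" "continuous_on {0..1} X"
  shows "continuous_on {0..1} (\<lambda>t. \<sigma> (K t *v X t + b t))"
proof (rule continuous_on_compose2[OF lipschitz_is_norm_continuous[OF N lip, of UNIV]])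
  show "continuous_on {0..1} (\<lambda>t. K t *v X t + b t)"
    by (intro continuous_on_add continuous_on_matrix_vector_mult assms)
qed simp

lemma ode_solution_exists:
  fixes K :: "real \<Rightarrow> real^'d^'d"
  assumes K: "continuous_on {0..1} K" and b: "continuous_on {0..1} b"
  shows "\<exists>X. ode_solution \<sigma> K b x X"
proof -
  obtain A where A: "0 < A" "\<And>x. norm x \<le> A * N x" using norm_le_is_norm[OF N] by blast
  obtain B where B: "0 < B" "\<And>x. N x \<le> B * norm x" using is_norm_le_norm[OF N] by blast
  obtain \<kappa> where \<kappa>: "0 < \<kappa>" "\<And>t. t \<in> {0..1} \<Longrightarrow> op_norm N (K t) \<le> \<kappa>"
    using is_norm_bounded_on_unit[OF is_norm_op_norm[OF N] K] by blast
  \<comment> \<open>\<open>A\<close> and \<open>B\<close> translate between \<open>N\<close> and the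
    Euclidean norm, and \<open>\<kappa>\<close> bounds the matrices on the compact interval; the
    product is a global Lipschitz constant in the state.\<close>
  have "norm (\<sigma> (K t *v x + b t) - \<sigma> (K t *v y + b t)) \<le> A * (L * (\<kappa> * B)) * norm (x - y)"
    if t: "t \<in> {0..1}" for t x y
  proof -
    have "norm (\<sigma> (K t *v x + b t) - \<sigma> (K t *v y + b t)) \<le> A * N (\<sigma> (K t *v x + b t) - \<sigma> (K t *v y + b t))"
      by (rule A(2))
    also have "\<dots> \<le> A * (L * N (K t *v (x - y)))"
      using lip[of "K t *v x + b t" "K t *v y + b t"] A(1) by (simp add: matrix_vector_mult_diff_distrib)
    also have "N (K t *v (x - y)) \<le> op_norm N (K t) * N (x - y)" by (rule op_norm_mult_vec[OF N])
    also have "\<dots> \<le> \<kappa> * (B * norm (x - y))"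
      using \<kappa> t B by (intro mult_mono is_norm_ge0[OF N]) auto
    finally show ?thesis using A L by (simp add: mult_ac)
  qed
  moreover have "0 < A * (L * (\<kappa> * B))" using A B L \<kappa> by simp
  ultimately obtain X where "X 0 = x"
    "\<And>t. t \<in> {0..1} \<Longrightarrow> (X has_vector_derivative \<sigma> (K t *v X t + b t)) (at t within {0..1})"
    using lipschitz_ivp_solution[of "A * (L * (\<kappa> * B))" "\<lambda>t X. \<sigma> (K t *v X + b t)" x]
      vector_field_continuous[OF K b] by blast
  then show ?thesis by (auto simp: ode_solution_def)
qed

lemma ode_flow_solution:
  fixes K :: "real \<Rightarrow> real^'d^'d"
  assumes "continuous_on {0..1} K" "continuous_on {0..1} b"
  shows "ode_solution \<sigma> K b x (ode_flow \<sigma> K b x)"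
  unfolding ode_flow_def by (rule someI_ex[OF ode_solution_exists[OF assms]])

text \<open>Per step the error is multiplied by at most \<open>1 + L * \<kappa> / n\<close> and
  gains the coefficient error and the truncation error \<open>\<eta>\<close>; discrete Gronwall sums
  these up. \<open>X\<close> and the coefficients enter only through their grid values, so the same
  estimate yields both the convergence of the loss and the final bound.\<close>

lemma euler_error:
  fixes K :: "real \<Rightarrow> real^'d^'d"
  assumes n: "0 < n" and Y0: "Y 0 = X 0"
    and Y: "\<And>i. i < n \<Longrightarrow> Y (Suc i) = Y i + (1 / real n) *\<^sub>R \<sigma> (Kn i *v Y i + bn i)"
    and \<kappa>: "0 < \<kappa>" "\<And>i. i < n \<Longrightarrow> op_norm N (Kn i) \<le> \<kappa>"
    and K: "\<And>i. i < n \<Longrightarrow> op_norm N (Kn i - K (real i / real n)) \<le> \<delta>"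
    and b: "\<And>i. i < n \<Longrightarrow> N (bn i - b (real i / real n)) \<le> \<delta>"
    and \<xi>: "\<And>i. i < n \<Longrightarrow> N (X (real i / real n)) \<le> \<xi>"
    and \<eta>: "\<And>i. i < n \<Longrightarrow> N (X (real (Suc i) / real n) - X (real i / real n)
        - (1 / real n) *\<^sub>R \<sigma> (K (real i / real n) *v X (real i / real n) + b (real i / real n))) \<le> \<eta>"
    and i: "i \<le> n"
  shows "N (X (real i / real n) - Y i)
    \<le> real n / (L * \<kappa>) * (1 / real n * (1 + \<xi>) * L * \<delta> + \<eta>) * (exp (real i / real n * L * \<kappa>) - 1)"
proof -
  let ?X = "\<lambda>i. X (real i / real n)" and ?K = "\<lambda>i. K (real i / real n)" and ?b = "\<lambda>i. b (real i / real n)"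
  let ?A = "1 / real n * (1 + \<xi>) * L * \<delta> + \<eta>" and ?r = "L * \<kappa> / real n"
  \<comment> \<open>Read off at index 0, which exists because \<open>n\<close> is positive.\<close>
  have nn: "0 \<le> \<delta>" "0 \<le> \<xi>" "0 \<le> \<eta>"
    using b[OF n] \<xi>[OF n] \<eta>[OF n] is_norm_ge0[OF N] order_trans by blast+
  have "N (?X (Suc i) - Y (Suc i)) \<le> (1 + ?r) * N (?X i - Y i) + ?A" if i: "i < n" for i
  proof -
    let ?T = "?X (Suc i) - ?X i - (1 / real n) *\<^sub>R \<sigma> (?K i *v ?X i + ?b i)"
    let ?S = "\<sigma> (?K i *v ?X i + ?b i) - \<sigma> (Kn i *v Y i + bn i)"
    have eq: "?X (Suc i) - Y (Suc i) = ?T + ((?X i - Y i) + (1 / real n) *\<^sub>R ?S)"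
      by (simp add: Y[OF i] scaleR_diff_right)
    have "N (?X (Suc i) - Y (Suc i)) \<le> N ?T + N ((?X i - Y i) + (1 / real n) *\<^sub>R ?S)"
      unfolding eq by (rule is_norm_triangle[OF N])
    also have "\<dots> \<le> N ?T + (N (?X i - Y i) + N ((1 / real n) *\<^sub>R ?S))"
      by (intro add_left_mono is_norm_triangle[OF N])
    also have "N ?T \<le> \<eta>" by (rule \<eta>[OF i])
    also have "N ((1 / real n) *\<^sub>R ?S) = 1 / real n * N ?S" by (simp add: is_norm_scale[OF N])
    also have "1 / real n * N ?S \<le> 1 / real n * (L * (\<kappa> * N (?X i - Y i) + (\<delta> * \<xi> + \<delta>)))"
    proof (rule mult_left_mono)
      \<comment> \<open>The splitting lets \<open>Kn i\<close> act on the error and the coefficient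
        difference on the exact solution. Hence a bound \<open>\<xi>\<close> for \<open>X\<close> is
        enough, and the two coefficient errors add up to
        \<open>(1 + \<xi>) * \<delta>\<close>.\<close>
      have "(?K i *v ?X i + ?b i) - (Kn i *v Y i + bn i)
          = Kn i *v (?X i - Y i) + (- ((Kn i - ?K i) *v ?X i) + - (bn i - ?b i))"
        by (simp add: matrix_vector_mult_diff_distrib matrix_vector_mult_diff_rdistrib)
      then have "N ((?K i *v ?X i + ?b i) - (Kn i *v Y i + bn i))
          \<le> N (Kn i *v (?X i - Y i)) + (N ((Kn i - ?K i) *v ?X i) + N (bn i - ?b i))"
        using is_norm_triangle[OF N, of "Kn i *v (?X i - Y i)" "- ((Kn i - ?K i) *v ?X i) + - (bn i - ?b i)"]
          is_norm_triangle[OF N, of "- ((Kn i - ?K i) *v ?X i)" "- (bn i - ?b i)"]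
        by (simp only: is_norm_minus[OF N])
      also have "N (Kn i *v (?X i - Y i)) \<le> \<kappa> * N (?X i - Y i)"
        using op_norm_mult_vec[OF N, of "Kn i" "?X i - Y i"] mult_right_mono[OF \<kappa>(2)[OF i] is_norm_ge0[OF N]]
        by (rule order_trans)
      also have "N ((Kn i - ?K i) *v ?X i) \<le> \<delta> * \<xi>"
        using op_norm_mult_vec[OF N, of "Kn i - ?K i" "?X i"] mult_mono[OF K[OF i] \<xi>[OF i] nn(1) is_norm_ge0[OF N]]
        by (rule order_trans)
      also have "N (bn i - ?b i) \<le> \<delta>" by (rule b[OF i])
      finally have "L * N ((?K i *v ?X i + ?b i) - (Kn i *v Y i + bn i)) \<le> L * (\<kappa> * N (?X i - Y i) + (\<delta> * \<xi> + \<delta>))"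
        using L by simp
      then show "N ?S \<le> L * (\<kappa> * N (?X i - Y i) + (\<delta> * \<xi> + \<delta>))"
        using lip order_trans by blast
    qed simp
    finally have "N (?X (Suc i) - Y (Suc i))
        \<le> \<eta> + (N (?X i - Y i) + 1 / real n * (L * (\<kappa> * N (?X i - Y i) + (\<delta> * \<xi> + \<delta>))))" by simp
    also have "\<dots> = (1 + ?r) * N (?X i - Y i) + ?A"
      by (simp add: algebra_simps add_divide_distrib)
    finally show ?thesis .
  qed
  moreover have "0 < ?r" "0 \<le> ?A" using L \<kappa>(1) n nn by auto
  ultimately have "N (?X i - Y i) \<le> ?A / ?r * (exp (real i * ?r) - 1)"
    using Y0 i by (intro discrete_gronwall[where n=n and e="\<lambda>i. N (?X i - Y i)"]) (auto simp: is_norm_0[OF N])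
  also have "?A / ?r = real n / (L * \<kappa>) * ?A" by simp
  also have "real i * ?r = real i / real n * L * \<kappa>" by simp
  finally show ?thesis .
qed

end

text \<open>The largest local truncation error along \<open>X\<close>; with \<open>X'\<close> the
  derivative of \<open>X\<close> it is the witness for \<epsilon>. At \<open>n = 0\<close> it is
  \<open>Max\<close> of the empty set, an unspecified value invisible to asymptotics.\<close>

definition euler_defect :: "('a::real_vector \<Rightarrow> real) \<Rightarrow> (real \<Rightarrow> 'a) \<Rightarrow> (real \<Rightarrow> 'a) \<Rightarrow> nat \<Rightarrow> real" where
  "euler_defect N X X' n =
     Max ((\<lambda>i. N (X (real (Suc i) / real n) - X (real i / real n) - (1 / real n) *\<^sub>R X' (real i / real n))) ` {..<n})"

lemma euler_defect_ge:
  "i < n \<Longrightarrow> N (X (real (Suc i) / real n) - X (real i / real n) - (1 / real n) *\<^sub>R X' (real i / real n))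
    \<le> euler_defect N X X' n"
  unfolding euler_defect_def by (intro Max_ge) auto

text \<open>A defect is the integral of \<open>X' r - X' s\<close> over a cell of length
  \<open>1 / n\<close>, at most \<open>1 / n\<close> times the oscillation of \<open>X'\<close> on
  the cell. With \<open>X'\<close> merely continuous this gives o(1/n), not a square rate.\<close>

lemma euler_defect_tendsto:
  fixes X :: "real \<Rightarrow> 'a::euclidean_space"
  assumes N: "is_norm N"
    and X: "\<And>t. t \<in> {0..1} \<Longrightarrow> (X has_vector_derivative X' t) (at t within {0..1})"
    and X': "continuous_on {0..1} X'"
  shows "(\<lambda>n. real n * euler_defect N X X' n) \<longlonglongrightarrow> 0"
proof (rule LIMSEQ_I)
  fix e :: real assume e: "0 < e"
  obtain C where C: "0 < C" "\<And>x. N x \<le> C * norm x" using is_norm_le_norm[OF N] by blast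
  have "uniformly_continuous_on {0..1} X'" using X' by (rule compact_uniformly_continuous) simp
  moreover have "0 < e / (2 * C)" using e C by simp
  ultimately obtain d where d: "0 < d"
    "\<And>s t. s \<in> {0..1} \<Longrightarrow> t \<in> {0..1} \<Longrightarrow> dist t s < d \<Longrightarrow> dist (X' t) (X' s) < e / (2 * C)"
    unfolding uniformly_continuous_on_def by meson
  obtain m :: nat where m: "0 < m" "1 / real m < d"
    using real_arch_inverse[of d] d(1) by (auto simp: inverse_eq_divide)
  have "norm (real n * euler_defect N X X' n - 0) < e" if mn: "m \<le> n" for n
  proof -
    have n: "0 < n" using m mn by simp
    have dn: "1 / real n < d"
      using m mn by (meson frac_le le_less_trans of_nat_0_less_iff of_nat_le_iff order_refl zero_le_one)
    have cell: "N (X (real (Suc i) / real n) - X (real i / real n) - (1 / real n) *\<^sub>R X' (real i / real n)) \<le> e / (2 * real n)"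
      if i: "i < n" for i
    proof -
      define s t where "s = real i / real n" and "t = real (Suc i) / real n"
      have "real (Suc i) \<le> real n" using i by simp
      then have st: "0 \<le> s" "s \<le> t" "t \<le> 1" "t - s = 1 / real n"
        using n by (auto simp: s_def t_def divide_right_mono divide_le_eq diff_divide_distrib[symmetric])
      have "(X' has_integral (X t - X s)) {s..t}"
        using st by (intro fundamental_theorem_of_calculus has_vector_derivative_within_subset[OF X]) auto
      moreover have "((\<lambda>r. X' s) has_integral (t - s) *\<^sub>R X' s) {s..t}"
        using has_integral_const_real[of "X' s" s t] st by simp
      ultimately have h: "((\<lambda>r. X' r - X' s) has_integral (X t - X s - (t - s) *\<^sub>R X' s)) {s..t}"
        by (rule has_integral_diff)
      have "norm (X t - X s - (t - s) *\<^sub>R X' s) \<le> e / (2 * C) * (t - s)"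
      proof -
        have "norm (integral {s..t} (\<lambda>r. X' r - X' s)) \<le> e / (2 * C) * (t - s)"
        proof (rule integral_bound)
          show "continuous_on {s..t} (\<lambda>r. X' r - X' s)"
            using st by (intro continuous_intros continuous_on_subset[OF X']) auto
          fix r assume r: "r \<in> {s..t}"
          then have "dist r s < d" using st dn by (auto simp: dist_real_def)
          then show "norm (X' r - X' s) \<le> e / (2 * C)"
            using d(2)[of s r] r st by (auto simp: dist_norm)
        qed (use st in auto)
        then show ?thesis by (simp add: integral_unique[OF h])
      qed
      then have "C * norm (X t - X s - (t - s) *\<^sub>R X' s) \<le> C * (e / (2 * C) * (t - s))"
        using C by (intro mult_left_mono) auto
      then have "N (X t - X s - (t - s) *\<^sub>R X' s) \<le> C * (e / (2 * C) * (t - s))"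
        using C(2) order_trans by blast
      also have "\<dots> = e / (2 * real n)" using C by (simp add: st(4))
      finally show ?thesis using st(4) by (simp add: s_def t_def)
    qed
    have "euler_defect N X X' n \<le> e / (2 * real n)"
      unfolding euler_defect_def using n cell by (intro Max.boundedI) auto
    then have "real n * euler_defect N X X' n \<le> real n * (e / (2 * real n))" by (intro mult_left_mono) auto
    also have "\<dots> = e / 2" using n by simp
    finally have "real n * euler_defect N X X' n \<le> e / 2" .
    moreover have "0 \<le> euler_defect N X X' n"
      using euler_defect_ge[of 0 n N X X'] n is_norm_ge0[OF N] order_trans by blast
    then have "0 \<le> real n * euler_defect N X X' n" by simp
    ultimately show ?thesis using e by simp
  qed
  then show "\<exists>m. \<forall>n\<ge>m. norm (real n * euler_defect N X X' n - 0) < e" by blast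
qed

text \<open>Inside the open interval the set where the bound fails is both open and negligible,
  hence empty; the end points follow by closure.\<close>

lemma AE_le_imp_le_continuous:
  fixes f :: "real \<Rightarrow> real"
  assumes f: "continuous_on {0..1} f" and AE: "AE t in lebesgue_on {0..1}. f t \<le> c" and t: "t \<in> {0..1}"
  shows "f t \<le> c"
proof -
  let ?S = "{t \<in> {0<..<1}. c < f t}"
  have "open ?S"
  proof -
    have "continuous_on {0<..<1} f" using f by (rule continuous_on_subset) auto
    then have "open ({0<..<1} \<inter> f -` {c<..})" by (intro continuous_open_preimage) auto
    moreover have "{0<..<1} \<inter> f -` {c<..} = ?S" by auto
    ultimately show ?thesis by simp
  qed
  moreover have "negligible ?S"
  proof -
    have "AE t in lebesgue. t \<in> {0..1} \<longrightarrow> f t \<le> c"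
      using AE by (subst (asm) AE_restrict_space_iff) auto
    then obtain A where A: "A \<in> null_sets lebesgue" "{t. \<not> (t \<in> {0..1} \<longrightarrow> f t \<le> c)} \<subseteq> A"
      by (auto simp: eventually_ae_filter)
    then have "negligible A" by (simp add: negligible_iff_null_sets)
    moreover have "?S \<subseteq> A" using A(2) by auto
    ultimately show ?thesis by (rule negligible_subset)
  qed
  ultimately have S: "?S = {}" using open_not_negligible by blast
  have le: "f s \<le> c" if "s \<in> {0<..<1}" for s
  proof -
    have "\<not> c < f s" using S that by blast
    then show ?thesis by simp
  qed
  have "continuous_on (closure {0<..<1}) f" "t \<in> closure {0<..<1}" using f t by auto
  then show ?thesis using le by (rule continuous_le_on_closure)
qed

text \<open>The conversion to a real number sends infinite values to 0, so both have to be excluded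
  before the essential supremum says anything about \<open>u\<close>.\<close>

lemma Linf_norm_ge:
  fixes u :: "real \<Rightarrow> 'a::euclidean_space"
  assumes N: "is_norm N" and u: "continuous_on {0..1} u" and t: "t \<in> {0..1}"
  shows "N (u t) \<le> Linf_norm N u"
proof -
  let ?M = "lebesgue_on {0..1::real}"
  define s where "s = esssup ?M (\<lambda>t. ereal (N (u t)))"
  have c: "continuous_on {0..1} (\<lambda>t. N (u t))"
    by (rule continuous_on_compose2[OF is_norm_continuous[OF N, of UNIV] u]) auto
  obtain B where B: "0 < B" "\<And>t. t \<in> {0..1} \<Longrightarrow> N (u t) \<le> B"
    using is_norm_bounded_on_unit[OF N u] by blast
  have "(\<lambda>t. ereal (N (u t))) \<in> borel_measurable ?M"
    using continuous_imp_measurable_unit[OF c] by measurable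
  then have "s \<le> ereal B"
    unfolding s_def using B by (intro esssup_I AE_I2) auto
  have AE: "AE t in ?M. ereal (N (u t)) \<le> s" unfolding s_def by (rule esssup_AE)
  show ?thesis
  proof (cases s)
    case (real r)
    then have "AE t in ?M. N (u t) \<le> r" using AE by simp
    then have "N (u t) \<le> r" by (rule AE_le_imp_le_continuous[OF c _ t])
    then show ?thesis using real by (simp add: Linf_norm_def s_def)
  next
    case PInf
    then show ?thesis using \<open>s \<le> ereal B\<close> by simp
  next
    case MInf
    \<comment> \<open>A supremum of minus infinity would make every bound hold almost everywhere,
      also a negative one.\<close>
    then have "AE t in ?M. False" using AE by simp
    then have "AE t in ?M. N (u t) \<le> -1" by (rule eventually_mono) simp
    then have "N (u t) \<le> -1" by (rule AE_le_imp_le_continuous[OF c _ t])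
    then show ?thesis using is_norm_ge0[OF N, of "u t"] by simp
  qed
qed

section \<open>Interpolation and sampling\<close>

text \<open>The \<open>n\<close> values have only \<open>n - 1\<close> increments, as there is none
  at the grid point 1. Slope 0 on the last cell adds no energy.\<close>

definition interp_slope :: "nat \<Rightarrow> (nat \<Rightarrow> 'a::real_vector) \<Rightarrow> real \<Rightarrow> 'a" where
  "interp_slope n v = step n (\<lambda>i. if Suc i < n then real n *\<^sub>R (v (Suc i) - v i) else 0)"

text \<open>The piecewise linear interpolant of the values \<open>v i\<close> at \<open>i / n\<close>, \<open>i < n\<close>, which is constant
  on the last cell.\<close>

definition interp :: "nat \<Rightarrow> (nat \<Rightarrow> 'a::euclidean_space) \<Rightarrow> real \<Rightarrow> 'a" where
  "interp n v t = v 0 + integral {0..t} (interp_slope n v)"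

lemma interp_primitive:
  fixes v :: "nat \<Rightarrow> 'a::euclidean_space"
  assumes "0 < n"
  shows "primitive_on_unit (interp n v) (interp_slope n v)"
  unfolding interp_def[abs_def] interp_slope_def by (intro primitive_integral L2_fun_step assms)

lemma interp_0: "interp n v 0 = v 0"
  by (simp add: interp_def)

lemma interp_grid:
  fixes v :: "nat \<Rightarrow> 'a::euclidean_space"
  assumes "i < n"
  shows "interp n v (real i / real n) = v i"
proof -
  let ?w = "\<lambda>i. if Suc i < n then real n *\<^sub>R (v (Suc i) - v i) else 0"
  have n: "0 < n" using assms by simp
  have "(\<Sum>k=0..<i. ?w k) = (\<Sum>k=0..<i. real n *\<^sub>R (v (Suc k) - v k))"
    using assms by (intro sum.cong) auto
  also have "\<dots> = real n *\<^sub>R (v i - v 0)"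
    by (simp add: scaleR_sum_right[symmetric] sum_Suc_diff')
  finally have "(interp_slope n v has_integral (v i - v 0)) {0..real i / real n}"
    using step_has_integral[OF n, of 0 i ?w] n by (simp add: interp_slope_def)
  then show ?thesis by (simp add: interp_def integral_unique)
qed

text \<open>An identity rather than an estimate, thanks to the flat last cell: discrete energies are
  exactly the energies of the interpolants.\<close>

lemma reg_disc_eq_interp:
  fixes v :: "nat \<Rightarrow> 'a::euclidean_space"
  assumes N: "is_norm N" and n: "0 < n"
  shows "reg_disc N \<tau> n v = integral {0..1} (\<lambda>t. (N (interp_slope n v t))\<^sup>2) + \<tau> * (N (v 0))\<^sup>2"
proof -
  let ?w = "\<lambda>i. if Suc i < n then real n *\<^sub>R (v (Suc i) - v i) else 0"
  have "(\<Sum>k<n. (N (?w k))\<^sup>2) = (\<Sum>k\<in>{..<n - 1}. (N (real n *\<^sub>R (v (Suc k) - v k)))\<^sup>2)"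
    by (rule sum.mono_neutral_cong_right) (use n in \<open>auto simp: is_norm_0[OF N]\<close>)
  also have "\<dots> = (\<Sum>k<n - 1. (real n)\<^sup>2 * (N (v (Suc k) - v k))\<^sup>2)"
    by (simp add: is_norm_scale[OF N] power_mult_distrib)
  also have "\<dots> = (real n)\<^sup>2 * (\<Sum>k<n - 1. (N (v (Suc k) - v k))\<^sup>2)"
    by (simp add: sum_distrib_left)
  also have "(\<Sum>k<n - 1. (N (v (Suc k) - v k))\<^sup>2) = (\<Sum>i = 1..<n. (N (v i - v (i - 1)))\<^sup>2)"
    by (rule sum.reindex_bij_witness[of _ "\<lambda>i. i - 1" Suc]) auto
  finally have "(1 / real n) *\<^sub>R (\<Sum>k<n. (N (?w k))\<^sup>2) = real n * (\<Sum>i = 1..<n. (N (v i - v (i - 1)))\<^sup>2)"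
    using n by (simp add: power2_eq_square)
  moreover have "((\<lambda>t. (N (interp_slope n v t))\<^sup>2) has_integral (1 / real n) *\<^sub>R (\<Sum>k<n. (N (?w k))\<^sup>2)) {0..1}"
    unfolding interp_slope_def comp_step[of "\<lambda>x. (N x)\<^sup>2"] by (rule step_has_integral_unit[OF n])
  ultimately show ?thesis by (simp add: reg_disc_def integral_unique)
qed

lemma reg_disc_sample_le:
  fixes u :: "real \<Rightarrow> 'a::euclidean_space"
  assumes N: "is_norm N" and u: "u \<in> H1" and n: "0 < n"
  shows "reg_disc N \<tau> n (\<lambda>i\<in>{..<n}. u (real i / real n)) \<le> reg_cont N \<tau> u"
proof -
  let ?v = "\<lambda>i\<in>{..<n}. u (real i / real n)"
  let ?d = "\<lambda>i. (N (u (real (Suc i) / real n) - u (real i / real n)))\<^sup>2"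
  have w: "primitive_on_unit u (weak_deriv u)" by (rule weak_deriv_primitive[OF u])
  have "(\<Sum>i = 1..<n. (N (?v i - ?v (i - 1)))\<^sup>2) = (\<Sum>i<n - 1. ?d i)"
    by (rule sum.reindex_bij_witness[of _ Suc "\<lambda>i. i - 1"]) auto
  \<comment> \<open>The Riesz sum also counts the last cell, which has no counterpart in the
    discrete regulariser.\<close>
  also have "\<dots> \<le> (\<Sum>i<n. ?d i)" by (intro sum_mono2) auto
  finally have "real n * (\<Sum>i = 1..<n. (N (?v i - ?v (i - 1)))\<^sup>2) \<le> riesz_sum N n u"
    unfolding riesz_sum_def by (intro mult_left_mono) auto
  also have "\<dots> \<le> integral {0..1} (\<lambda>t. (N (weak_deriv u t))\<^sup>2)" by (rule riesz_sum_le[OF N w n])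
  also have "\<dots> = (LINT t|lebesgue_on {0..1}. (N (weak_deriv u t))\<^sup>2)"
    by (rule LINT_weak_deriv[OF N u w, symmetric])
  finally show ?thesis using n by (simp add: reg_disc_def reg_cont_def)
qed

text \<open>The equicontinuity and boundedness required by Arzela-Ascoli, with constants independent
  of \<open>n\<close>. In the sup bound one \<open>C * sqrt B\<close> pays for the starting value
  and one for the oscillation over length at most 1.\<close>

lemma interp_bounds:
  fixes v :: "nat \<Rightarrow> 'a::euclidean_space"
  assumes N: "is_norm N" and n: "0 < n"
    and C: "0 < C" "\<And>x. norm x \<le> C * N x"
    and B: "integral {0..1} (\<lambda>t. (N (interp_slope n v t))\<^sup>2) \<le> B" "(N (v 0))\<^sup>2 \<le> B"
    and st: "s \<in> {0..1}" "t \<in> {0..1}"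
  shows "norm (interp n v t - interp n v s) \<le> C * sqrt (B * \<bar>t - s\<bar>)"
    and "norm (interp n v t) \<le> 2 * C * sqrt B"
proof -
  have mono: "norm (interp n v t - interp n v s) \<le> C * sqrt (B * \<bar>t - s\<bar>)"
    if "s \<in> {0..1}" "t \<in> {0..1}" "s \<le> t" for s t
  proof -
    have "(N (interp n v t - interp n v s))\<^sup>2 \<le> (t - s) * integral {0..1} (\<lambda>r. (N (interp_slope n v r))\<^sup>2)"
      using that by (intro primitive_increment_le_total[OF N interp_primitive[OF n]]) auto
    also have "\<dots> \<le> (t - s) * B" using B that by (intro mult_left_mono) auto
    finally have "N (interp n v t - interp n v s) \<le> sqrt (B * \<bar>t - s\<bar>)"
      using that by (intro real_le_rsqrt) (simp add: mult.commute)
    then have "C * N (interp n v t - interp n v s) \<le> C * sqrt (B * \<bar>t - s\<bar>)" using C by simp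
    then show ?thesis using C(2) order_trans by blast
  qed
  have *: "norm (interp n v t - interp n v s) \<le> C * sqrt (B * \<bar>t - s\<bar>)" if "s \<in> {0..1}" "t \<in> {0..1}" for s t
    using mono[of s t] mono[of t s] that
    by (cases "s \<le> t") (auto simp: norm_minus_commute abs_minus_commute)
  show "norm (interp n v t - interp n v s) \<le> C * sqrt (B * \<bar>t - s\<bar>)" by (rule *[OF st])
  have B0: "0 \<le> B" using B(2) order_trans[OF zero_le_power2] by blast
  have "norm (interp n v t) \<le> norm (interp n v t - interp n v 0) + norm (v 0)"
    using norm_triangle_sub[of "interp n v t" "v 0"] by (simp add: interp_0)
  also have "\<dots> \<le> C * sqrt (B * \<bar>t - 0\<bar>) + C * N (v 0)"
    using *[of 0 t] st C(2)[of "v 0"] by (intro add_mono) auto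
  also have "\<dots> \<le> C * sqrt B + C * sqrt B"
  proof (intro add_mono mult_left_mono real_sqrt_le_mono)
    show "B * \<bar>t - 0\<bar> \<le> B" using st B0 by (simp add: mult_left_le)
    show "N (v 0) \<le> sqrt B" using B(2) by (rule real_le_rsqrt)
  qed (use C in auto)
  finally show "norm (interp n v t) \<le> 2 * C * sqrt B" by simp
qed

section \<open>Passing to the limit in Riesz sums and in the scheme\<close>

lemma riesz_sum_tendsto:
  fixes u :: "real \<Rightarrow> 'a::euclidean_space"
  assumes N: "is_norm N" and n: "0 < n"
    and u: "\<And>t. t \<in> {0..1} \<Longrightarrow> (\<lambda>j. U j t) \<longlonglongrightarrow> u t"
  shows "(\<lambda>j. riesz_sum N n (U j)) \<longlonglongrightarrow> riesz_sum N n u"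
  unfolding riesz_sum_def
proof (intro tendsto_intros tendsto_sum is_norm_tendsto[OF N] u)
  fix i assume "i \<in> {..<n}"
  then have "real (Suc i) \<le> real n" "real i \<le> real n" by auto
  then show "real (Suc i) / real n \<in> {0..1}" "real i / real n \<in> {0..1}"
    using n by (auto simp: divide_le_eq)
qed

text \<open>The bound is uniform in the sequence index and in the grid. For each fixed grid it
  passes to \<open>u\<close>; equivalence of norms then makes it Euclidean, as the martingale
  argument requires, and the resulting limit is again taken in \<open>N\<close>.\<close>

lemma riesz_sum_limit_H1:
  fixes u :: "real \<Rightarrow> 'a::euclidean_space"
  assumes N: "is_norm N" and u: "u \<in> extensional {0..1}" "continuous_on {0..1} u"
    and lim: "\<And>t. t \<in> {0..1} \<Longrightarrow> (\<lambda>j. U j t) \<longlonglongrightarrow> u t"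
    and B: "\<And>j m. riesz_sum N (2 ^ m) (U j) \<le> B"
  shows "u \<in> H1"
    and "(\<lambda>m. riesz_sum N (2 ^ m) u) \<longlonglongrightarrow> (LINT t|lebesgue_on {0..1}. (N (weak_deriv u t))\<^sup>2)"
proof -
  obtain C where C: "0 < C" "\<And>x. norm x \<le> C * N x" using norm_le_is_norm[OF N] by blast
  have "riesz_sum norm (2 ^ m) u \<le> C\<^sup>2 * B" for m
  proof -
    let ?D = "\<lambda>i. u (real (Suc i) / real (2 ^ m)) - u (real i / real (2 ^ m))"
    have "(norm (?D i))\<^sup>2 \<le> C\<^sup>2 * (N (?D i))\<^sup>2" for i
      using power_mono[OF C(2)[of "?D i"], of 2] by (simp add: power_mult_distrib)
    then have "riesz_sum norm (2 ^ m) u \<le> real (2 ^ m) * (\<Sum>i<2 ^ m. C\<^sup>2 * (N (?D i))\<^sup>2)"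
      unfolding riesz_sum_def by (intro mult_left_mono sum_mono) auto
    also have "\<dots> = C\<^sup>2 * riesz_sum N (2 ^ m) u"
      by (simp add: riesz_sum_def sum_distrib_left mult_ac)
    also have "riesz_sum N (2 ^ m) u \<le> B"
      using riesz_sum_tendsto[where U=U and u=u and n="2 ^ m", OF N _ lim] B by (intro LIMSEQ_le_const2) auto
    finally show ?thesis by (simp add: mult_left_mono)
  qed
  then obtain g where g: "primitive_on_unit u g"
    "(\<lambda>m. riesz_sum N (2 ^ m) u) \<longlonglongrightarrow> integral {0..1} (\<lambda>t. (N (g t))\<^sup>2)"
    using riesz_sum_bounded_imp_primitive[OF u(2)] N by metis
  show H1: "u \<in> H1" using primitive_H1[OF g(1) u(1)] .
  show "(\<lambda>m. riesz_sum N (2 ^ m) u) \<longlonglongrightarrow> (LINT t|lebesgue_on {0..1}. (N (weak_deriv u t))\<^sup>2)"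
    using g(2) LINT_weak_deriv[OF N H1 g(1)] by simp
qed

text \<open>The Euler estimate at the final layer, with an arbitrary small tolerance
  \<open>e\<close> in place of \<delta>. It is formulated along a subsequence \<open>\<rho>\<close>
  because compactness provides nothing better.\<close>

lemma resnet_tendsto_ode_flow:
  fixes N :: "real^'d \<Rightarrow> real" and K :: "real \<Rightarrow> real^'d^'d"
  assumes N: "is_norm N" and L: "0 < L" and lip: "\<And>u v. N (\<sigma> u - \<sigma> v) \<le> L * N (u - v)"
    and K: "continuous_on {0..1} K" and b: "continuous_on {0..1} b"
    and \<rho>: "strict_mono \<rho>" "\<And>j. 0 < \<rho> j"
    and Kd: "\<And>e. 0 < e \<Longrightarrow> \<forall>\<^sub>F j in sequentially. \<forall>i<\<rho> j. op_norm N (Kd j i - K (real i / real (\<rho> j))) \<le> e"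
    and bd: "\<And>e. 0 < e \<Longrightarrow> \<forall>\<^sub>F j in sequentially. \<forall>i<\<rho> j. N (bd j i - b (real i / real (\<rho> j))) \<le> e"
  shows "(\<lambda>j. resnet \<sigma> (\<rho> j) (Kd j) (bd j) x (\<rho> j)) \<longlonglongrightarrow> ode_flow \<sigma> K b x 1"
proof -
  let ?X = "ode_flow \<sigma> K b x"
  let ?X' = "\<lambda>t. \<sigma> (K t *v ?X t + b t)"
  let ?Y = "\<lambda>j. resnet \<sigma> (\<rho> j) (Kd j) (bd j) x"
  have X: "?X 0 = x" "\<And>t. t \<in> {0..1} \<Longrightarrow> (?X has_vector_derivative ?X' t) (at t within {0..1})"
    using ode_flow_solution[OF N L lip K b, of x] by (auto simp: ode_solution_def)
  have cX: "continuous_on {0..1} ?X"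
    using X(2) by (meson continuous_on_eq_continuous_within has_vector_derivative_continuous)
  have cX': "continuous_on {0..1} ?X'" by (rule vector_field_continuous[OF N L lip K b cX])
  obtain \<kappa> where \<kappa>: "0 < \<kappa>" "\<And>t. t \<in> {0..1} \<Longrightarrow> op_norm N (K t) \<le> \<kappa>"
    using is_norm_bounded_on_unit[OF is_norm_op_norm[OF N] K] by blast
  obtain \<xi> where \<xi>: "0 < \<xi>" "\<And>t. t \<in> {0..1} \<Longrightarrow> N (?X t) \<le> \<xi>"
    using is_norm_bounded_on_unit[OF N cX] by blast
  \<comment> \<open>Tolerances are at most 1, so the perturbed matrices have operator norm at most
    \<open>\<kappa> + 1\<close>.\<close>
  define \<kappa>' where "\<kappa>' = \<kappa> + 1"
  \<comment> \<open>The Euler bound divided by \<open>e\<close>, once both the coefficient error and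
    \<open>n\<close> times the defect are at most \<open>e\<close>; the prefactor \<open>n\<close>
    has cancelled.\<close>
  define D where "D = ((1 + \<xi>) * L + 1) * ((exp (L * \<kappa>') - 1) / (L * \<kappa>'))"
  have \<kappa>': "0 < L * \<kappa>'" using \<kappa> L by (simp add: \<kappa>'_def)
  have D: "0 < D" using \<kappa>' \<xi> L by (auto simp: D_def intro!: mult_pos_pos divide_pos_pos add_pos_pos)
  have defect: "(\<lambda>j. real (\<rho> j) * euler_defect N ?X ?X' (\<rho> j)) \<longlonglongrightarrow> 0"
    using LIMSEQ_subseq_LIMSEQ[OF euler_defect_tendsto[OF N X(2) cX'] \<rho>(1)] by (simp add: o_def)
  have main: "\<forall>\<^sub>F j in sequentially. N (?X 1 - ?Y j (\<rho> j)) \<le> D * e" if e: "0 < e" "e \<le> 1" for e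
    using Kd[OF e(1)] bd[OF e(1)] order_tendstoD(2)[OF defect e(1)]
  proof eventually_elim
    case (elim j)
    let ?n = "\<rho> j"
    have n: "0 < ?n" by (rule \<rho>(2))
    have unit: "real i / real ?n \<in> {0..1}" if "i < ?n" for i using that by auto
    have k: "op_norm N (Kd j i) \<le> \<kappa>'" if i: "i < ?n" for i
    proof -
      have "op_norm N (Kd j i) \<le> op_norm N (Kd j i - K (real i / real ?n)) + op_norm N (K (real i / real ?n))"
        using is_norm_triangle[OF is_norm_op_norm[OF N], of "Kd j i - K (real i / real ?n)" "K (real i / real ?n)"]
        by simp
      then show ?thesis using elim(1) i \<kappa>(2)[OF unit[OF i]] e(2) by (force simp: \<kappa>'_def)
    qed
    have "N (?X (real ?n / real ?n) - ?Y j ?n)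
      \<le> real ?n / (L * \<kappa>') * (1 / real ?n * (1 + \<xi>) * L * e + euler_defect N ?X ?X' ?n)
        * (exp (real ?n / real ?n * L * \<kappa>') - 1)"
      by (rule euler_error[OF N L lip n, where Kn="Kd j" and bn="bd j" and K=K and b=b])
        (use elim X(1) \<xi>(2) unit k \<kappa> euler_defect_ge in \<open>auto simp: \<kappa>'_def\<close>)
    also have "\<dots> = ((1 + \<xi>) * L * e + real ?n * euler_defect N ?X ?X' ?n) * ((exp (L * \<kappa>') - 1) / (L * \<kappa>'))"
    proof -
      have "real ?n * (1 / real ?n * (1 + \<xi>) * L * e + euler_defect N ?X ?X' ?n)
          = (1 + \<xi>) * L * e + real ?n * euler_defect N ?X ?X' ?n"
        using n by (simp add: distrib_left)
      then show ?thesis using n by (simp flip: times_divide_eq_left) (simp add: mult_ac)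
    qed
    also have "\<dots> \<le> ((1 + \<xi>) * L * e + e) * ((exp (L * \<kappa>') - 1) / (L * \<kappa>'))"
      using elim(3) \<kappa>' by (intro mult_right_mono divide_nonneg_pos) auto
    also have "\<dots> = D * e"
    proof -
      have "(a * e + e) * F = (a + 1) * F * e" for a F :: real by (simp add: algebra_simps)
      then show ?thesis unfolding D_def .
    qed
    finally show ?case using n by simp
  qed
  obtain C where C: "0 < C" "\<And>x. norm x \<le> C * N x" using norm_le_is_norm[OF N] by blast
  show ?thesis
  proof (rule tendstoI)
    fix e :: real assume e: "0 < e"
    define e' where "e' = min 1 (e / (2 * C * D))"
    have e': "0 < e'" "e' \<le> 1" "e' \<le> e / (2 * C * D)" using e C D by (auto simp: e'_def)
    show "\<forall>\<^sub>F j in sequentially. dist (?Y j (\<rho> j)) (?X 1) < e"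
      using main[OF e'(1,2)]
    proof eventually_elim
      case (elim j)
      have "norm (?X 1 - ?Y j (\<rho> j)) \<le> C * N (?X 1 - ?Y j (\<rho> j))" by (rule C(2))
      also have "\<dots> \<le> C * (D * (e / (2 * C * D)))"
      proof -
        have "D * e' \<le> D * (e / (2 * C * D))" using e'(3) D by (intro mult_left_mono) auto
        then show ?thesis using elim C by (intro mult_left_mono) auto
      qed
      also have "\<dots> < e" using C D e by simp
      finally show ?case by (simp add: dist_norm norm_minus_commute)
    qed
  qed
qed

lemma tendsto_matrix_vector_mult:
  fixes A :: "'a \<Rightarrow> real^'n^'m" and X :: "'a \<Rightarrow> real^'n"
  assumes "(A \<longlongrightarrow> A') F" "(X \<longlongrightarrow> X') F"
  shows "((\<lambda>j. A j *v X j) \<longlongrightarrow> A' *v X') F"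
  unfolding matrix_vector_mult_def by (intro tendsto_intros tendsto_vec_lambda tendsto_sum assms)

section \<open>Convergence of minimisers\<close>

lemma loss_tendsto:
  fixes h :: "real^'m \<Rightarrow> real^'m" and L :: "real^'m \<Rightarrow> real^'m \<Rightarrow> real" and A :: "nat \<Rightarrow> real^'d^'m"
  assumes h: "continuous_on UNIV h" and L: "\<forall>v. continuous_on UNIV (\<lambda>u. L u v)"
    and A: "A \<longlonglongrightarrow> A'" and a: "a \<longlonglongrightarrow> a'" and Y: "\<And>s. (\<lambda>j. Y s j) \<longlonglongrightarrow> Y' s"
  shows "(\<lambda>j. \<Sum>s = 1..S. L (h (A j *v Y s j + a j)) (ys s)) \<longlonglongrightarrow> (\<Sum>s = 1..S. L (h (A' *v Y' s + a')) (ys s))"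
proof (rule tendsto_sum)
  fix s
  have 1: "(\<lambda>j. A j *v Y s j + a j) \<longlonglongrightarrow> A' *v Y' s + a'"
    by (intro tendsto_add tendsto_matrix_vector_mult A a Y)
  have 2: "(\<lambda>j. h (A j *v Y s j + a j)) \<longlonglongrightarrow> h (A' *v Y' s + a')"
    using continuous_on_tendsto_compose[OF h 1] by simp
  have "continuous_on UNIV (\<lambda>u. L u (ys s))" using L by blast
  from continuous_on_tendsto_compose[OF this 2]
  show "(\<lambda>j. L (h (A j *v Y s j + a j)) (ys s)) \<longlonglongrightarrow> L (h (A' *v Y' s + a')) (ys s)" by simp
qed

lemma H1_continuous: "u \<in> H1 \<Longrightarrow> continuous_on {0..1} u"
  by (simp add: H1_def)

text \<open>Interpolation is exact at the points \<open>i / n\<close> with \<open>i < n\<close>, so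
  uniform convergence controls all layers at once.\<close>

lemma interp_limit_grid:
  fixes N :: "'a::euclidean_space \<Rightarrow> real"
  assumes N: "is_norm N" and u: "uniform_limit {0..1} (\<lambda>j. interp (\<rho> j) (v j)) u sequentially" and e: "0 < e"
  shows "\<forall>\<^sub>F j in sequentially. \<forall>i<\<rho> j. N (v j i - u (real i / real (\<rho> j))) \<le> e"
proof -
  obtain C where C: "0 < C" "\<And>x. N x \<le> C * norm x" using is_norm_le_norm[OF N] by blast
  have "\<forall>\<^sub>F j in sequentially. \<forall>t\<in>{0..1}. dist (interp (\<rho> j) (v j) t) (u t) < e / C"
    using uniform_limitD[OF u, of "e / C"] e C by simp
  then show ?thesis
  proof eventually_elim
    case (elim j)
    show ?case
    proof (intro allI impI)
      fix i assume i: "i < \<rho> j"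
      then have "norm (v j i - u (real i / real (\<rho> j))) < e / C"
        using elim[rule_format, of "real i / real (\<rho> j)"] interp_grid[OF i, of "v j"] by (simp add: dist_norm)
      then have "C * norm (v j i - u (real i / real (\<rho> j))) \<le> e" using C by (simp add: field_simps)
      then show "N (v j i - u (real i / real (\<rho> j))) \<le> e" using C(2) order_trans by blast
    qed
  qed
qed

section \<open>\<Gamma>-convergence of the training energies\<close>

context
  fixes Nd :: "real^'d::finite \<Rightarrow> real"
    and NW :: "real^'d^'m::finite \<Rightarrow> real"
    and Nm :: "real^'m \<Rightarrow> real"
    and \<sigma> :: "real^'d \<Rightarrow> real^'d"
    and h :: "real^'m \<Rightarrow> real^'m"
    and L :: "real^'m \<Rightarrow> real^'m \<Rightarrow> real"
    and \<alpha> \<tau> :: "nat \<Rightarrow> real"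
    and L\<^sub>\<sigma> :: real
    and S :: nat
    and xs :: "nat \<Rightarrow> real^'d" and ys :: "nat \<Rightarrow> real^'m"
  assumes Nd: "is_norm Nd" and NW: "is_norm NW" and Nm: "is_norm Nm"
    and \<alpha>: "\<forall>i\<in>{1..4}. 0 < \<alpha> i" and \<tau>: "\<forall>j\<in>{1..2}. 0 < \<tau> j"
    and h: "continuous_on UNIV h"
    and L\<sigma>: "0 < L\<^sub>\<sigma>" and lip: "\<forall>u v. Nd (\<sigma> u - \<sigma> v) \<le> L\<^sub>\<sigma> * Nd (u - v)"
    and L0: "\<forall>u v. 0 \<le> L u v" and Lc: "\<forall>v. continuous_on UNIV (\<lambda>u. L u v)"
begin

abbreviation (input) "energy\<^sub>d \<equiv> energy_disc Nd NW Nm \<sigma> h L \<alpha> \<tau> S xs ys"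
abbreviation (input) "energy\<^sub>c \<equiv> energy_cont Nd NW Nm \<sigma> h L \<alpha> \<tau> S xs ys"

lemma weights_pos: "0 < \<alpha> 1" "0 < \<alpha> 2" "0 < \<alpha> 3" "0 < \<alpha> 4" "0 < \<tau> 1" "0 < \<tau> 2"
  using \<alpha> \<tau> by auto

text \<open>\<open>B n\<close> joins the sampled loss, which converges, to the continuum
  regulariser, which dominates the sampled one. An upper bound with the right limit is all that a
  comparison with minimisers requires.\<close>

lemma energy_recovery:
  assumes "(K, b, W, c) \<in> Theta"
  obtains B where "B \<longlonglongrightarrow> energy\<^sub>c (K, b, W, c)"
    "\<And>n. 1 \<le> n \<Longrightarrow> \<exists>\<theta>\<in>Theta_disc n. energy\<^sub>d n \<theta> \<le> B n"
proof -
  have K: "K \<in> H1" and b: "b \<in> H1" using assms by (auto simp: Theta_def)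
  let ?K = "\<lambda>n. \<lambda>i\<in>{..<n}. K (real i / real n)" and ?b = "\<lambda>n. \<lambda>i\<in>{..<n}. b (real i / real n)"
  let ?loss = "\<lambda>n. \<Sum>s = 1..S. L (h (W *v resnet \<sigma> n (?K n) (?b n) (xs s) n + c)) (ys s)"
  let ?R = "\<alpha> 1 * reg_cont (op_norm Nd) (\<tau> 1) K + \<alpha> 2 * reg_cont Nd (\<tau> 2) b + \<alpha> 3 * (NW W)\<^sup>2 + \<alpha> 4 * (Nm c)\<^sup>2"
  define B where "B n = ?loss n + ?R" for n
  \<comment> \<open>Indexing by \<open>Suc\<close> keeps the number of layers positive; on the grid
    the sampled coefficients have error 0.\<close>
  have "(\<lambda>j. resnet \<sigma> (Suc j) (?K (Suc j)) (?b (Suc j)) x (Suc j)) \<longlonglongrightarrow> ode_flow \<sigma> K b x 1" for x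
    by (rule resnet_tendsto_ode_flow[OF Nd L\<sigma> _ H1_continuous[OF K] H1_continuous[OF b], where \<rho>=Suc])
      (use lip in \<open>auto simp: strict_mono_Suc_iff is_norm_0[OF Nd] is_norm_0[OF is_norm_op_norm[OF Nd]]\<close>)
  then have "(\<lambda>n. resnet \<sigma> n (?K n) (?b n) x n) \<longlonglongrightarrow> ode_flow \<sigma> K b x 1" for x
    by (rule LIMSEQ_imp_Suc)
  then have "?loss \<longlonglongrightarrow> (\<Sum>s = 1..S. L (h (W *v ode_flow \<sigma> K b (xs s) 1 + c)) (ys s))"
    by (intro loss_tendsto[OF h Lc] tendsto_const)
  then have "B \<longlonglongrightarrow> (\<Sum>s = 1..S. L (h (W *v ode_flow \<sigma> K b (xs s) 1 + c)) (ys s)) + ?R"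
    unfolding B_def by (intro tendsto_add tendsto_const)
  then have "B \<longlonglongrightarrow> energy\<^sub>c (K, b, W, c)" by (simp add: energy_cont_def add.assoc)
  moreover have "\<exists>\<theta>\<in>Theta_disc n. energy\<^sub>d n \<theta> \<le> B n" if n: "1 \<le> n" for n
  proof
    show "(?K n, ?b n, W, c) \<in> Theta_disc n" by (simp add: Theta_disc_def)
    have "\<alpha> 1 * reg_disc (op_norm Nd) (\<tau> 1) n (?K n) \<le> \<alpha> 1 * reg_cont (op_norm Nd) (\<tau> 1) K"
      using n weights_pos by (intro mult_left_mono reg_disc_sample_le is_norm_op_norm Nd K) auto
    moreover have "\<alpha> 2 * reg_disc Nd (\<tau> 2) n (?b n) \<le> \<alpha> 2 * reg_cont Nd (\<tau> 2) b"
      using n weights_pos by (intro mult_left_mono reg_disc_sample_le Nd b) auto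
    ultimately show "energy\<^sub>d n (?K n, ?b n, W, c) \<le> B n"
      by (simp add: energy_disc_def B_def)
  qed
  ultimately show thesis by (rule that)
qed

text \<open>Coercivity: all terms of the energy are nonnegative, so each is bounded by the total
  divided by its weight, and positive \<tau> controls the values at 0. The four parameters are
  bundled into one function into a product space, constant in the last two components; a single use
  of Arzela-Ascoli then gives a common subsequence.\<close>

lemma energy_compactness:
  assumes \<rho>: "\<And>j. 1 \<le> \<rho> j"
    and bound: "\<And>j. energy\<^sub>d (\<rho> j) (Kd j, bd j, Wd j, cd j) \<le> B"
  obtains K b W c k where "strict_mono (k :: nat \<Rightarrow> nat)"
    "continuous_on {0..1} K" "continuous_on {0..1} b" "K \<in> extensional {0..1}" "b \<in> extensional {0..1}"
    "uniform_limit {0..1} (\<lambda>j. interp (\<rho> (k j)) (Kd (k j))) K sequentially"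
    "uniform_limit {0..1} (\<lambda>j. interp (\<rho> (k j)) (bd (k j))) b sequentially"
    "(\<lambda>j. Wd (k j)) \<longlonglongrightarrow> W" "(\<lambda>j. cd (k j)) \<longlonglongrightarrow> c"
proof -
  note w = weights_pos
  note No = is_norm_op_norm[OF Nd]
  have \<rho>0: "0 < \<rho> j" for j using \<rho>[of j] by simp
  let ?I1 = "\<lambda>j. integral {0..1} (\<lambda>t. (op_norm Nd (interp_slope (\<rho> j) (Kd j) t))\<^sup>2)"
  let ?I2 = "\<lambda>j. integral {0..1} (\<lambda>t. (Nd (interp_slope (\<rho> j) (bd j) t))\<^sup>2)"
  \<comment> \<open>The sum of all quotients of the bound by a weight is one constant for every
    term. The absolute value makes the quotients nonnegative whatever the sign of
    \<open>B\<close>.\<close>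
  define B' where "B' = \<bar>B\<bar> / \<alpha> 1 + \<bar>B\<bar> / \<alpha> 2 + \<bar>B\<bar> / \<alpha> 3 + \<bar>B\<bar> / \<alpha> 4 + \<bar>B\<bar> / (\<alpha> 1 * \<tau> 1) + \<bar>B\<bar> / (\<alpha> 2 * \<tau> 2)"
  have B'_ge: "\<bar>B\<bar> / \<alpha> 1 \<le> B'" "\<bar>B\<bar> / \<alpha> 2 \<le> B'" "\<bar>B\<bar> / \<alpha> 3 \<le> B'" "\<bar>B\<bar> / \<alpha> 4 \<le> B'"
    "\<bar>B\<bar> / (\<alpha> 1 * \<tau> 1) \<le> B'" "\<bar>B\<bar> / (\<alpha> 2 * \<tau> 2) \<le> B'" "0 \<le> B'"
  proof -
    have "0 \<le> \<bar>B\<bar> / \<alpha> 1" "0 \<le> \<bar>B\<bar> / \<alpha> 2" "0 \<le> \<bar>B\<bar> / \<alpha> 3" "0 \<le> \<bar>B\<bar> / \<alpha> 4"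
      "0 \<le> \<bar>B\<bar> / (\<alpha> 1 * \<tau> 1)" "0 \<le> \<bar>B\<bar> / (\<alpha> 2 * \<tau> 2)"
      using w by auto
    then show "\<bar>B\<bar> / \<alpha> 1 \<le> B'" "\<bar>B\<bar> / \<alpha> 2 \<le> B'" "\<bar>B\<bar> / \<alpha> 3 \<le> B'" "\<bar>B\<bar> / \<alpha> 4 \<le> B'"
      "\<bar>B\<bar> / (\<alpha> 1 * \<tau> 1) \<le> B'" "\<bar>B\<bar> / (\<alpha> 2 * \<tau> 2) \<le> B'" "0 \<le> B'"
      unfolding B'_def by linarith+
  qed
  have nonneg: "0 \<le> ?I1 j" "0 \<le> ?I2 j" for j
  proof -
    have "L2_fun (interp_slope (\<rho> j) (Kd j))" "L2_fun (interp_slope (\<rho> j) (bd j))"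
      using \<rho>0 unfolding interp_slope_def by (auto intro: L2_fun_step)
    then show "0 \<le> ?I1 j" "0 \<le> ?I2 j"
      by (intro Henstock_Kurzweil_Integration.integral_nonneg lebesgue_on_integrable_on_subinterval
          L2_fun_is_norm_sq_integrable No Nd; simp)+
  qed
  have bnd: "?I1 j \<le> B'" "?I2 j \<le> B'" "(op_norm Nd (Kd j 0))\<^sup>2 \<le> B'" "(Nd (bd j 0))\<^sup>2 \<le> B'"
    "(NW (Wd j))\<^sup>2 \<le> B'" "(Nm (cd j))\<^sup>2 \<le> B'" for j
  proof -
    let ?l = "\<Sum>s = 1..S. L (h (Wd j *v resnet \<sigma> (\<rho> j) (Kd j) (bd j) (xs s) (\<rho> j) + cd j)) (ys s)"
    have "?l + \<alpha> 1 * (?I1 j + \<tau> 1 * (op_norm Nd (Kd j 0))\<^sup>2) + \<alpha> 2 * (?I2 j + \<tau> 2 * (Nd (bd j 0))\<^sup>2)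
        + \<alpha> 3 * (NW (Wd j))\<^sup>2 + \<alpha> 4 * (Nm (cd j))\<^sup>2 \<le> B"
      using bound[of j] by (simp add: energy_disc_def reg_disc_eq_interp[OF No \<rho>0] reg_disc_eq_interp[OF Nd \<rho>0])
    then have sum: "?l + \<alpha> 1 * ?I1 j + (\<alpha> 1 * \<tau> 1) * (op_norm Nd (Kd j 0))\<^sup>2 + \<alpha> 2 * ?I2 j
        + (\<alpha> 2 * \<tau> 2) * (Nd (bd j 0))\<^sup>2 + \<alpha> 3 * (NW (Wd j))\<^sup>2 + \<alpha> 4 * (Nm (cd j))\<^sup>2 \<le> \<bar>B\<bar>"
      by (simp add: distrib_left mult.assoc)
    have p: "0 \<le> ?l" "0 \<le> \<alpha> 1 * ?I1 j" "0 \<le> (\<alpha> 1 * \<tau> 1) * (op_norm Nd (Kd j 0))\<^sup>2" "0 \<le> \<alpha> 2 * ?I2 j"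
      "0 \<le> (\<alpha> 2 * \<tau> 2) * (Nd (bd j 0))\<^sup>2" "0 \<le> \<alpha> 3 * (NW (Wd j))\<^sup>2" "0 \<le> \<alpha> 4 * (Nm (cd j))\<^sup>2"
      using L0 w nonneg[of j] by (auto intro!: sum_nonneg)
    have div: "y \<le> B'" if "a * y \<le> \<bar>B\<bar>" "\<bar>B\<bar> / a \<le> B'" "0 < a" for a y
      using that by (smt (verit) mult.commute pos_le_divide_eq)
    have "\<alpha> 1 * ?I1 j \<le> \<bar>B\<bar>" "\<alpha> 2 * ?I2 j \<le> \<bar>B\<bar>" "(\<alpha> 1 * \<tau> 1) * (op_norm Nd (Kd j 0))\<^sup>2 \<le> \<bar>B\<bar>"
      "(\<alpha> 2 * \<tau> 2) * (Nd (bd j 0))\<^sup>2 \<le> \<bar>B\<bar>" "\<alpha> 3 * (NW (Wd j))\<^sup>2 \<le> \<bar>B\<bar>" "\<alpha> 4 * (Nm (cd j))\<^sup>2 \<le> \<bar>B\<bar>"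
      using sum p by linarith+
    moreover have "0 < \<alpha> 1 * \<tau> 1" "0 < \<alpha> 2 * \<tau> 2" using w by auto
    ultimately show "?I1 j \<le> B'" "?I2 j \<le> B'" "(op_norm Nd (Kd j 0))\<^sup>2 \<le> B'" "(Nd (bd j 0))\<^sup>2 \<le> B'"
      "(NW (Wd j))\<^sup>2 \<le> B'" "(Nm (cd j))\<^sup>2 \<le> B'"
      using div B'_ge w by blast+
  qed
  obtain C1 where C1: "0 < C1" "\<And>x. norm x \<le> C1 * op_norm Nd x" using norm_le_is_norm[OF No] by blast
  obtain C2 where C2: "0 < C2" "\<And>x. norm x \<le> C2 * Nd x" using norm_le_is_norm[OF Nd] by blast
  obtain C3 where C3: "0 < C3" "\<And>x. norm x \<le> C3 * NW x" using norm_le_is_norm[OF NW] by blast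
  obtain C4 where C4: "0 < C4" "\<And>x. norm x \<le> C4 * Nm x" using norm_le_is_norm[OF Nm] by blast
  let ?F = "\<lambda>j t. (interp (\<rho> j) (Kd j) t, interp (\<rho> j) (bd j) t, Wd j, cd j)"
  have norm4: "norm (a1, a2, a3, a4) \<le> norm a1 + (norm a2 + (norm a3 + norm a4))"
    for a1 :: "real^'d^'d" and a2 :: "real^'d" and a3 :: "real^'d^'m" and a4 :: "real^'m"
    using norm_Pair_le[of a1 "(a2, a3, a4)"] norm_Pair_le[of a2 "(a3, a4)"] norm_Pair_le[of a3 a4] by linarith
  have "norm (?F j t) \<le> 2 * C1 * sqrt B' + (2 * C2 * sqrt B' + (C3 * sqrt B' + C4 * sqrt B'))"
    if t: "t \<in> {0..1}" for j t
  proof -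
    have "norm (Wd j) \<le> C3 * sqrt B'"
      using C3(2)[of "Wd j"] mult_left_mono[OF real_le_rsqrt[OF bnd(5)[of j]], of C3] C3(1) by linarith
    moreover have "norm (cd j) \<le> C4 * sqrt B'"
      using C4(2)[of "cd j"] mult_left_mono[OF real_le_rsqrt[OF bnd(6)[of j]], of C4] C4(1) by linarith
    moreover have "norm (interp (\<rho> j) (Kd j) t) \<le> 2 * C1 * sqrt B'"
      by (rule interp_bounds(2)[OF No \<rho>0 C1 bnd(1,3) t t])
    moreover have "norm (interp (\<rho> j) (bd j) t) \<le> 2 * C2 * sqrt B'"
      by (rule interp_bounds(2)[OF Nd \<rho>0 C2 bnd(2,4) t t])
    ultimately show ?thesis
      using norm4[of "interp (\<rho> j) (Kd j) t" "interp (\<rho> j) (bd j) t" "Wd j" "cd j"] by linarith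
  qed
  moreover have "\<exists>d. 0 < d \<and> (\<forall>j y. y \<in> {0..1} \<and> norm (x - y) < d \<longrightarrow> norm (?F j x - ?F j y) < e)"
    if x: "x \<in> {0..1}" and e: "0 < e" for x e
  proof -
    let ?C = "C1 + C2"
    have "continuous_on UNIV (\<lambda>r. ?C * sqrt (B' * r))" by (intro continuous_intros)
    then have "((\<lambda>r. ?C * sqrt (B' * r)) \<longlongrightarrow> ?C * sqrt (B' * 0)) (at_right 0)"
      by (intro tendsto_intros)
    then have "\<forall>\<^sub>F r in at_right 0. ?C * sqrt (B' * r) < e"
      using e order_tendstoD(2)[of _ 0 "at_right 0" e] by simp
    then obtain d where d: "0 < d" "\<And>r. 0 < r \<Longrightarrow> r < d \<Longrightarrow> ?C * sqrt (B' * r) < e"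
      by (auto simp: eventually_at_right_field)
    have "norm (?F j x - ?F j y) < e" if y: "y \<in> {0..1}" "norm (x - y) < d" for j y
    proof -
      have "norm (?F j x - ?F j y) \<le> norm (interp (\<rho> j) (Kd j) x - interp (\<rho> j) (Kd j) y)
          + norm (interp (\<rho> j) (bd j) x - interp (\<rho> j) (bd j) y)"
        using norm4[of "interp (\<rho> j) (Kd j) x - interp (\<rho> j) (Kd j) y"
            "interp (\<rho> j) (bd j) x - interp (\<rho> j) (bd j) y" 0 0] by (simp add: zero_prod_def)
      also have "\<dots> \<le> C1 * sqrt (B' * \<bar>x - y\<bar>) + C2 * sqrt (B' * \<bar>x - y\<bar>)"
        by (intro add_mono interp_bounds(1)[OF No \<rho>0 C1 bnd(1,3) y(1) x]
            interp_bounds(1)[OF Nd \<rho>0 C2 bnd(2,4) y(1) x])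
      also have "\<dots> = ?C * sqrt (B' * \<bar>x - y\<bar>)" by (simp add: distrib_right)
      also have "\<dots> < e" using d(2)[of "\<bar>x - y\<bar>"] y e by (cases "x = y") auto
      finally show ?thesis .
    qed
    then show ?thesis using d(1) by blast
  qed
  ultimately obtain G k where G: "continuous_on {0..1} G" "strict_mono (k :: nat \<Rightarrow> nat)"
    "\<And>e. 0 < e \<Longrightarrow> \<exists>m. \<forall>n x. n \<ge> m \<and> x \<in> {0..1} \<longrightarrow> norm (?F (k n) x - G x) < e"
    using Arzela_Ascoli[OF compact_Icc[of 0 "1::real"], of ?F
        "2 * C1 * sqrt B' + (2 * C2 * sqrt B' + (C3 * sqrt B' + C4 * sqrt B'))"] by blast
  have U: "uniform_limit {0..1} (\<lambda>j t. ?F (k j) t) G sequentially"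
    unfolding uniform_limit_sequentially_iff dist_norm using G(3) by blast
  have p: "bounded_linear (\<lambda>z :: (real^'d^'d) \<times> (real^'d) \<times> (real^'d^'m) \<times> (real^'m). fst z)"
    "bounded_linear (\<lambda>z :: (real^'d^'d) \<times> (real^'d) \<times> (real^'d^'m) \<times> (real^'m). fst (snd z))"
    "bounded_linear (\<lambda>z :: (real^'d^'d) \<times> (real^'d) \<times> (real^'d^'m) \<times> (real^'m). fst (snd (snd z)))"
    "bounded_linear (\<lambda>z :: (real^'d^'d) \<times> (real^'d) \<times> (real^'d^'m) \<times> (real^'m). snd (snd (snd z)))"
    by (intro bounded_linear_fst_comp bounded_linear_snd_comp bounded_linear_fst bounded_linear_snd bounded_linear_ident)+
  have proj: "uniform_limit {0..1} (\<lambda>j t. q (?F (k j) t)) (\<lambda>t. q (G t)) sequentially"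
    if "bounded_linear q" for q :: "_ \<Rightarrow> 'z::real_normed_vector"
    using bounded_linear.uniform_limit[OF that U] .
  show thesis
  \<comment> \<open>Members of \<open>H1\<close> are extensional, hence the restrictions. The last
    two components are limits of constants and may be read at any point, here at 0.\<close>
  proof (rule that[OF G(2), of "\<lambda>t\<in>{0..1}. fst (G t)" "\<lambda>t\<in>{0..1}. fst (snd (G t))"
        "fst (snd (snd (G 0)))" "snd (snd (snd (G 0)))"])
    show "continuous_on {0..1} (\<lambda>t\<in>{0..1}. fst (G t))"
      by (rule continuous_on_eq[OF continuous_on_fst[OF G(1)]]) simp
    show "continuous_on {0..1} (\<lambda>t\<in>{0..1}. fst (snd (G t)))"
      by (rule continuous_on_eq[OF continuous_on_fst[OF continuous_on_snd[OF G(1)]]]) simp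
    show "uniform_limit {0..1} (\<lambda>j. interp (\<rho> (k j)) (Kd (k j))) (\<lambda>t\<in>{0..1}. fst (G t)) sequentially"
      by (rule uniform_limit_cong'[THEN iffD1, OF _ _ proj[OF p(1)]]) auto
    show "uniform_limit {0..1} (\<lambda>j. interp (\<rho> (k j)) (bd (k j))) (\<lambda>t\<in>{0..1}. fst (snd (G t))) sequentially"
      by (rule uniform_limit_cong'[THEN iffD1, OF _ _ proj[OF p(2)]]) auto
    show "(\<lambda>j. Wd (k j)) \<longlonglongrightarrow> fst (snd (snd (G 0)))"
      using tendsto_uniform_limitI[OF proj[OF p(3)], of 0] by simp
    show "(\<lambda>j. cd (k j)) \<longlonglongrightarrow> snd (snd (snd (G 0)))"
      using tendsto_uniform_limitI[OF proj[OF p(4)], of 0] by simp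
  qed auto
qed

text \<open>The order of the limits matters: first \<open>j\<close> tends to infinity with the
  dyadic grid frozen, where Riesz sums are continuous; only then is the grid refined, and the sums
  of the limit function tend to its energy.\<close>

lemma energy_liminf:
  assumes \<rho>: "strict_mono \<rho>" "\<And>j. 1 \<le> \<rho> j"
    and K: "continuous_on {0..1} K" "K \<in> extensional {0..1}"
    and b: "continuous_on {0..1} b" "b \<in> extensional {0..1}"
    and UK: "uniform_limit {0..1} (\<lambda>j. interp (\<rho> j) (Kd j)) K sequentially"
    and Ub: "uniform_limit {0..1} (\<lambda>j. interp (\<rho> j) (bd j)) b sequentially"
    and W: "Wd \<longlonglongrightarrow> W" and c: "cd \<longlonglongrightarrow> c"
    and B: "\<And>j. energy\<^sub>d (\<rho> j) (Kd j, bd j, Wd j, cd j) \<le> B j" "B \<longlonglongrightarrow> M"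
  shows "(K, b, W, c) \<in> Theta" and "energy\<^sub>c (K, b, W, c) \<le> M"
proof -
  note w = weights_pos
  note No = is_norm_op_norm[OF Nd]
  have \<rho>0: "0 < \<rho> j" for j using \<rho>(2)[of j] by simp
  let ?u = "\<lambda>j. interp (\<rho> j) (Kd j)" and ?v = "\<lambda>j. interp (\<rho> j) (bd j)"
  let ?l = "\<lambda>j. \<Sum>s = 1..S. L (h (Wd j *v resnet \<sigma> (\<rho> j) (Kd j) (bd j) (xs s) (\<rho> j) + cd j)) (ys s)"
  let ?l' = "\<Sum>s = 1..S. L (h (W *v ode_flow \<sigma> K b (xs s) 1 + c)) (ys s)"
  have limu: "(\<lambda>j. ?u j t) \<longlonglongrightarrow> K t" and limv: "(\<lambda>j. ?v j t) \<longlonglongrightarrow> b t" if "t \<in> {0..1}" for t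
    using tendsto_uniform_limitI[OF UK that] tendsto_uniform_limitI[OF Ub that] .
  have "(\<lambda>j. resnet \<sigma> (\<rho> j) (Kd j) (bd j) x (\<rho> j)) \<longlonglongrightarrow> ode_flow \<sigma> K b x 1" for x
    using lip interp_limit_grid[OF No UK] interp_limit_grid[OF Nd Ub]
    by (intro resnet_tendsto_ode_flow[OF Nd L\<sigma> _ K(1) b(1) \<rho>(1) \<rho>0]) auto
  then have loss: "?l \<longlonglongrightarrow> ?l'" by (intro loss_tendsto[OF h Lc W c])
  have le: "?l j + \<alpha> 1 * (riesz_sum (op_norm Nd) (2 ^ m) (?u j) + \<tau> 1 * (op_norm Nd (?u j 0))\<^sup>2)
      + \<alpha> 2 * (riesz_sum Nd (2 ^ m) (?v j) + \<tau> 2 * (Nd (?v j 0))\<^sup>2)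
      + \<alpha> 3 * (NW (Wd j))\<^sup>2 + \<alpha> 4 * (Nm (cd j))\<^sup>2 \<le> B j" for j m
  proof -
    have "\<alpha> 1 * (riesz_sum (op_norm Nd) (2 ^ m) (?u j) + \<tau> 1 * (op_norm Nd (?u j 0))\<^sup>2)
        \<le> \<alpha> 1 * reg_disc (op_norm Nd) (\<tau> 1) (\<rho> j) (Kd j)"
      unfolding reg_disc_eq_interp[OF No \<rho>0] interp_0 using w
      by (intro mult_left_mono add_right_mono riesz_sum_le[OF No interp_primitive[OF \<rho>0]]) auto
    moreover have "\<alpha> 2 * (riesz_sum Nd (2 ^ m) (?v j) + \<tau> 2 * (Nd (?v j 0))\<^sup>2)
        \<le> \<alpha> 2 * reg_disc Nd (\<tau> 2) (\<rho> j) (bd j)"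
      unfolding reg_disc_eq_interp[OF Nd \<rho>0] interp_0 using w
      by (intro mult_left_mono add_right_mono riesz_sum_le[OF Nd interp_primitive[OF \<rho>0]]) auto
    ultimately show ?thesis using B(1)[of j] by (simp add: energy_disc_def)
  qed
  \<comment> \<open>Nonnegativity of the remaining terms turns a bound on the energies into one on
    the Riesz sums, uniform in \<open>j\<close> and \<open>m\<close>; this is what puts the limits
    into \<open>H1\<close>.\<close>
  obtain M' where M': "\<And>j. \<bar>B j\<bar> \<le> M'"
    using convergent_imp_Bseq[OF convergentI[OF B(2)]] by (auto simp: Bseq_def)
  have bdd: "riesz_sum (op_norm Nd) (2 ^ m) (?u j) \<le> M' / \<alpha> 1" "riesz_sum Nd (2 ^ m) (?v j) \<le> M' / \<alpha> 2" for j m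
  proof -
    have "0 \<le> ?l j" using L0 by (auto intro: sum_nonneg)
    moreover have "0 \<le> riesz_sum (op_norm Nd) (2 ^ m) (?u j)" "0 \<le> riesz_sum Nd (2 ^ m) (?v j)"
      by (auto simp: riesz_sum_def intro!: mult_nonneg_nonneg sum_nonneg)
    then have "0 \<le> \<alpha> 1 * riesz_sum (op_norm Nd) (2 ^ m) (?u j)" "0 \<le> \<alpha> 2 * riesz_sum Nd (2 ^ m) (?v j)"
      using w by auto
    moreover have "0 \<le> \<alpha> 1 * (\<tau> 1 * (op_norm Nd (?u j 0))\<^sup>2)" "0 \<le> \<alpha> 2 * (\<tau> 2 * (Nd (?v j 0))\<^sup>2)"
      "0 \<le> \<alpha> 3 * (NW (Wd j))\<^sup>2" "0 \<le> \<alpha> 4 * (Nm (cd j))\<^sup>2" using w by auto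
    moreover have "B j \<le> M'" using M'[of j] by simp
    ultimately have "\<alpha> 1 * riesz_sum (op_norm Nd) (2 ^ m) (?u j) \<le> M'" "\<alpha> 2 * riesz_sum Nd (2 ^ m) (?v j) \<le> M'"
      using le[of j m] unfolding distrib_left by linarith+
    then show "riesz_sum (op_norm Nd) (2 ^ m) (?u j) \<le> M' / \<alpha> 1" "riesz_sum Nd (2 ^ m) (?v j) \<le> M' / \<alpha> 2"
      using w by (auto simp: pos_le_divide_eq mult.commute)
  qed
  note HK = riesz_sum_limit_H1[where U="?u", OF No K(2,1) limu bdd(1)]
  note Hb = riesz_sum_limit_H1[where U="?v", OF Nd b(2,1) limv bdd(2)]
  show "(K, b, W, c) \<in> Theta" using HK(1) Hb(1) by (simp add: Theta_def)
  have "?l' + \<alpha> 1 * (riesz_sum (op_norm Nd) (2 ^ m) K + \<tau> 1 * (op_norm Nd (K 0))\<^sup>2)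
      + \<alpha> 2 * (riesz_sum Nd (2 ^ m) b + \<tau> 2 * (Nd (b 0))\<^sup>2) + \<alpha> 3 * (NW W)\<^sup>2 + \<alpha> 4 * (Nm c)\<^sup>2 \<le> M" for m
  proof (rule LIMSEQ_le[OF _ B(2)])
    show "(\<lambda>j. ?l j + \<alpha> 1 * (riesz_sum (op_norm Nd) (2 ^ m) (?u j) + \<tau> 1 * (op_norm Nd (?u j 0))\<^sup>2)
      + \<alpha> 2 * (riesz_sum Nd (2 ^ m) (?v j) + \<tau> 2 * (Nd (?v j 0))\<^sup>2)
      + \<alpha> 3 * (NW (Wd j))\<^sup>2 + \<alpha> 4 * (Nm (cd j))\<^sup>2)
      \<longlonglongrightarrow> ?l' + \<alpha> 1 * (riesz_sum (op_norm Nd) (2 ^ m) K + \<tau> 1 * (op_norm Nd (K 0))\<^sup>2)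
      + \<alpha> 2 * (riesz_sum Nd (2 ^ m) b + \<tau> 2 * (Nd (b 0))\<^sup>2) + \<alpha> 3 * (NW W)\<^sup>2 + \<alpha> 4 * (Nm c)\<^sup>2"
      by (intro tendsto_add tendsto_mult tendsto_power tendsto_const loss W c
          riesz_sum_tendsto[OF No _ limu] riesz_sum_tendsto[OF Nd _ limv]
          is_norm_tendsto[OF No] is_norm_tendsto[OF Nd] is_norm_tendsto[OF NW] is_norm_tendsto[OF Nm]
          limu limv) auto
  qed (use le in blast)
  moreover have "(\<lambda>m. ?l' + \<alpha> 1 * (riesz_sum (op_norm Nd) (2 ^ m) K + \<tau> 1 * (op_norm Nd (K 0))\<^sup>2)
      + \<alpha> 2 * (riesz_sum Nd (2 ^ m) b + \<tau> 2 * (Nd (b 0))\<^sup>2) + \<alpha> 3 * (NW W)\<^sup>2 + \<alpha> 4 * (Nm c)\<^sup>2)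
      \<longlonglongrightarrow> energy\<^sub>c (K, b, W, c)"
    unfolding energy_cont_def reg_cont_def prod.case
    by (intro tendsto_add tendsto_mult tendsto_const HK(2) Hb(2))
  ultimately show "energy\<^sub>c (K, b, W, c) \<le> M" by (intro LIMSEQ_le_const2) auto
qed

text \<open>If the claim fails, the exceptional \<open>n\<close> form a sequence along which
  compactness applies. The recovery bounds for the minimiser are the upper bounds in the liminf
  inequality, so the limit is again a minimiser; identifying it contradicts the choice of the
  sequence.\<close>

lemma minimisers_tendsto:
  assumes min: "\<forall>n\<ge>1. is_arg_min (energy\<^sub>d n) (\<lambda>\<theta>. \<theta> \<in> Theta_disc n) (Kn n, bn n, Wn n, cn n)"
    and inf: "is_arg_min energy\<^sub>c (\<lambda>\<theta>. \<theta> \<in> Theta) (K, b, W, c)"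
    and uniq: "\<forall>\<theta>'. is_arg_min energy\<^sub>c (\<lambda>\<theta>. \<theta> \<in> Theta) \<theta>' \<longrightarrow> \<theta>' = (K, b, W, c)"
    and e: "0 < e"
  shows "\<forall>\<^sub>F n in sequentially. \<forall>i<n. op_norm Nd (Kn n i - K (real i / real n)) \<le> e \<and> Nd (bn n i - b (real i / real n)) \<le> e"
proof (rule ccontr)
  note No = is_norm_op_norm[OF Nd]
  let ?P = "\<lambda>n. \<forall>i<n. op_norm Nd (Kn n i - K (real i / real n)) \<le> e \<and> Nd (bn n i - b (real i / real n)) \<le> e"
  assume "\<not> eventually ?P sequentially"
  define A where "A = {n. \<not> ?P n}"
  have "infinite A"
    using \<open>\<not> eventually ?P sequentially\<close>
    unfolding A_def cofinite_eq_sequentially[symmetric] eventually_cofinite .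
  from infinite_enumerate[OF this] obtain \<rho> :: "nat \<Rightarrow> nat" where \<rho>: "strict_mono \<rho>" "\<And>j. \<rho> j \<in> A"
    by auto
  \<comment> \<open>For \<open>n = 0\<close> the property is vacuous, so 0 is not
    exceptional.\<close>
  have \<rho>1: "1 \<le> \<rho> j" for j using \<rho>(2)[of j] by (cases "\<rho> j") (auto simp: A_def)
  have Th: "(K, b, W, c) \<in> Theta" using inf by (simp add: is_arg_min_def)
  obtain B where B: "B \<longlonglongrightarrow> energy\<^sub>c (K, b, W, c)" "\<And>n. 1 \<le> n \<Longrightarrow> \<exists>\<theta>\<in>Theta_disc n. energy\<^sub>d n \<theta> \<le> B n"
    using energy_recovery[OF Th] by blast
  have EB: "energy\<^sub>d n (Kn n, bn n, Wn n, cn n) \<le> B n" if n: "1 \<le> n" for n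
  proof -
    obtain \<theta> where \<theta>: "\<theta> \<in> Theta_disc n" "energy\<^sub>d n \<theta> \<le> B n" using B(2)[OF n] by blast
    have "\<not> energy\<^sub>d n \<theta> < energy\<^sub>d n (Kn n, bn n, Wn n, cn n)" using min n \<theta>(1) unfolding is_arg_min_def by blast
    then show ?thesis using \<theta>(2) by simp
  qed
  obtain M' where M': "\<And>n. \<bar>B n\<bar> \<le> M'"
    using convergent_imp_Bseq[OF convergentI[OF B(1)]] by (auto simp: Bseq_def)
  have EM: "energy\<^sub>d (\<rho> j) (Kn (\<rho> j), bn (\<rho> j), Wn (\<rho> j), cn (\<rho> j)) \<le> M'" for j
    using EB[OF \<rho>1[of j]] M'[of "\<rho> j"] by simp
  obtain K' b' W' c' k where k: "strict_mono (k :: nat \<Rightarrow> nat)"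
    and lim: "continuous_on {0..1} K'" "continuous_on {0..1} b'" "K' \<in> extensional {0..1}" "b' \<in> extensional {0..1}"
    "uniform_limit {0..1} (\<lambda>j. interp (\<rho> (k j)) (Kn (\<rho> (k j)))) K' sequentially"
    "uniform_limit {0..1} (\<lambda>j. interp (\<rho> (k j)) (bn (\<rho> (k j)))) b' sequentially"
    "(\<lambda>j. Wn (\<rho> (k j))) \<longlonglongrightarrow> W'" "(\<lambda>j. cn (\<rho> (k j))) \<longlonglongrightarrow> c'"
    by (rule energy_compactness[where \<rho>=\<rho> and Kd="\<lambda>j. Kn (\<rho> j)" and bd="\<lambda>j. bn (\<rho> j)"
          and Wd="\<lambda>j. Wn (\<rho> j)" and cd="\<lambda>j. cn (\<rho> j)", OF \<rho>1 EM])
  have mono: "strict_mono (\<lambda>j. \<rho> (k j))" using strict_mono_o[OF \<rho>(1) k] by (simp add: o_def)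
  have BM: "(\<lambda>j. B (\<rho> (k j))) \<longlonglongrightarrow> energy\<^sub>c (K, b, W, c)"
    using LIMSEQ_subseq_LIMSEQ[OF B(1) mono] by (simp add: o_def)
  note liminf = energy_liminf[OF mono \<rho>1 lim(1,3,2,4,5,6,7,8) EB[OF \<rho>1] BM]
  have "is_arg_min energy\<^sub>c (\<lambda>\<theta>. \<theta> \<in> Theta) (K', b', W', c')"
    using liminf inf unfolding is_arg_min_def by (meson order_less_le_trans)
  then have eq: "K' = K" "b' = b" using uniq by auto
  have "\<forall>\<^sub>F j in sequentially. ?P (\<rho> (k j))"
    using interp_limit_grid[OF No lim(5) e] interp_limit_grid[OF Nd lim(6) e]
    by eventually_elim (auto simp: eq)
  then obtain j where "?P (\<rho> (k j))" by (auto simp: eventually_sequentially)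
  then show False using \<rho>(2)[of "k j"] unfolding A_def by blast
qed

end

section \<open>The error estimate for trained networks\<close>

theorem corollary2p5:
  fixes Nd :: "real^'d::finite \<Rightarrow> real"
    and NW :: "real^'d^'m::finite \<Rightarrow> real"
    and Nm :: "real^'m \<Rightarrow> real"
    and \<sigma> :: "real^'d \<Rightarrow> real^'d"
    and h :: "real^'m \<Rightarrow> real^'m"
    and L :: "real^'m \<Rightarrow> real^'m \<Rightarrow> real"
    and \<alpha> \<tau> :: "nat \<Rightarrow> real"
    and L\<^sub>\<sigma> :: real
    and S :: nat
    and xs :: "nat \<Rightarrow> real^'d" and ys :: "nat \<Rightarrow> real^'m"
    and Kn :: "nat \<Rightarrow> nat \<Rightarrow> real^'d^'d" and bn :: "nat \<Rightarrow> nat \<Rightarrow> real^'d"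
    and Wn :: "nat \<Rightarrow> real^'d^'m" and cn :: "nat \<Rightarrow> real^'m"
    and K :: "real \<Rightarrow> real^'d^'d" and b :: "real \<Rightarrow> real^'d"
    and W :: "real^'d^'m" and c :: "real^'m"
    and x :: "real^'d"
    and Xn :: "nat \<Rightarrow> nat \<Rightarrow> real^'d" and X :: "real \<Rightarrow> real^'d"
  assumes "is_norm Nd" and "is_norm NW" and "is_norm Nm"
    and "1 \<le> S"
    and "\<forall>i\<in>{1..4}. 0 < \<alpha> i" and "\<forall>j\<in>{1..2}. 0 < \<tau> j"
    and "continuous_on UNIV h"
    and "0 < L\<^sub>\<sigma>" and "\<forall>u v. Nd (\<sigma> u - \<sigma> v) \<le> L\<^sub>\<sigma> * Nd (u - v)"
    and "\<exists>\<sigma>'::real \<Rightarrow> real. \<forall>u. \<sigma> u = (\<chi> i. \<sigma>' (u $ i))"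
    and "\<sigma> 0 = 0"
    and "\<forall>u v. 0 \<le> L u v" and "\<forall>v. continuous_on UNIV (\<lambda>u. L u v)"
    and "\<forall>n\<ge>1. is_arg_min (energy_disc Nd NW Nm \<sigma> h L \<alpha> \<tau> S xs ys n)
           (\<lambda>\<theta>. \<theta> \<in> Theta_disc n) (Kn n, bn n, Wn n, cn n)"
    and "is_arg_min (energy_cont Nd NW Nm \<sigma> h L \<alpha> \<tau> S xs ys)
           (\<lambda>\<theta>. \<theta> \<in> Theta) (K, b, W, c)"
    and "\<forall>\<theta>'. is_arg_min (energy_cont Nd NW Nm \<sigma> h L \<alpha> \<tau> S xs ys)
           (\<lambda>\<theta>. \<theta> \<in> Theta) \<theta>' \<longrightarrow> \<theta>' = (K, b, W, c)"
    and "\<forall>n\<ge>1. Xn n 0 = x \<and>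
           (\<forall>i<n. Xn n (Suc i) = Xn n i + (1 / real n) *\<^sub>R \<sigma> (Kn n i *v Xn n i + bn n i))"
    and "ode_solution \<sigma> K b x X"
  shows "\<forall>\<delta>>0. \<exists>N\<ge>1. \<exists>\<epsilon>::nat \<Rightarrow> real.
           (\<forall>n\<ge>N. \<forall>i\<le>n.
              Nd (X (real i / real n) - Xn n i)
              \<le> real n / (L\<^sub>\<sigma> * (Linf_norm (op_norm Nd) K + \<delta>))
                * (1 / real n * (1 + Linf_norm Nd X) * L\<^sub>\<sigma> * \<delta> + \<epsilon> n)
                * (exp (real i / real n * L\<^sub>\<sigma> * (Linf_norm (op_norm Nd) K + \<delta>)) - 1))
           \<and> \<epsilon> \<in> o(\<lambda>n. 1 / real n)"
proof (intro allI impI)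
  fix \<delta> :: real assume \<delta>: "0 < \<delta>"
  note Nd = assms(1) and lip = assms(9)[rule_format]
  note No = is_norm_op_norm[OF Nd]
  have "(K, b, W, c) \<in> Theta" using assms(15) by (simp add: is_arg_min_def)
  then have cK: "continuous_on {0..1} K" and cb: "continuous_on {0..1} b"
    by (auto simp: Theta_def H1_continuous)
  let ?X' = "\<lambda>t. \<sigma> (K t *v X t + b t)"
  have X0: "X 0 = x" and X: "\<And>t. t \<in> {0..1} \<Longrightarrow> (X has_vector_derivative ?X' t) (at t within {0..1})"
    using assms(18) by (auto simp: ode_solution_def)
  have cX: "continuous_on {0..1} X"
    using X by (meson continuous_on_eq_continuous_within has_vector_derivative_continuous)
  have cX': "continuous_on {0..1} ?X'" by (rule vector_field_continuous[OF Nd assms(8) lip cK cb cX])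
  let ?\<kappa> = "Linf_norm (op_norm Nd) K + \<delta>"
  have "\<forall>\<^sub>F n in sequentially. \<forall>i<n. op_norm Nd (Kn n i - K (real i / real n)) \<le> \<delta> \<and> Nd (bn n i - b (real i / real n)) \<le> \<delta>"
    by (rule minimisers_tendsto[OF assms(1-3,5-9,12-16) \<delta>])
  then obtain N where N: "\<And>n i. N \<le> n \<Longrightarrow> i < n \<Longrightarrow> op_norm Nd (Kn n i - K (real i / real n)) \<le> \<delta> \<and> Nd (bn n i - b (real i / real n)) \<le> \<delta>"
    unfolding eventually_sequentially by blast
  \<comment> \<open>\<open>K\<close> may vanish identically; strict positivity of the rate comes
    from \<delta>.\<close>
  have \<kappa>0: "0 < ?\<kappa>"
    using Linf_norm_ge[OF No cK, of 0] is_norm_ge0[OF No, of "K 0"] \<delta> by simp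
  have bound: "Nd (X (real i / real n) - Xn n i)
      \<le> real n / (L\<^sub>\<sigma> * ?\<kappa>) * (1 / real n * (1 + Linf_norm Nd X) * L\<^sub>\<sigma> * \<delta> + euler_defect Nd X ?X' n)
        * (exp (real i / real n * L\<^sub>\<sigma> * ?\<kappa>) - 1)" if n: "max 1 N \<le> n" and i: "i \<le> n" for n i
  proof (rule euler_error[OF Nd assms(8) lip, where Kn="Kn n" and bn="bn n" and K=K and b=b])
    show "0 < n" using n by simp
    show "Xn n 0 = X 0" "\<And>i. i < n \<Longrightarrow> Xn n (Suc i) = Xn n i + (1 / real n) *\<^sub>R \<sigma> (Kn n i *v Xn n i + bn n i)"
      using assms(17) n X0 by auto
    have unit: "real i / real n \<in> {0..1}" if "i < n" for i using that by auto
    show "op_norm Nd (Kn n i) \<le> ?\<kappa>" if "i < n" for i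
      using is_norm_triangle[OF No, of "Kn n i - K (real i / real n)" "K (real i / real n)"]
        N[of n i] n that Linf_norm_ge[OF No cK unit[OF that]] by simp
    show "Nd (X (real i / real n)) \<le> Linf_norm Nd X" if "i < n" for i
      by (rule Linf_norm_ge[OF Nd cX unit[OF that]])
    show "op_norm Nd (Kn n i - K (real i / real n)) \<le> \<delta>" "Nd (bn n i - b (real i / real n)) \<le> \<delta>" if "i < n" for i
      using N[of n i] n that by auto
    show "Nd (X (real (Suc i) / real n) - X (real i / real n)
        - (1 / real n) *\<^sub>R \<sigma> (K (real i / real n) *v X (real i / real n) + b (real i / real n)))
        \<le> euler_defect Nd X ?X' n" if "i < n" for i
      using euler_defect_ge[OF that, of Nd X ?X'] by simp
  qed (use \<kappa>0 i in auto)
  have "euler_defect Nd X ?X' \<in> o(\<lambda>n. 1 / real n)"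
  proof (rule smalloI_tendsto)
    have "(\<lambda>n. real n * euler_defect Nd X ?X' n) \<longlonglongrightarrow> 0"
      by (rule euler_defect_tendsto[OF Nd X cX'])
    then show "(\<lambda>n. euler_defect Nd X ?X' n / (1 / real n)) \<longlonglongrightarrow> 0" by (simp add: mult.commute)
    \<comment> \<open>At \<open>n = 0\<close> the reference function is \<open>1 / 0\<close>, which
      is 0, so it is nonzero only eventually.\<close>
    show "\<forall>\<^sub>F n in sequentially. 1 / real n \<noteq> 0"
      using eventually_gt_at_top[of 0] by eventually_elim simp
  qed
  then show "\<exists>N\<ge>1. \<exists>\<epsilon>::nat \<Rightarrow> real.
           (\<forall>n\<ge>N. \<forall>i\<le>n.
              Nd (X (real i / real n) - Xn n i)
              \<le> real n / (L\<^sub>\<sigma> * ?\<kappa>)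
                * (1 / real n * (1 + Linf_norm Nd X) * L\<^sub>\<sigma> * \<delta> + \<epsilon> n)
                * (exp (real i / real n * L\<^sub>\<sigma> * ?\<kappa>) - 1))
           \<and> \<epsilon> \<in> o(\<lambda>n. 1 / real n)"
    using bound by (intro exI[of _ "max 1 N"] conjI exI[of _ "euler_defect Nd X ?X'"]) auto
qed

end
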